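(* Let $T\in\mathcal{T}_{\mathrm{BV}}$. If $T$ is not topologically transitive, then there exist $p,q\in\mathbb{N}$ and a regular $p,q$-invariant graph for $T$ (equivalently, a $p,q$-invariant open tube for $T$). In particular, $\rho_T$ depends rationally on $\omega$: $\rho_T=\frac{k}{q}\omega+\frac{l}{pq}\bmod1$ for suitable integers $k,l$.
   Context: $\mathbb{T}^1=\mathbb{R}/\mathbb{Z}$, $\mathbb{T}^2=\mathbb{T}^1\times\mathbb{T}^1$, $\omega\in[0,1)$ irrational. $\mathcal{T}_{\mathrm{BV}}$: maps $T(\theta,x)=(\theta+\omega,T_\theta(x))$ on $\mathbb{T}^2$, homotopic to the identity, with fibre maps orientation-preserving $C^1$ circle diffeomorphisms, $DT_\theta(x)$ continuous in $(\theta,x)$, and $V(T):=\int_{\mathbb{T}^1}V_\theta\,d\theta<\infty$, where $V_\theta$ is the total variation of $\log DT_\theta$ over the circle. $T$ is topologically transitive if for all nonempty open $U,V\subseteq\mathbb{T}^2$ there is $n\in\mathbb{N}$ with $T^{-n}U\cap V\neq\emptyset$. Fibrewise rotation number: for a lift $\hat T$ of $T$ to $\mathbb{T}^1\times\mathbb{R}$, $\rho_T:=\lim_{n\to\infty}\frac1n(\hat T^n_\theta(\hat x)-\hat x)\bmod1$ (exists, independent of $\theta,\hat x$, lift). $q$-curve: point set $\{(\hat\theta\bmod1,\hat\gamma(\hat\theta)\bmod1):\hat\theta\in\mathbb{R}\}$ of a continuous $\hat\gamma:\mathbb{R}\to\mathbb{R}$ with $\hat\gamma(\hat\theta+q)-\hat\gamma(\hat\theta)\in\mathbb{Z}$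 constant and $\hat\gamma(\hat\theta+l)-\hat\gamma(\hat\theta)\notin\mathbb{Z}$ for $1\le l<q$; it meets each fibre in points $\gamma_1(\theta),\dots,\gamma_q(\theta)$. An open $T$-invariant set $U$ is a $1,q$-invariant open tube if each fibre $U_\theta$ consists of $q$ disjoint nonempty open intervals and $U$ is connected; if $U^1$ is a $1,q$-invariant open tube for $T^p$ and $U^i:=T^{i-1}(U^1)$, $i=1,\dots,p$, are pairwise disjoint, $U=\bigcup_iU^i$ is a $p,q$-invariant open tube. Each $U^i$ contains a $q$-curve $\gamma^i$ with exactly one of its points in each interval of $U^i_\theta$. A regular $p,q$-invariant graph is the boundary line of a $p,q$-invariant open tube: $\varphi^i_j(\theta)=\gamma^i_j(\theta)+\inf\{x\in[0,1):\gamma^i_j(\theta)+x\notin U_\theta\}$ (or the analogous lower boundary $\gamma^i_j(\theta)-\sup\{x\in[0,1):\gamma^i_j(\theta)-x\notin U_\theta\}$). *)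

theory Defs
  imports "HOL-Analysis.Analysis"
begin

text \<open>The torus T^2 = R^2/Z^2, realised concretely as a subset of C x C via
  the covering map tor (the standard embedding, a homeomorphism onto its image).\<close>
definition tor :: "real \<times> real \<Rightarrow> complex \<times> complex" where
  "tor z = (cis (2 * pi * fst z), cis (2 * pi * snd z))"

definition Torus :: "(complex \<times> complex) set" where
  "Torus = range tor"

text \<open>Lift to R x R of the skew product T(theta,x) = (theta + omega, T_theta(x)),
  given by a lift F of the fibre maps.\<close>
definition liftmap :: "real \<Rightarrow> (real \<Rightarrow> real \<Rightarrow> real) \<Rightarrow> real \<times> real \<Rightarrow> real \<times> real" where
  "liftmap \<omega> F z = (fst z + \<omega>, F (fst z) (snd z))"

definition torus_map :: "real \<Rightarrow> (real \<Rightarrow> real \<Rightarrow> real) \<Rightarrow> complex \<times> complex \<Rightarrow> complex \<times> complex" where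
  "torus_map \<omega> F z = tor (liftmap \<omega> F (SOME w. tor w = z))"

definition total_variation :: "(real \<Rightarrow> real) \<Rightarrow> real \<Rightarrow> real \<Rightarrow> ennreal" where
  "total_variation f a b =
     (SUP nt \<in> {(n::nat, t::nat \<Rightarrow> real). t 0 = a \<and> t n = b \<and> (\<forall>i<n. t i \<le> t (Suc i))}.
        ennreal (\<Sum>i<fst nt. \<bar>f (snd nt (Suc i)) - f (snd nt i)\<bar>))"

text \<open>The class T_BV, expressed through a lift F : R x R -> R of the fibre maps.
  F(theta+1,x) = F(theta,x) (homotopic to identity), F(theta,x+1) = F(theta,x)+1
  (degree one), C^1 with continuous positive derivative DF (orientation preserving
  C^1 diffeomorphisms), and V(T) = integral of the variation of log DF_theta finite.\<close>
definition in_TBV :: "(real \<Rightarrow> real \<Rightarrow> real) \<Rightarrow> bool" where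
  "in_TBV F \<longleftrightarrow>
     (\<forall>\<theta> x. F (\<theta> + 1) x = F \<theta> x) \<and>
     (\<forall>\<theta> x. F \<theta> (x + 1) = F \<theta> x + 1) \<and>
     continuous_on UNIV (\<lambda>z. F (fst z) (snd z)) \<and>
     (\<exists>DF. continuous_on UNIV (\<lambda>z. DF (fst z) (snd z)) \<and>
        (\<forall>\<theta> x. (F \<theta> has_real_derivative DF \<theta> x) (at x) \<and> DF \<theta> x > 0) \<and>
        (\<integral>\<^sup>+ \<theta>\<in>{0..1}. total_variation (\<lambda>x. ln (DF \<theta> x)) 0 1 \<partial>lborel) < \<infinity>)"

definition top_transitive :: "(complex \<times> complex \<Rightarrow> complex \<times> complex) \<Rightarrow> bool" where
  "top_transitive G \<longleftrightarrow>
     (\<forall>U V. openin (top_of_set Torus) U \<longrightarrow> openin (top_of_set Torus) V \<longrightarrow>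
        U \<noteq> {} \<longrightarrow> V \<noteq> {} \<longrightarrow> (\<exists>n\<ge>1. (G ^^ n) -` U \<inter> V \<noteq> {}))"

definition fibre :: "(complex \<times> complex) set \<Rightarrow> real \<Rightarrow> complex set" where
  "fibre U \<theta> = {y. (cis (2 * pi * \<theta>), y) \<in> U}"

definition open_tube1 :: "(complex \<times> complex \<Rightarrow> complex \<times> complex) \<Rightarrow> nat \<Rightarrow> (complex \<times> complex) set \<Rightarrow> bool" where
  "open_tube1 G q U \<longleftrightarrow>
     openin (top_of_set Torus) U \<and> G ` U = U \<and> connected U \<and>
     (\<forall>\<theta>. card (components (fibre U \<theta>)) = q \<and>
           (\<forall>C\<in>components (fibre U \<theta>). C \<noteq> sphere 0 1))"

definition open_tube :: "(complex \<times> complex \<Rightarrow> complex \<times> complex) \<Rightarrow> nat \<Rightarrow> nat \<Rightarrow> (complex \<times> complex) set \<Rightarrow> bool" where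
  "open_tube G p q U \<longleftrightarrow>
     (\<exists>U1. open_tube1 (G ^^ p) q U1 \<and>
        (\<forall>i\<in>{1..p}. \<forall>j\<in>{1..p}. i \<noteq> j \<longrightarrow> (G ^^ (i - 1)) ` U1 \<inter> (G ^^ (j - 1)) ` U1 = {}) \<and>
        U = (\<Union>i\<in>{1..p}. (G ^^ (i - 1)) ` U1))"

definition rot_number :: "real \<Rightarrow> (real \<Rightarrow> real \<Rightarrow> real) \<Rightarrow> real" where
  "rot_number \<omega> F = frac (lim (\<lambda>n. (snd ((liftmap \<omega> F ^^ n) (0, 0)) - 0) / real n))"

end

(* Work with the lift of T to the plane, on which Z^3 acts by (n, m, k) |-> T^n followed by translation by
(m, k).  If T is not transitive, two small boxes never meet under iteration; by the intermediate value
theorem the iterates of a horizontal segment then oscillate boundedly over a fixed interval, and by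
minimality of the rotation T^n moves every point vertically by n*rho up to a uniform error.  Hence
H z = sup_n (snd (T^n z) - n*rho) is a lower semicontinuous function, monotone on fibres, that conjugates
the action of (n, m, k) to addition of n*rho + k.

If p*q*rho = p*k*omega + w, then H - (k/q)*theta changes by multiples of 1/(p*q) under the action, and the
interior of a sublevel set minus the sublevel set 1/(p*q) below it is an invariant open strip with
interval fibres, which projects to the tube.

Otherwise 1, omega, rho are rationally independent, and this is contradictory.  If every box returns to
itself, the two boxes generate invariant curves along non-parallel directions, which intersect by Brouwer's
theorem.  If some box is wandering, its translates cannot cross one another, and by Kronecker's theorem this
forces H to be affine on the box.  The order of the translates above the box is then that of a linear
functional, so at a closest return n the regions between the box and its n-th preimage have disjoint images up to time n - 1.
Integrating the distortion over these regions bounds it by V(T), as in Denjoy's theorem, so that the n-th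
and (-n)-th images of the box cannot both be small, although all images are disjoint. *)

theory Submission
  imports Defs
begin

section \<open>Lifts of skew products\<close>

text \<open>The rotation in the base is irrational, so no fibre ever returns to itself. Returns are
  therefore taken in Z^3, with a small horizontal shift allowed, and "between the box and its
  preimage" has a meaning only after heights over different base points have been compared. This is
  why H must be affine on the box: its slope corrects the order of the translates for the horizontal
  shift. The second obstacle is that the variation V_theta is merely integrable, so the variations
  of the fibres visited by a single orbit have no useful bound. If the defects of n steps are
  integrated over the width of the box, the i-th step can be read on the fibre tau = theta +
  i*omega. For fixed tau the contributions come from intervals that are disjoint modulo 1, and
  integration over tau leaves one copy of V(T). The distortion is thus bounded only on average, and
  convexity of exp turns this into a lower bound for areas instead of lengths.\<close>

definition zpow :: "('a \<Rightarrow> 'a) \<Rightarrow> int \<Rightarrow> 'a \<Rightarrow> 'a" where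
  "zpow f n = (if 0 \<le> n then f ^^ nat n else inv f ^^ nat (- n))"

lemma zpow_0 [simp]: "zpow f 0 x = x"
  by (simp add: zpow_def)

lemma zpow_of_nat: "zpow f (int n) = f ^^ n"
  by (simp add: zpow_def)

lemma zpow_add_1:
  assumes "bij f"
  shows "zpow f (n + 1) x = f (zpow f n x)"
proof (cases "0 \<le> n")
  case True
  then show ?thesis by (simp add: zpow_def nat_add_distrib)
next
  case False
  define k where "k = nat (- (n + 1))"
  have k: "nat (- n) = Suc k" "nat (- (n + 1)) = k"
    using False unfolding k_def by linarith+
  have "f (zpow f n x) = f (inv f ((inv f ^^ k) x))"
    using False k by (simp add: zpow_def)
  also have "\<dots> = (inv f ^^ k) x"
    using assms by (simp add: bij_is_surj surj_f_inv_f)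
  also have "\<dots> = zpow f (n + 1) x"
    using False k by (cases "n = -1") (auto simp: zpow_def)
  finally show ?thesis by simp
qed

lemma zpow_minus_1:
  assumes "bij f"
  shows "zpow f (n - 1) x = inv f (zpow f n x)"
  using zpow_add_1[OF assms, of "n - 1" x] assms by (simp add: bij_is_inj)

lemma zpow_add:
  assumes "bij f"
  shows "zpow f (m + n) x = zpow f m (zpow f n x)"
proof (induction m rule: int_induct[where k = 0])
  case (step1 i)
  then show ?case
    using zpow_add_1[OF assms, of "i + n"] zpow_add_1[OF assms, of i] by (simp add: algebra_simps)
next
  case (step2 i)
  then show ?case
    using zpow_minus_1[OF assms, of "i + n"] zpow_minus_1[OF assms, of i] by (simp add: algebra_simps)
qed simp

lemma irrational_int_eq_zero:
  fixes \<omega> :: real and n m :: int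
  assumes "\<omega> \<notin> \<rat>" and "of_int n * \<omega> + of_int m = 0"
  shows "n = 0" "m = 0"
proof -
  show "n = 0"
  proof (rule ccontr)
    assume "n \<noteq> 0"
    with assms(2) have "\<omega> = - of_int m / of_int n" by (simp add: field_simps)
    with assms(1) show False by simp
  qed
  with assms(2) show "m = 0" by simp
qed

lemma shift_of_int:
  fixes f :: "real \<Rightarrow> real"
  assumes "\<And>x. f (x + 1) = f x + c"
  shows "f (x + of_int k) = f x + of_int k * c"
proof (induction k rule: int_induct[where k = 0])
  case (step1 i)
  then show ?case using assms[of "x + of_int i"] by (simp add: algebra_simps)
next
  case (step2 i)
  then show ?case using assms[of "x + of_int i - 1"] by (simp add: algebra_simps)
qed simp

lemma periodic_of_int:
  fixes f :: "real \<Rightarrow> 'a"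
  assumes "\<And>x. f (x + 1) = f x"
  shows "f (x + of_int k) = f x"
proof (induction k rule: int_induct[where k = 0])
  case (step1 i)
  then show ?case using assms[of "x + of_int i"] by (simp add: algebra_simps)
next
  case (step2 i)
  then show ?case using assms[of "x + of_int i - 1"] by (simp add: algebra_simps)
qed simp

text \<open>The fibre maps enter as increasing homeomorphisms of degree one. Derivatives are first
  needed for the distortion, in \<open>smooth_wandering_qpf\<close>.\<close>

locale qpf =
  fixes \<omega> :: real and F :: "real \<Rightarrow> real \<Rightarrow> real"
  assumes irrational: "\<omega> \<notin> \<rat>"
    and F_periodic: "F (\<theta> + 1) x = F \<theta> x"
    and F_degree_one: "F \<theta> (x + 1) = F \<theta> x + 1"
    and F_continuous: "continuous_on UNIV (\<lambda>z. F (fst z) (snd z))"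
    and F_strict_mono: "x < y \<Longrightarrow> F \<theta> x < F \<theta> y"
begin

lemma F_periodic_int: "F (\<theta> + of_int m) x = F \<theta> x"
  by (rule periodic_of_int[of "\<lambda>\<theta>. F \<theta> x", OF F_periodic])

lemma F_degree_one_int: "F \<theta> (x + of_int k) = F \<theta> x + of_int k"
  using shift_of_int[of "F \<theta>", OF F_degree_one] by simp

lemma continuous_on_fibre: "continuous_on S (F \<theta>)"
proof -
  have "continuous_on S (\<lambda>x. F (fst (\<theta>, x)) (snd (\<theta>, x)))"
    by (rule continuous_on_compose2[OF F_continuous]) (auto intro!: continuous_intros)
  then show ?thesis by simp
qed

lemma surj_fibre: "surj (F \<theta>)"
unfolding surj_def
proof
  fix y
  define k where "k = \<lfloor>y - F \<theta> 0\<rfloor>"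
  have "F \<theta> (of_int k) \<le> y" "y \<le> F \<theta> (of_int (k + 1))"
    using F_degree_one_int[of \<theta> 0 k] F_degree_one_int[of \<theta> 0 "k + 1"]
      floor_correct[of "y - F \<theta> 0"] unfolding k_def[symmetric] by simp_all
  then obtain x where "F \<theta> x = y"
    using IVT'[of "F \<theta>" "of_int k" y "of_int (k+1)"] continuous_on_fibre by auto
  then show "\<exists>x. y = F \<theta> x" by blast
qed

abbreviation L :: "real \<times> real \<Rightarrow> real \<times> real" where "L \<equiv> liftmap \<omega> F"

lemma L_simps: "fst (L z) = fst z + \<omega>" "snd (L z) = F (fst z) (snd z)"
  by (simp_all add: liftmap_def)

lemma bij_L: "bij L"
proof (rule bijI)
  show "inj L"
  proof (rule injI)
    fix z w assume "L z = L w"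
    then have "fst z = fst w" "F (fst z) (snd z) = F (fst z) (snd w)"
      by (auto simp: liftmap_def)
    then show "z = w"
      using F_strict_mono by (metis linorder_neqE_linordered_idom order_less_irrefl prod.expand)
  qed
  show "surj L"
    unfolding surj_def
  proof
    fix w
    obtain x where "F (fst w - \<omega>) x = snd w" using surj_fibre by (metis surjD)
    then have "w = L (fst w - \<omega>, x)" by (simp add: liftmap_def)
    then show "\<exists>z. w = L z" by blast
  qed
qed

lemma continuous_on_L: "continuous_on S L"
proof -
  have "continuous_on UNIV L"
    unfolding liftmap_def using F_continuous by (intro continuous_intros)
  then show ?thesis using continuous_on_subset by blast
qed

text \<open>Invariance of domain: a continuous injection of the plane into itself is open, so its
  inverse is continuous.\<close>

lemma continuous_on_inv_L: "continuous_on S (inv L)"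
proof -
  have "continuous_on (L ` UNIV) (inv L)"
    by (rule continuous_on_inverse_open) (auto simp: continuous_on_L bij_L bij_is_inj)
  then show ?thesis using bij_L continuous_on_subset by (metis bij_is_surj subset_UNIV)
qed

lemma L_translate: "L (z + (of_int m, of_int k)) = L z + (of_int m, of_int k)"
  using F_periodic_int[of "fst z" m] F_degree_one_int[of "fst z" "snd z" k]
  by (simp add: liftmap_def fst_add snd_add prod_eq_iff)

abbreviation iter :: "int \<Rightarrow> real \<times> real \<Rightarrow> real \<times> real" where "iter \<equiv> zpow L"

lemmas iter_add = zpow_add[OF bij_L]

lemma iter_inverse [simp]: "iter n (iter (- n) z) = z" "iter (- n) (iter n z) = z"
  using iter_add[of n "-n" z] iter_add[of "-n" n z] by auto

lemma iter_translate: "iter n (z + (of_int m, of_int k)) = iter n z + (of_int m, of_int k)"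
proof -
  have inv_L: "inv L (z + (of_int m, of_int k)) = inv L z + (of_int m, of_int k)" for z
    by (metis L_translate bij_L bij_inv_eq_iff)
  show ?thesis
  proof (induction n rule: int_induct[where k = 0])
    case (step1 i)
    then show ?case using zpow_add_1[OF bij_L] L_translate by simp
  next
    case (step2 i)
    then show ?case using zpow_minus_1[OF bij_L] inv_L by simp
  qed simp
qed

lemma fst_iter: "fst (iter n z) = fst z + of_int n * \<omega>"
proof (induction n rule: int_induct[where k = 0])
  case (step1 i)
  then show ?case using zpow_add_1[OF bij_L, of i z] by (simp add: L_simps algebra_simps)
next
  case (step2 i)
  have "fst (inv L w) = fst w - \<omega>" for w
    using L_simps(1)[of "inv L w"] bij_L by (simp add: bij_is_surj surj_f_inv_f)
  with step2 show ?case using zpow_minus_1[OF bij_L, of i z] by (simp add: algebra_simps)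
qed simp

lemma continuous_on_iter: "continuous_on S (iter n)"
proof -
  have pow: "continuous_on UNIV (f ^^ k)" if "continuous_on UNIV f"
    for f :: "real \<times> real \<Rightarrow> real \<times> real" and k
  proof (induction k)
    case (Suc k)
    then show ?case
      using continuous_on_compose[OF Suc.IH continuous_on_subset[OF that]] by simp
  qed (simp add: id_def)
  have "continuous_on UNIV (iter n)"
    using pow[OF continuous_on_L] pow[OF continuous_on_inv_L] by (simp add: zpow_def)
  then show ?thesis
    using continuous_on_subset by blast
qed

lemma iter_strict_mono:
  assumes "fst z = fst w" "snd z < snd w"
  shows "snd (iter n z) < snd (iter n w)"
proof -
  have nonneg: "snd (iter (int n) z) < snd (iter (int n) w)"
    if "fst z = fst w" "snd z < snd w" for z w n
    using that
  proof (induction n)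
    case (Suc n)
    then show ?case
      using zpow_add_1[OF bij_L, of "int n"] fst_iter[of "int n"] F_strict_mono
      by (simp add: L_simps add.commute)
  qed simp
  show ?thesis
  proof (cases "n \<ge> 0")
    case True
    then show ?thesis using nonneg[of z w "nat n"] assms by simp
  next
    \<comment> \<open>For negative \<open>n\<close> a violated order is pushed forward by the
      \<open>-n\<close>-th iterate, to which the case of nonnegative times applies.\<close>
    case False
    show ?thesis
    proof (rule ccontr)
      assume "\<not> ?thesis"
      moreover have fst_eq: "fst (iter n w) = fst (iter n z)" using assms fst_iter by simp
      ultimately consider "iter n w = iter n z" | "snd (iter n w) < snd (iter n z)"
        by (metis linorder_neqE_linordered_idom prod.expand)
      then show False
      proof cases
        case 1
        then show False using assms iter_inverse(2)[of n z] iter_inverse(2)[of n w] by auto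
      next
        case 2
        then have "snd (iter (int (nat (- n))) (iter n w)) < snd (iter (int (nat (- n))) (iter n z))"
          using nonneg fst_eq by blast
        then show False using False assms by simp
      qed
    qed
  qed
qed

lemma iter_mono:
  assumes "fst z = fst w" "snd z \<le> snd w"
  shows "snd (iter n z) \<le> snd (iter n w)"
proof (cases "snd z = snd w")
  case True
  with assms(1) have "z = w" by (simp add: prod_eq_iff)
  then show ?thesis by simp
next
  case False
  then show ?thesis using iter_strict_mono[OF assms(1), of n] assms(2) by simp
qed

definition act :: "int \<Rightarrow> int \<Rightarrow> int \<Rightarrow> real \<times> real \<Rightarrow> real \<times> real" where
  "act n m k z = iter n z + (of_int m, of_int k)"

lemma act_0 [simp]: "act 0 0 0 z = z"
  by (simp add: act_def zero_prod_def[symmetric])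

lemma act_act: "act n m k (act n' m' k' z) = act (n + n') (m + m') (k + k') z"
  by (simp add: act_def iter_translate iter_add prod_eq_iff)

lemma act_inverse [simp]: "act n m k (act (- n) (- m) (- k) z) = z" "act (- n) (- m) (- k) (act n m k z) = z"
  by (simp_all add: act_act)

abbreviation hshift :: "int \<Rightarrow> int \<Rightarrow> real" where "hshift n m \<equiv> of_int n * \<omega> + of_int m"

lemma fst_act: "fst (act n m k z) = fst z + (of_int n * \<omega> + of_int m)"
  by (simp add: act_def fst_iter)

lemma continuous_on_act: "continuous_on S (act n m k)"
  unfolding act_def using continuous_on_iter by (intro continuous_intros)

text \<open>Vertical translation by an integer commutes with \<open>iter\<close>. Monotonicity
  therefore preserves bounds on vertical distances, but only integer ones.\<close>

lemma iter_diff_le: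
  assumes "fst z = fst w" "\<bar>snd z - snd w\<bar> \<le> of_int j"
  shows "\<bar>snd (iter n z) - snd (iter n w)\<bar> \<le> of_int j"
proof -
  have *: "snd (iter n u) \<le> snd (iter n v) + of_int j" if "fst u = fst v" "snd u \<le> snd v + of_int j" for u v
  proof -
    have "snd (iter n u) \<le> snd (iter n (v + (of_int 0, of_int j)))"
      by (rule iter_mono) (use that in simp_all)
    also have "\<dots> = snd (iter n v) + of_int j"
      unfolding iter_translate by simp
    finally show ?thesis .
  qed
  show ?thesis using *[of z w] *[of w z] assms by (auto simp: abs_le_iff)
qed

end

section \<open>Bounded deviation from the rotation number\<close>

text \<open>Intermediate values with the end points in either order; the base points it is applied
  to are not ordered.\<close>

lemma IVT_closed_segment:
  fixes f :: "real \<Rightarrow> real"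
  assumes "continuous_on (closed_segment a b) f" "f a \<le> y" "y \<le> f b"
  obtains t where "t \<in> closed_segment a b" "f t = y"
proof -
  have "is_interval (f ` closed_segment a b)"
    using assms(1) connected_continuous_image connected_segment is_interval_connected_1 by blast
  then have "y \<in> f ` closed_segment a b"
    using assms(2,3) ends_in_segment unfolding is_interval_1 by blast
  then show ?thesis using that by blast
qed

text \<open>Some multiple \<open>k * \<omega>\<close> exceeds an integer by \<open>s\<close> with 0
  < s < \<delta>. The points j * s with j \<le> 1 / s cross the unit interval in steps shorter than
  \<delta>, so one bound on the time serves all starting points and all targets.\<close>

lemma rotation_hitting_time:
  fixes \<omega> :: real
  assumes "\<omega> \<notin> \<rat>" and "0 < \<delta>"
  obtains N :: nat where "\<And>\<theta> t. \<exists>k\<le>N. \<exists>m::int. \<bar>\<theta> + real k * \<omega> + of_int m - t\<bar> < \<delta>"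
proof -
  obtain h k :: int where k: "k > 0" "\<bar>of_int k * \<omega> - of_int h - \<delta> / 2\<bar> < \<delta> / 2"
    by (rule sequence_of_fractional_parts_is_dense[OF assms(1), of "\<delta> / 2" "\<delta> / 2"])
      (use assms(2) in auto)
  define s where "s = of_int k * \<omega> - of_int h"
  have s: "0 < s" "s < \<delta>" using k(2) unfolding s_def by linarith+
  show ?thesis
  proof
    fix \<theta> t :: real
    define y where "y = frac (t - \<theta>)"
    define j where "j = \<lfloor>y / s\<rfloor>"
    have y: "0 \<le> y" "y < 1" unfolding y_def by (simp_all add: frac_lt_1)
    have j0: "0 \<le> j" unfolding j_def using y s by simp
    have "y / s \<le> 1 / s" using y s by (simp add: divide_right_mono)
    then have j1: "j \<le> \<lfloor>1 / s\<rfloor>" unfolding j_def by (rule floor_mono)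
    have "of_int j \<le> y / s" "y / s < of_int j + 1" unfolding j_def by linarith+
    then have js: "of_int j * s \<le> y" "y < of_int j * s + s"
      using s by (simp_all add: field_simps)
    have eq: "\<theta> + real (nat (j * k)) * \<omega> + of_int (\<lfloor>t - \<theta>\<rfloor> - j * h) - t = of_int j * s - y"
    proof -
      have "real (nat (j * k)) = of_int j * of_int k"
        using j0 k(1) by simp
      then show ?thesis unfolding s_def y_def frac_def by (simp add: algebra_simps)
    qed
    have "nat (j * k) \<le> nat (\<lfloor>1 / s\<rfloor> * k)"
      using j1 k(1) by (intro nat_mono mult_right_mono) auto
    moreover have "\<bar>\<theta> + real (nat (j * k)) * \<omega> + of_int (\<lfloor>t - \<theta>\<rfloor> - j * h) - t\<bar> < \<delta>"
      unfolding eq using js s by linarith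
    ultimately show "\<exists>i\<le>nat (\<lfloor>1 / s\<rfloor> * k). \<exists>m::int. \<bar>\<theta> + real i * \<omega> + of_int m - t\<bar> < \<delta>"
      by blast
  qed
qed

text \<open>Homogenisation of a quasimorphism. Comparing \<open>a (m * n)\<close> both with m * a n
  and with n * a m shows that a n / n is Cauchy with error D / n + D / m; the bound on a n - n *
  \<rho> follows as m tends to infinity.\<close>

lemma quasi_additive_linear:
  fixes a :: "nat \<Rightarrow> real"
  assumes "\<And>m n. \<bar>a (m + n) - a m - a n\<bar> \<le> D"
  obtains \<rho> where "\<And>n. \<bar>a n - real n * \<rho>\<bar> \<le> D" "(\<lambda>n. a n / real n) \<longlonglongrightarrow> \<rho>"
proof -
  have mult: "\<bar>a (Suc m * n) - real (Suc m) * a n\<bar> \<le> real m * D" for m n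
  proof (induction m)
    case (Suc m)
    have "a (Suc (Suc m) * n) = a (n + Suc m * n)" by simp
    then show ?case using Suc assms[of n "Suc m * n"] by (simp add: algebra_simps)
  qed simp
  have D: "0 \<le> D" using assms[of 0 0] by linarith
  have mult': "\<bar>a (m * n) - real m * a n\<bar> \<le> real m * D" if "m > 0" for m n
  proof -
    obtain l where l: "m = Suc l" using \<open>m > 0\<close> gr0_conv_Suc by blast
    have "real l * D \<le> real m * D" using D l by (intro mult_right_mono) auto
    then show ?thesis using mult[of l n] unfolding l by linarith
  qed
  have comp: "\<bar>real m * a n - real n * a m\<bar> \<le> (real m + real n) * D" if "m > 0" "n > 0" for m n
    using mult'[OF that(1), of n] mult'[OF that(2), of m]
    unfolding mult.commute[of n m] distrib_right by linarith
  have comp': "\<bar>a n / real n - a m / real m\<bar> \<le> D / real n + D / real m" if "m > 0" "n > 0" for m n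
  proof -
    have "a n / real n - a m / real m = (real m * a n - real n * a m) / (real m * real n)"
      using that by (simp add: field_simps)
    then have "\<bar>a n / real n - a m / real m\<bar> = \<bar>real m * a n - real n * a m\<bar> / (real m * real n)"
      using that by (simp add: abs_divide)
    also have "\<dots> \<le> ((real m + real n) * D) / (real m * real n)"
      using comp[OF that] that by (intro divide_right_mono) auto
    also have "\<dots> = D / real n + D / real m"
      using that by (simp add: field_simps)
    finally show ?thesis .
  qed
  have lim0: "(\<lambda>n. D / real n) \<longlonglongrightarrow> 0"
    by (intro tendsto_divide_0[OF tendsto_const] filterlim_at_top_imp_at_infinity filterlim_real_sequentially)
  have "Cauchy (\<lambda>n. a n / real n)"
  proof (rule metric_CauchyI)
    fix e :: real assume "0 < e"
    then have "eventually (\<lambda>n. D / real n < e / 2) sequentially"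
      using order_tendstoD(2)[OF lim0, of "e / 2"] by simp
    then obtain M where M: "\<And>n. n \<ge> M \<Longrightarrow> D / real n < e / 2"
      unfolding eventually_sequentially by blast
    have "dist (a m / real m) (a n / real n) < e" if "m \<ge> Suc M" "n \<ge> Suc M" for m n
      using comp'[of n m] M[of m] M[of n] that unfolding dist_real_def by linarith
    then show "\<exists>M. \<forall>m\<ge>M. \<forall>n\<ge>M. dist (a m / real m) (a n / real n) < e" by blast
  qed
  then obtain \<rho> where \<rho>: "(\<lambda>n. a n / real n) \<longlonglongrightarrow> \<rho>"
    using Cauchy_convergent_iff convergent_def by blast
  have "\<bar>a n - real n * \<rho>\<bar> \<le> D" for n
  proof (cases "n = 0")
    case True
    then show ?thesis using assms[of 0 0] by simp
  next
    case False
    have "(\<lambda>m. \<bar>a n / real n - a m / real m\<bar>) \<longlonglongrightarrow> \<bar>a n / real n - \<rho>\<bar>"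
      by (intro tendsto_intros \<rho>)
    moreover have "(\<lambda>m. D / real n + D / real m) \<longlonglongrightarrow> D / real n + 0"
      by (intro tendsto_intros lim0)
    moreover have "\<exists>N. \<forall>m\<ge>N. \<bar>a n / real n - a m / real m\<bar> \<le> D / real n + D / real m"
      using comp' False by (intro exI[of _ 1]) auto
    ultimately have "\<bar>a n / real n - \<rho>\<bar> \<le> D / real n + 0" by (rule LIMSEQ_le)
    moreover have "a n / real n - \<rho> = (a n - real n * \<rho>) / real n" using False by (simp add: field_simps)
    ultimately show ?thesis using False by (simp add: abs_divide field_simps)
  qed
  with \<rho> show ?thesis using that by blast
qed

lemma locally_bounded_oscillation:
  fixes f :: "real \<Rightarrow> real"
  assumes "0 < \<delta>" and "\<And>x y. \<bar>x - y\<bar> < \<delta> \<Longrightarrow> \<bar>f x - f y\<bar> \<le> D"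
  shows "\<bar>x - y\<bar> < real n * \<delta> \<Longrightarrow> \<bar>f x - f y\<bar> \<le> real n * D"
proof (induction n arbitrary: x)
  case (Suc n)
  show ?case
  proof (cases "n = 0")
    case True
    then show ?thesis using Suc.prems assms(2)[of x y] by simp
  next
    case False
    \<comment> \<open>The segment from \<open>y\<close> to \<open>x\<close> is cut into n + 1 equal
      steps, and \<open>x'\<close> is where the last one begins.\<close>
    define x' where "x' = y + (x - y) * (real n / real (Suc n))"
    have "x' - y = (x - y) * (real n / real (Suc n))" unfolding x'_def by simp
    moreover have "x - x' = (x - y) * (1 / real (Suc n))"
      unfolding x'_def by (simp add: field_simps)
    ultimately have "\<bar>x' - y\<bar> = \<bar>x - y\<bar> * (real n / real (Suc n))" "\<bar>x - x'\<bar> = \<bar>x - y\<bar> * (1 / real (Suc n))"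
      by (simp_all add: abs_mult)
    moreover have "\<bar>x - y\<bar> < real (Suc n) * \<delta>" using Suc.prems by simp
    ultimately have "\<bar>x' - y\<bar> < real n * \<delta>" "\<bar>x - x'\<bar> < \<delta>"
      using False mult_strict_right_mono[of "\<bar>x - y\<bar>" "real (Suc n) * \<delta>" "real n / real (Suc n)"]
          mult_strict_right_mono[of "\<bar>x - y\<bar>" "real (Suc n) * \<delta>" "1 / real (Suc n)"]
      by (auto simp: mult.commute[of \<delta>])
    then have "\<bar>f x' - f y\<bar> \<le> real n * D" "\<bar>f x - f x'\<bar> \<le> D"
      using Suc.IH assms(2) by auto
    then show ?thesis by (simp add: algebra_simps)
  qed
qed simp

definition square :: "real \<times> real \<Rightarrow> real \<Rightarrow> (real \<times> real) set" where
  "square c r = {z. \<bar>fst z - fst c\<bar> < r \<and> \<bar>snd z - snd c\<bar> < r}"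

context qpf
begin

lemma fibre_displacement_bounded:
  obtains B where "0 \<le> B" "\<And>n z. \<bar>snd (iter (int n) z) - snd z\<bar> \<le> real n * B"
proof -
  have "bounded ((\<lambda>z. F (fst z) (snd z) - snd z) ` cbox (0,0) (1,1))"
    by (intro compact_imp_bounded compact_continuous_image continuous_on_diff continuous_intros
        continuous_on_subset[OF F_continuous]) auto
  then obtain B where B: "\<And>z. z \<in> cbox (0,0) (1,1) \<Longrightarrow> \<bar>F (fst z) (snd z) - snd z\<bar> \<le> B"
    unfolding bounded_iff by auto
  have B1: "\<bar>F \<theta> x - x\<bar> \<le> B" for \<theta> x
  proof -
    have "F \<theta> x - x = F (frac \<theta>) (frac x) - frac x"
      using F_periodic_int[of "frac \<theta>" "\<lfloor>\<theta>\<rfloor>" x] F_degree_one_int[of "frac \<theta>" "frac x" "\<lfloor>x\<rfloor>"]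
      by (simp add: frac_def)
    moreover have "(frac \<theta>, frac x) \<in> cbox (0,0) (1,1)"
      by (simp add: cbox_Pair_iff less_imp_le[OF frac_lt_1])
    ultimately show ?thesis using B by fastforce
  qed
  have "\<bar>snd (iter (int n) z) - snd z\<bar> \<le> real n * B" for n z
  proof (induction n)
    case (Suc n)
    have "iter (int (Suc n)) z = L (iter (int n) z)"
      using zpow_add_1[OF bij_L, of "int n" z] by (simp add: add.commute)
    then show ?case
      using Suc B1[of "fst (iter (int n) z)" "snd (iter (int n) z)"]
      by (simp add: L_simps algebra_simps abs_le_iff)
  qed simp
  then show ?thesis using that[of B] B1[of 0 0] by force
qed

text \<open>Two nearby base points are brought over the box at \<open>v\<close> within
  \<open>N\<close> steps and, \<open>n\<close> steps later, over the box at \<open>u\<close> within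
  another \<open>N\<close> steps. In between \<open>osc\<close> controls them, and the additional
  steps cost a bounded amount. Hence the displacement over \<open>n\<close> steps depends on the
  base point only up to a bound independent of \<open>n\<close>.\<close>

lemma bounded_deviation:
  assumes r: "0 < r"
    and NT: "\<And>n m k z. 1 \<le> n \<Longrightarrow> z \<in> square v r \<Longrightarrow> act n m k z \<notin> square u r"
  obtains \<rho> C where "\<And>n z. \<bar>snd (iter n z) - snd z - of_int n * \<rho>\<bar> \<le> C"
    "(\<lambda>n. snd (iter (int n) (0, 0)) / real n) \<longlonglongrightarrow> \<rho>"
proof -
  define P where "P n \<theta> = snd (iter (int n) (\<theta>, 0))" for n \<theta>
  have osc: "\<bar>snd (iter n (a, snd v)) - snd (iter n (b, snd v))\<bar> \<le> 1"
    if n: "1 \<le> n" and ab: "\<bar>a - fst v\<bar> < r" "\<bar>b - fst v\<bar> < r"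
      "\<bar>a + of_int n * \<omega> + of_int m - fst u\<bar> < r" "\<bar>b + of_int n * \<omega> + of_int m - fst u\<bar> < r"
    for n m a b
  proof -
    define h where "h t = snd (iter n (t, snd v))" for t
    have cont: "continuous_on S h" for S
      unfolding h_def
      by (intro continuous_on_snd continuous_on_compose2[OF continuous_on_iter[of UNIV n]] continuous_intros) auto
    have *: False
      if "h a + 1 \<le> h b" and ab: "\<bar>a - fst v\<bar> < r" "\<bar>b - fst v\<bar> < r"
      "\<bar>a + of_int n * \<omega> + of_int m - fst u\<bar> < r" "\<bar>b + of_int n * \<omega> + of_int m - fst u\<bar> < r" for a b
    proof -
      \<comment> \<open>The number \<open>snd u - k\<close> lies in the interval from
        \<open>h a\<close> to \<open>h a + 1\<close>, so the image curve must cross it. The crossing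
        carries a point of the box at \<open>v\<close> into the box at \<open>u\<close>.\<close>
      define k where "k = \<lfloor>snd u - h a\<rfloor>"
      have "h a \<le> snd u - of_int k" "snd u - of_int k \<le> h b"
        unfolding k_def using that(1) by linarith+
      then obtain t where t: "t \<in> closed_segment a b" "h t = snd u - of_int k"
        using IVT_closed_segment cont by metis
      then have "(min a b) \<le> t" "t \<le> max a b" by (auto simp: closed_segment_eq_real_ivl split: if_splits)
      then have "\<bar>t - fst v\<bar> < r" "\<bar>t + of_int n * \<omega> + of_int m - fst u\<bar> < r"
        using ab by (auto simp: min_def max_def split: if_splits)
      then have "(t, snd v) \<in> square v r" "act n m k (t, snd v) \<in> square u r"
        using t(2) r by (auto simp: square_def act_def fst_iter h_def)
      then show False using NT n by blast
    qed
    have "\<not> h a + 1 \<le> h b" "\<not> h b + 1 \<le> h a" using * ab by blast+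
    then show ?thesis unfolding h_def by linarith
  qed
  obtain N where N: "\<And>\<theta> t. \<exists>k\<le>N. \<exists>m::int. \<bar>\<theta> + real k * \<omega> + of_int m - t\<bar> < r / 2"
    using rotation_hitting_time[OF irrational, of "r / 2"] r by auto
  obtain B where B: "0 \<le> B" "\<And>n z. \<bar>snd (iter (int n) z) - snd z\<bar> \<le> real n * B"
    using fibre_displacement_bounded by blast
  \<comment> \<open>After at most \<open>N\<close> steps from height 0 the distance to
    \<open>snd v\<close> is at most \<open>J\<close>, rounded up because \<open>iter_diff_le\<close>
    wants an integer. In \<open>D\<close>, the two \<open>J\<close> pay for replacing both starting
    heights by \<open>snd v\<close>, 1 is the oscillation, and the last term pays, for both points,
    for undoing up to 2 * N additional steps.\<close>
  define J where "J = \<lceil>real N * B + \<bar>snd v\<bar>\<rceil>"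
  define D where "D = 2 * of_int J + 1 + 2 * (real (2 * N) * B)"
  have B2: "\<bar>snd (iter (int n) z) - snd z\<bar> \<le> real M * B" if "n \<le> M" for n M z
    using B(2)[of n z] mult_right_mono[of "real n" "real M" B] that B(1) by force
  have local: "\<bar>P n \<theta> - P n \<theta>0\<bar> \<le> D" if "\<bar>\<theta> - \<theta>0\<bar> < r / 2" for n \<theta> \<theta>0
  proof (cases "n = 0")
    case True
    have "0 \<le> real N * B + \<bar>snd v\<bar>" using B(1) by simp
    then have "0 \<le> J" unfolding J_def by linarith
    then show ?thesis unfolding True P_def D_def using B(1) by simp
  next
    case False
    obtain k and m :: int where k: "k \<le> N" "\<bar>\<theta>0 + real k * \<omega> + of_int m - fst v\<bar> < r / 2"
      using N by blast
    obtain j and m' :: int where j: "j \<le> N"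
      "\<bar>(\<theta>0 + real k * \<omega> + of_int m + real n * \<omega>) + real j * \<omega> + of_int m' - fst u\<bar> < r / 2"
      using N by blast
    have iter_k: "\<bar>snd (iter (int (n + j + k)) (t, 0)) - snd (iter (int (n + j)) (t + real k * \<omega> + of_int m, snd v))\<bar> \<le> of_int J"
      for t
    proof -
      define y where "y = snd (iter (int k) (t, 0))"
      have y: "iter (int k) (t, 0) = (t + real k * \<omega>, y)" unfolding y_def by (simp add: prod_eq_iff fst_iter)
      have "\<bar>y\<bar> \<le> real N * B" using B2[OF k(1), of "(t, 0)"] y_def by simp
      then have "\<bar>y - snd v\<bar> \<le> of_int J" unfolding J_def by linarith
      then have "\<bar>snd (iter (int (n + j)) (t + real k * \<omega> + of_int m, y)) - snd (iter (int (n + j)) (t + real k * \<omega> + of_int m, snd v))\<bar> \<le> of_int J"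
        by (intro iter_diff_le) auto
      moreover have "iter (int (n + j + k)) (t, 0) = iter (int (n + j)) (t + real k * \<omega>, y)"
        unfolding of_nat_add[of "n + j" k] iter_add y ..
      moreover have "snd (iter (int (n + j)) (t + real k * \<omega> + of_int m, y)) = snd (iter (int (n + j)) (t + real k * \<omega>, y))"
        using iter_translate[of "int (n + j)" "(t + real k * \<omega>, y)" m 0] by simp
      ultimately show ?thesis by simp
    qed
    have "\<bar>snd (iter (int (n + j)) (\<theta> + real k * \<omega> + of_int m, snd v)) - snd (iter (int (n + j)) (\<theta>0 + real k * \<omega> + of_int m, snd v))\<bar> \<le> 1"
    proof (rule osc[of "int (n + j)" _ _ m'])
      have nj: "of_int (int (n + j)) * \<omega> = real n * \<omega> + real j * \<omega>" by (simp add: algebra_simps)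
      note bounds = k(2) j(2) that
      show "1 \<le> int (n + j)" using False by simp
      show "\<bar>\<theta> + real k * \<omega> + of_int m - fst v\<bar> < r" using bounds by linarith
      show "\<bar>\<theta>0 + real k * \<omega> + of_int m - fst v\<bar> < r" using bounds by linarith
      show "\<bar>\<theta> + real k * \<omega> + of_int m + of_int (int (n + j)) * \<omega> + of_int m' - fst u\<bar> < r"
        unfolding nj using bounds by linarith
      show "\<bar>\<theta>0 + real k * \<omega> + of_int m + of_int (int (n + j)) * \<omega> + of_int m' - fst u\<bar> < r"
        unfolding nj using bounds by linarith
    qed
    moreover have "\<bar>snd (iter (int (n + j + k)) (t, 0)) - P n t\<bar> \<le> real (2 * N) * B" for t
    proof -
      have "iter (int (n + j + k)) (t, 0) = iter (int (j + k)) (iter (int n) (t, 0))"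
        unfolding iter_add[symmetric] by (simp add: algebra_simps)
      then show ?thesis unfolding P_def using B2[of "j + k" "2 * N" "iter (int n) (t, 0)"] k j by simp
    qed
    from this[of \<theta>] this[of \<theta>0] iter_k[of \<theta>] iter_k[of \<theta>0] calculation
    show ?thesis unfolding D_def by linarith
  qed
  obtain M :: nat where M: "1 < real M * (r / 2)"
    using reals_Archimedean3[of "r / 2"] r by (meson half_gt_zero)
  have P_global: "\<bar>P n \<theta> - P n 0\<bar> \<le> real M * D" for n \<theta>
  proof -
    have "P n \<theta> = P n (frac \<theta>)"
      using iter_translate[of "int n" "(frac \<theta>, 0)" "\<lfloor>\<theta>\<rfloor>" 0] unfolding P_def by (simp add: frac_def)
    moreover have "\<bar>frac \<theta> - 0\<bar> < real M * (r / 2)"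
      using M frac_lt_1[of \<theta>] frac_ge_0[of \<theta>] by linarith
    ultimately show ?thesis
      using locally_bounded_oscillation[of "r / 2" "P n" D "frac \<theta>" 0 M] local r by simp
  qed
  \<comment> \<open>The 2 is one unit for moving the starting point down to an integer height and
    one for the fractional part of \<open>snd z\<close>.\<close>
  define C where "C = real M * D + 2"
  have dev: "\<bar>snd (iter (int n) z) - snd z - P n 0\<bar> \<le> C" for n z
  proof -
    have "\<bar>snd (iter (int n) z) - snd (iter (int n) (fst z, of_int \<lfloor>snd z\<rfloor>))\<bar> \<le> of_int 1"
      by (rule iter_diff_le) (simp_all, linarith)
    moreover have "snd (iter (int n) (fst z, of_int \<lfloor>snd z\<rfloor>)) = P n (fst z) + of_int \<lfloor>snd z\<rfloor>"
      using iter_translate[of "int n" "(fst z, 0)" 0 "\<lfloor>snd z\<rfloor>"] unfolding P_def by simp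
    ultimately show ?thesis
      unfolding C_def using P_global[of n "fst z"] of_int_floor_le[of "snd z"] floor_correct[of "snd z"] by (simp; linarith)
  qed
  have "\<bar>P (m + n) 0 - P m 0 - P n 0\<bar> \<le> C" for m n
    using dev[of m "iter (int n) (0, 0)"] unfolding P_def of_nat_add iter_add by simp
  then obtain \<rho> where \<rho>: "\<And>n. \<bar>P n 0 - real n * \<rho>\<bar> \<le> C" "(\<lambda>n. P n 0 / real n) \<longlonglongrightarrow> \<rho>"
    using quasi_additive_linear[of "\<lambda>n. P n 0" C] by metis
  have nonneg: "\<bar>snd (iter (int n) z) - snd z - real n * \<rho>\<bar> \<le> 2 * C" for n z
    using dev[of n z] \<rho>(1)[of n] by linarith
  have "\<bar>snd (iter n z) - snd z - of_int n * \<rho>\<bar> \<le> 2 * C" for n z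
  proof (cases "n \<ge> 0")
    case True
    then show ?thesis using nonneg[of "nat n" z] by simp
  next
    case False
    then show ?thesis using nonneg[of "nat (- n)" "iter n z"] by (simp add: abs_le_iff)
  qed
  with \<rho>(2) show ?thesis using that unfolding P_def by blast
qed

end

section \<open>Invariant strips for resonant rotation numbers\<close>

text \<open>The projections to the first coordinate of the two sides of a separation are open. They
  are disjoint because every fibre is an interval, and they cover the line, which is
  connected.\<close>

lemma connected_open_convex_fibres:
  fixes S :: "(real \<times> real) set"
  assumes "open S" and nonempty: "\<And>\<theta>. \<exists>x. (\<theta>, x) \<in> S"
    and convex: "\<And>\<theta> x y t. (\<theta>, x) \<in> S \<Longrightarrow> (\<theta>, y) \<in> S \<Longrightarrow> x \<le> t \<Longrightarrow> t \<le> y \<Longrightarrow> (\<theta>, t) \<in> S"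
  shows "connected S"
proof (rule connectedI)
  fix A B :: "(real \<times> real) set"
  assume AB: "open A" "open B" "A \<inter> S \<noteq> {}" "B \<inter> S \<noteq> {}" "A \<inter> B \<inter> S = {}" "S \<subseteq> A \<union> B"
  have "open (fst ` (A \<inter> S))" "open (fst ` (B \<inter> S))"
    by (intro open_image_fst open_Int AB assms(1))+
  moreover have "fst ` (A \<inter> S) \<inter> fst ` (B \<inter> S) = {}"
  proof (rule ccontr)
    assume "\<not> ?thesis"
    then obtain \<theta> x y where xy: "(\<theta>, x) \<in> A \<inter> S" "(\<theta>, y) \<in> B \<inter> S" by fastforce
    define I where "I = {\<theta>} \<times> closed_segment x y"
    have "connected I" unfolding I_def by (intro connected_Times) auto
    moreover have "I \<subseteq> S"
    proof
      fix z assume "z \<in> I"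
      then obtain t where t: "z = (\<theta>, t)" "x \<le> t \<and> t \<le> y \<or> y \<le> t \<and> t \<le> x"
        unfolding I_def by (auto simp: closed_segment_eq_real_ivl split: if_splits)
      then show "z \<in> S" using convex[of \<theta> x y t] convex[of \<theta> y x t] xy by blast
    qed
    moreover have "A \<inter> I \<noteq> {}" "B \<inter> I \<noteq> {}" using xy unfolding I_def by auto
    ultimately show False using connectedD[of I A B] AB by blast
  qed
  moreover have "UNIV \<subseteq> fst ` (A \<inter> S) \<union> fst ` (B \<inter> S)"
  proof
    fix \<theta> :: real
    obtain x where "(\<theta>, x) \<in> S" using nonempty by blast
    then show "\<theta> \<in> fst ` (A \<inter> S) \<union> fst ` (B \<inter> S)" using AB(6) by force
  qed
  ultimately have "fst ` (A \<inter> S) = {} \<or> fst ` (B \<inter> S) = {}"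
    using connectedD[OF connected_UNIV, of "fst ` (A \<inter> S)" "fst ` (B \<inter> S)"] unfolding Int_UNIV_right by blast
  then show False using AB(3,4) by blast
qed

lemma square_subset_open:
  assumes "open S" "c \<in> S"
  obtains r where "0 < r" "square c r \<subseteq> S"
proof -
  obtain e where e: "0 < e" "ball c e \<subseteq> S" using assms open_contains_ball by blast
  have "square c (e / 2) \<subseteq> ball c e"
  proof
    fix z assume "z \<in> square c (e / 2)"
    then have "\<bar>fst z - fst c\<bar> + \<bar>snd z - snd c\<bar> < e" by (simp add: square_def; linarith)
    moreover have "norm (z - c) \<le> \<bar>fst z - fst c\<bar> + \<bar>snd z - snd c\<bar>"
      using norm_Pair_le[of "fst (z - c)" "snd (z - c)"] unfolding prod.collapse by simp
    ultimately have "norm (z - c) < e" by linarith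
    then show "z \<in> ball c e" by (simp add: dist_norm norm_minus_commute)
  qed
  with e show ?thesis using that[of "e / 2"] by auto
qed

lemma open_square: "open (square c r)"
proof -
  have "square c r = {fst c - r<..<fst c + r} \<times> {snd c - r<..<snd c + r}"
    unfolding square_def by (auto simp: abs_less_iff)
  then show ?thesis by (simp add: open_Times)
qed

section \<open>The conjugation of the Z^3 action to translations\<close>

locale bounded_qpf = qpf +
  fixes \<rho> C :: real
  assumes deviation: "\<bar>snd (iter n z) - snd z - of_int n * \<rho>\<bar> \<le> C"
begin

abbreviation vshift :: "int \<Rightarrow> int \<Rightarrow> real" where "vshift n k \<equiv> of_int n * \<rho> + of_int k"

lemma open_act_image:
  assumes "open S"
  shows "open (act n m k ` S)"
proof -
  have "act n m k ` S = act (- n) (- m) (- k) -` S"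
  proof (intro equalityI subsetI)
    fix z assume "z \<in> act (- n) (- m) (- k) -` S"
    then show "z \<in> act n m k ` S" by (metis act_inverse(1) image_eqI vimageD)
  qed auto
  then show ?thesis using continuous_on_open_vimage[OF open_UNIV] continuous_on_act assms
    by (metis inf_top.right_neutral)
qed

definition H :: "real \<times> real \<Rightarrow> real" where
  "H z = (SUP n. snd (iter n z) - of_int n * \<rho>)"

lemma bdd_above_H: "bdd_above (range (\<lambda>n. snd (iter n z) - of_int n * \<rho>))"
proof (rule bdd_aboveI2)
  show "snd (iter n z) - of_int n * \<rho> \<le> snd z + C" for n
    using deviation[of n z] by linarith
qed

lemma H_ge: "snd (iter n z) - of_int n * \<rho> \<le> H z"
  unfolding H_def by (rule cSUP_upper[OF _ bdd_above_H]) simp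

lemma H_le: "(\<And>n. snd (iter n z) - of_int n * \<rho> \<le> a) \<Longrightarrow> H z \<le> a"
  unfolding H_def by (rule cSUP_least) auto

lemma H_close: "\<bar>H z - snd z\<bar> \<le> C"
proof -
  have "snd (iter n z) - of_int n * \<rho> \<le> snd z + C" for n
    using deviation[of n z] by linarith
  then show ?thesis using H_ge[of 0 z] H_le[of z "snd z + C"] deviation[of 0 z] by simp
qed

text \<open>Applying an iterate merely reindexes a supremum over all integers. The inequality for
  every group element, used for the inverse as well, gives equality.\<close>

lemma H_act: "H (act n m k z) = H z + (vshift n k)"
proof -
  have le: "H (act n m k z) \<le> H z + (vshift n k)" for n m k z
  proof (rule H_le)
    fix j
    have "iter j (act n m k z) = iter (j + n) z + (of_int m, of_int k)"
      unfolding act_def iter_translate iter_add ..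
    then show "snd (iter j (act n m k z)) - of_int j * \<rho> \<le> H z + (vshift n k)"
      using H_ge[of "j + n" z] by (simp add: algebra_simps)
  qed
  show ?thesis
    using le[of n m k z] le[of "- n" "- m" "- k" "act n m k z"] by simp
qed

lemma H_mono:
  assumes "fst z = fst w" "snd z \<le> snd w"
  shows "H z \<le> H w"
proof (rule H_le)
  fix n
  show "snd (iter n z) - of_int n * \<rho> \<le> H w"
    using iter_mono[OF assms, of n] H_ge[of n w] by linarith
qed

text \<open>Lower semicontinuity of a supremum of continuous functions. The linear term is carried
  along for \<open>K\<close>, where a multiple of the base coordinate is subtracted from
  \<open>H\<close>.\<close>

lemma open_H_greater: "open {z. a < H z + b * fst z}"
proof -
  have "{z. a < H z + b * fst z} = (\<Union>n. {z. a < snd (iter n z) - of_int n * \<rho> + b * fst z})"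
  proof (intro equalityI subsetI)
    fix z assume "z \<in> {z. a < H z + b * fst z}"
    then have "\<not> H z \<le> a - b * fst z" by simp
    then obtain n where "\<not> snd (iter n z) - of_int n * \<rho> \<le> a - b * fst z"
      using H_le by blast
    then show "z \<in> (\<Union>n. {z. a < snd (iter n z) - of_int n * \<rho> + b * fst z})"
      by (auto simp: not_le intro!: exI[of _ n])
  next
    fix z assume "z \<in> (\<Union>n. {z. a < snd (iter n z) - of_int n * \<rho> + b * fst z})"
    then obtain n where "a < snd (iter n z) - of_int n * \<rho> + b * fst z" by blast
    then show "z \<in> {z. a < H z + b * fst z}" using H_ge[of n z] by simp
  qed
  moreover have "open {z. a < snd (iter n z) - of_int n * \<rho> + b * fst z}" for n
    by (intro open_Collect_less continuous_intros continuous_on_snd continuous_on_iter)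
  ultimately show ?thesis by auto
qed

end

lemma resonant_identity:
  fixes \<rho> \<omega> :: real
  assumes "P * Q * \<rho> = P * k * \<omega> + w" "P \<noteq> 0" "Q \<noteq> 0"
  shows "n * \<rho> + j - k / Q * (n * \<omega> + m) = (n * w + j * (P * Q) - P * k * m) / (P * Q)"
proof -
  have w: "w = P * Q * \<rho> - P * k * \<omega>" using assms(1) by simp
  have "(n * w + j * (P * Q) - P * k * m) = (n * \<rho> + j) * (P * Q) - P * (k * (n * \<omega> + m))"
    unfolding w by (simp add: algebra_simps)
  also have "P * (k * (n * \<omega> + m)) = (k / Q * (n * \<omega> + m)) * (P * Q)"
    using assms(3) by simp
  finally have "n * w + j * (P * Q) - P * k * m = (n * \<rho> + j - k / Q * (n * \<omega> + m)) * (P * Q)"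
    by (simp only: left_diff_distrib)
  then show ?thesis using assms(2,3) by simp
qed

text \<open>The coprimality conditions normalise the relation: they make \<open>level\<close> onto
  the integers and fix the number of pieces of the tube as \<open>p\<close> and the number of arcs
  in each fibre of a piece as \<open>q\<close>.\<close>

locale resonant_qpf = bounded_qpf +
  fixes p q :: nat and k w :: int
  assumes p_pos: "1 \<le> p" and q_pos: "1 \<le> q" and coprime_kq: "coprime k (int q)" and coprime_pw: "coprime (int p) w"
    and resonance: "real (p * q) * \<rho> = real p * of_int k * \<omega> + of_int w"
begin

text \<open>A homomorphism from Z^3 to Z: the group element moves \<open>K\<close> by this multiple
  of 1 / (p * q). Its kernel is the stabiliser of \<open>strip\<close>.\<close>

definition level :: "int \<Rightarrow> int \<Rightarrow> int \<Rightarrow> int" where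
  "level n m j = n * w + j * int (p * q) - int p * k * m"

definition K :: "real \<times> real \<Rightarrow> real" where
  "K z = H z - of_int k / real q * fst z"

lemma K_act: "K (act n m j z) = K z + of_int (level n m j) / real (p * q)"
proof -
  have pq: "real p \<noteq> 0" "real q \<noteq> 0" using p_pos q_pos by auto
  have "of_int n * \<rho> + of_int j - of_int k / real q * (hshift n m) = of_int (level n m j) / real (p * q)"
    using resonant_identity[OF _ pq, of \<rho> "of_int k" \<omega> "of_int w" "of_int n" "of_int j" "of_int m"] resonance
    unfolding level_def by simp
  then show ?thesis unfolding K_def H_act fst_act by (simp add: algebra_simps)
qed

definition sublevel :: "real \<Rightarrow> (real \<times> real) set" where
  "sublevel c = {z. K z \<le> c}"

lemma closed_sublevel: "closed (sublevel c)"
proof -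
  have "- sublevel c = {z. c < H z + (- of_int k / real q) * fst z}"
    by (auto simp: sublevel_def K_def)
  then show ?thesis unfolding closed_def by (simp only: open_H_greater)
qed

lemma act_interior_sublevel:
  assumes "z \<in> interior (sublevel c)"
  shows "act n m j z \<in> interior (sublevel (c + of_int (level n m j) / real (p * q)))"
proof (rule interiorI)
  show "open (act n m j ` interior (sublevel c))" by (simp add: open_act_image)
  show "act n m j z \<in> act n m j ` interior (sublevel c)" using assms by blast
  show "act n m j ` interior (sublevel c) \<subseteq> sublevel (c + of_int (level n m j) / real (p * q))"
    using interior_subset by (fastforce simp: sublevel_def K_act)
qed

text \<open>By \<open>H_mono\<close> sublevel sets are stable under moving down. Pushing down the
  whole open set passes this on to the interior.\<close>

lemma interior_sublevel_downward:
  assumes "(\<theta>, x) \<in> interior (sublevel c)" "y \<le> x"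
  shows "(\<theta>, y) \<in> interior (sublevel c)"
proof (rule interiorI)
  let ?S = "(\<lambda>z. (0, y - x) + z) ` interior (sublevel c)"
  show "open ?S" by (intro open_translation) simp
  show "(\<theta>, y) \<in> ?S" using assms(1) by (intro image_eqI[of _ _ "(\<theta>, x)"]) simp_all
  show "?S \<subseteq> sublevel c"
  proof
    fix a assume "a \<in> ?S"
    then obtain z where z: "z \<in> interior (sublevel c)" "a = (0, y - x) + z" by blast
    have "H a \<le> H z" by (rule H_mono) (use z assms(2) in simp_all)
    moreover have "z \<in> sublevel c" using z(1) interior_subset by blast
    ultimately show "a \<in> sublevel c" using z(2) by (simp add: sublevel_def K_def)
  qed
qed

text \<open>\<open>H\<close> is only lower semicontinuous, so sublevel sets are closed. Taking the
  interior of the larger one makes the difference open, but then nonemptiness has to be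
  proved.\<close>

definition strip :: "(real \<times> real) set" where
  "strip = interior (sublevel (1 / real (p * q))) - sublevel 0"

lemma open_strip: "open strip"
  unfolding strip_def using closed_sublevel by (intro open_Diff) auto

lemma act_strip: "z \<in> strip \<Longrightarrow> level n m j = 0 \<Longrightarrow> act n m j z \<in> strip"
  using act_interior_sublevel[of z "1 / real (p * q)" n m j]
  by (simp add: strip_def sublevel_def K_act)

text \<open>On the strip \<open>K\<close> takes values in a half-open interval of length 1 / (p *
  q), so a shift by a nonzero multiple of that length leaves it.\<close>

lemma level_eq_0_if_return:
  assumes "z \<in> strip" "act n m j z \<in> strip"
  shows "level n m j = 0"
proof -
  have pq: "real (p * q) > 0" using p_pos q_pos by simp
  have range: "0 < K z \<and> K z \<le> 1 / real (p * q)" if "z \<in> strip" for z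
    using that interior_subset unfolding strip_def sublevel_def by fastforce
  have "\<bar>of_int (level n m j) / real (p * q)\<bar> < 1 / real (p * q)"
    using range[OF assms(1)] range[OF assms(2)] unfolding K_act by linarith
  then have "\<bar>of_int (level n m j)\<bar> < (1::real)" using pq
    by (simp add: abs_divide divide_less_cancel del: of_nat_mult)
  then show ?thesis by linarith
qed

lemma strip_convex:
  assumes "(\<theta>, x) \<in> strip" "(\<theta>, y) \<in> strip" "x \<le> t" "t \<le> y"
  shows "(\<theta>, t) \<in> strip"
proof -
  have "H (\<theta>, x) \<le> H (\<theta>, t)" by (rule H_mono) (use assms in simp_all)
  then have "(\<theta>, t) \<notin> sublevel 0" using assms(1) by (simp add: strip_def sublevel_def K_def)
  then show ?thesis using interior_sublevel_downward[of \<theta> y _ t] assms unfolding strip_def by blast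
qed

lemma obtain_level:
  obtains n m j where "level n m j = 1"
proof -
  obtain a b where ab: "a * int p + b * w = 1"
    using coprime_pw by (metis bezout_int coprime_iff_gcd_eq_1)
  obtain c d where cd: "c * k + d * int q = 1"
    using coprime_kq by (metis bezout_int coprime_iff_gcd_eq_1)
  have "level b (- a * c) (a * d) = b * w + a * int p * (c * k + d * int q)"
    unfolding level_def by (simp add: algebra_simps)
  also have "\<dots> = 1" using ab cd by simp
  finally show ?thesis using that by blast
qed

text \<open>If the strip were empty, every point interior to \<open>sublevel c\<close> would already
  lie in \<open>sublevel 0\<close>. A group element of level 1 carries this gap one step up, so by
  induction the interiors of all sublevel sets lie in \<open>sublevel 0\<close>. But
  \<open>K\<close> is within bounded distance of a linear function and takes large values.\<close>

lemma strip_nonempty: "strip \<noteq> {}"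
proof
  assume empty: "strip = {}"
  obtain n m j where level: "level n m j = 1" using obtain_level .
  define c where "c = 1 / real (p * q)"
  have c: "c > 0" unfolding c_def using p_pos q_pos by simp
  have sub: "interior (sublevel c) \<subseteq> sublevel 0" using empty unfolding strip_def c_def by blast
  have all: "interior (sublevel (real i * c)) \<subseteq> sublevel 0" for i
  proof (induction i)
    case 0
    show ?case using interior_subset[of "sublevel 0"] by simp
  next
    case (Suc i)
    have "interior (sublevel (real (Suc i) * c)) \<subseteq> sublevel c"
    proof
      fix z assume "z \<in> interior (sublevel (real (Suc i) * c))"
      then have "act (- n) (- m) (- j) z \<in> interior (sublevel (real (Suc i) * c + of_int (level (- n) (- m) (- j)) / real (p * q)))"
        by (rule act_interior_sublevel)
      moreover have neg: "level (- n) (- m) (- j) = - 1" using level by (simp add: level_def)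
      moreover have "real (Suc i) * c + of_int (- 1) / real (p * q) = real i * c"
        unfolding c_def by (simp add: add_divide_distrib)
      ultimately have "act (- n) (- m) (- j) z \<in> sublevel 0" using Suc by (metis subsetD)
      then show "z \<in> sublevel c" unfolding sublevel_def mem_Collect_eq K_act neg c_def by simp
    qed
    then have "interior (sublevel (real (Suc i) * c)) \<subseteq> interior (sublevel c)"
      by (simp add: interior_maximal)
    with sub show ?case by blast
  qed
  obtain i where i: "2 * C + 1 < real i * c" using reals_Archimedean3[OF c] by blast
  \<comment> \<open>By \<open>H_close\<close> the open half plane \<open>?S\<close> lies in the
    sublevel set, while \<open>H\<close> is at least 1 at height C + 1.\<close>
  have "(0, C + 1) \<in> interior (sublevel (real i * c))"
  proof (rule interiorI)
    let ?S = "{z. snd z - of_int k / real q * fst z < real i * c - C}"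
    show "open ?S" by (intro open_Collect_less continuous_intros)
    show "(0, C + 1) \<in> ?S" using i by simp
    show "?S \<subseteq> sublevel (real i * c)"
    proof
      fix z assume "z \<in> ?S"
      then have "snd z - of_int k / real q * fst z < real i * c - C" by simp
      then show "z \<in> sublevel (real i * c)"
        using H_close[of z] unfolding sublevel_def K_def mem_Collect_eq by linarith
    qed
  qed
  then have "K (0, C + 1) \<le> 0" using all unfolding sublevel_def by blast
  then show False using H_close[of "(0, C + 1)"] by (simp add: K_def)
qed

text \<open>The triples (p*q*n, -p*q*h, -p*k*h - w*n) have level 0, and their horizontal shifts
  p*q*(n*\<omega> - h) are dense. They move a small square of the strip over any given
  fibre.\<close>

lemma strip_fibre_nonempty: "\<exists>x. (\<theta>, x) \<in> strip"
proof -
  obtain z where "z \<in> strip" using strip_nonempty by blast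
  then obtain r where r: "0 < r" "square z r \<subseteq> strip" using square_subset_open open_strip by blast
  define pq where "pq = real (p * q)"
  have pq: "0 < pq" unfolding pq_def using p_pos q_pos by simp
  have "0 < r / pq" using r pq by simp
  then obtain h n :: int where hn: "\<bar>of_int n * \<omega> - of_int h - (\<theta> - fst z) / pq\<bar> < r / pq"
    using sequence_of_fractional_parts_is_dense[OF irrational] by metis
  define \<alpha> where "\<alpha> = pq * (of_int n * \<omega> - of_int h)"
  have "pq * ((\<theta> - fst z) / pq) = \<theta> - fst z" using pq by simp
  then have "\<alpha> - (\<theta> - fst z) = pq * (of_int n * \<omega> - of_int h - (\<theta> - fst z) / pq)"
    unfolding \<alpha>_def right_diff_distrib[of pq _ "(\<theta> - fst z) / pq"] by simp
  then have "\<bar>\<alpha> - (\<theta> - fst z)\<bar> = pq * \<bar>of_int n * \<omega> - of_int h - (\<theta> - fst z) / pq\<bar>"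
    using pq by (simp add: abs_mult)
  also have "\<dots> < pq * (r / pq)" by (rule mult_strict_left_mono[OF hn pq])
  finally have "\<bar>\<alpha> - (\<theta> - fst z)\<bar> < r" using pq by simp
  then have "(\<theta> - \<alpha>, snd z) \<in> square z r" using r(1) unfolding square_def by auto
  then have "(\<theta> - \<alpha>, snd z) \<in> strip" using r(2) by blast
  moreover have "level (int (p * q) * n) (- int (p * q) * h) (- int p * k * h - w * n) = 0"
    unfolding level_def by (simp add: algebra_simps)
  ultimately have "act (int (p * q) * n) (- int (p * q) * h) (- int p * k * h - w * n) (\<theta> - \<alpha>, snd z) \<in> strip"
    by (rule act_strip)
  moreover have "fst (act (int (p * q) * n) (- int (p * q) * h) (- int p * k * h - w * n) (\<theta> - \<alpha>, snd z)) = \<theta>"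
    unfolding fst_act \<alpha>_def pq_def by (simp add: algebra_simps)
  ultimately show ?thesis by (metis prod.collapse)
qed

lemma connected_strip: "connected strip"
  using connected_open_convex_fibres[OF open_strip strip_fibre_nonempty] strip_convex by blast

end

section \<open>Projection to the torus\<close>

lemma cis_2pi_eq_iff: "cis (2 * pi * a) = cis (2 * pi * b) \<longleftrightarrow> (\<exists>m::int. a = b + of_int m)"
proof -
  have "cis (2 * pi * a) = cis (2 * pi * b) \<longleftrightarrow> sin (2 * pi * a) = sin (2 * pi * b) \<and> cos (2 * pi * a) = cos (2 * pi * b)"
    by (auto simp: complex_eq_iff)
  also have "\<dots> \<longleftrightarrow> (\<exists>m::int. 2 * pi * a = 2 * pi * b + 2 * pi * of_int m)"
    unfolding sin_cos_eq_iff by (simp add: mult_ac)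
  also have "\<dots> \<longleftrightarrow> (\<exists>m::int. a = b + of_int m)"
    unfolding distrib_left[symmetric] by simp
  finally show ?thesis .
qed

lemma tor_eq_iff: "tor z = tor w \<longleftrightarrow> (\<exists>m k. z = w + (of_int m, of_int k))"
  by (simp add: tor_def cis_2pi_eq_iff prod_eq_iff)

lemma tor_translate: "tor (z + (of_int m, of_int k)) = tor z"
  using tor_eq_iff by blast

lemma continuous_on_tor: "continuous_on S tor"
  unfolding tor_def by (intro continuous_intros)

text \<open>The complement of the image is the image of those points of the unit square none of
  whose integer translates lies in \<open>S\<close>. That set is compact, hence so is its
  image.\<close>

lemma openin_tor_image:
  assumes "open S"
  shows "openin (top_of_set Torus) (tor ` S)"
proof -
  define N where "N = {z. \<forall>m k. z + (of_int m, of_int k) \<notin> S}"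
  have "N = (\<Inter>m. \<Inter>k. (\<lambda>z. z + (of_int m, of_int k)) -` (- S))"
    unfolding N_def by auto
  moreover have "closed ((\<lambda>z. z + (real_of_int m, real_of_int k)) -` (- S))" for m k
    by (rule closed_vimage) (use assms in \<open>auto intro!: continuous_intros\<close>)
  ultimately have "closed N" by auto
  then have "compact (tor ` (N \<inter> cbox (0, 0) (1, 1)))"
    by (intro compact_continuous_image continuous_on_tor closed_Int_compact compact_cbox)
  then have closed: "closed (tor ` (N \<inter> cbox (0, 0) (1, 1)))" by (rule compact_imp_closed)
  have "tor ` S = Torus \<inter> - tor ` (N \<inter> cbox (0, 0) (1, 1))"
  proof (intro equalityI subsetI)
    fix y assume "y \<in> tor ` S"
    then obtain z where z: "z \<in> S" "y = tor z" by blast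
    have False if w: "tor z = tor w" "w \<in> N" for w
    proof -
      obtain m k where "z = w + (of_int m, of_int k)" using w(1) tor_eq_iff by blast
      then show False using z(1) w(2) unfolding N_def by blast
    qed
    then have "y \<notin> tor ` (N \<inter> cbox (0, 0) (1, 1))" unfolding z(2) by (metis IntD1 imageE)
    moreover have "y \<in> Torus" unfolding z(2) Torus_def by (rule rangeI)
    ultimately show "y \<in> Torus \<inter> - tor ` (N \<inter> cbox (0, 0) (1, 1))" by simp
  next
    fix y assume y: "y \<in> Torus \<inter> - tor ` (N \<inter> cbox (0, 0) (1, 1))"
    then obtain z where z: "y = tor z" unfolding Torus_def by blast
    define w where "w = (frac (fst z), frac (snd z))"
    have zw: "z = w + (of_int \<lfloor>fst z\<rfloor>, of_int \<lfloor>snd z\<rfloor>)"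
      unfolding w_def by (simp add: frac_def prod_eq_iff)
    then have "y = tor w" using z tor_translate by metis
    moreover have "w \<in> cbox (0, 0) (1, 1)"
      unfolding w_def by (simp add: cbox_Pair_iff less_imp_le[OF frac_lt_1])
    ultimately have "w \<notin> N" using y by blast
    then obtain m k where "w + (of_int m, of_int k) \<in> S" unfolding N_def by blast
    then show "y \<in> tor ` S" using \<open>y = tor w\<close> tor_translate by (metis image_eqI)
  qed
  then show ?thesis using closed unfolding openin_open by blast
qed

text \<open>A connected set strictly containing one piece would be separated by this piece and the
  union of the others, both relatively open.\<close>

lemma components_disjoint_openin:
  assumes S: "S = (\<Union>i\<in>I. A i)"
    and openin: "\<And>i. i \<in> I \<Longrightarrow> openin (top_of_set S) (A i)"
    and connected: "\<And>i. i \<in> I \<Longrightarrow> connected (A i)"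
    and nonempty: "\<And>i. i \<in> I \<Longrightarrow> A i \<noteq> {}"
    and disjoint: "\<And>i j. i \<in> I \<Longrightarrow> j \<in> I \<Longrightarrow> i \<noteq> j \<Longrightarrow> A i \<inter> A j = {}"
  shows "components S = A ` I"
proof -
  have comp: "A i \<in> components S" if i: "i \<in> I" for i
    unfolding in_components_maximal
  proof (intro conjI allI impI)
    show "A i \<noteq> {}" "A i \<subseteq> S" "connected (A i)" using i nonempty S connected by auto
    fix D assume D: "D \<noteq> {} \<and> A i \<subseteq> D \<and> D \<subseteq> S \<and> connected D"
    define B where "B = (\<Union>j\<in>I - {i}. A j)"
    have "openin (top_of_set S) B" unfolding B_def by (intro openin_Union) (use openin in auto)
    then obtain P where P: "open P" "B = S \<inter> P" unfolding openin_open by blast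
    obtain Q where Q: "open Q" "A i = S \<inter> Q" using openin[OF i] unfolding openin_open by blast
    have "A i \<inter> B = {}" unfolding B_def using disjoint[OF i] by blast
    then have "Q \<inter> P \<inter> D = {}" using P Q D by blast
    moreover have "S = A i \<union> B" unfolding B_def S using i by blast
    then have "D \<subseteq> Q \<union> P" using P Q D by blast
    ultimately have "Q \<inter> D = {} \<or> P \<inter> D = {}" using connectedD[of D Q P] P Q D by blast
    moreover have "Q \<inter> D \<noteq> {}" using D Q nonempty[OF i] by blast
    ultimately show "D = A i" using D \<open>S = A i \<union> B\<close> P by blast
  qed
  show ?thesis
  proof (intro equalityI subsetI)
    fix X assume X: "X \<in> components S"
    then obtain x where "x \<in> X" "x \<in> S" using in_components_nonempty in_components_subset by blast
    then obtain i where "i \<in> I" "x \<in> A i" unfolding S by blast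
    then have "X = A i" using components_eq[OF X comp] \<open>x \<in> X\<close> by blast
    then show "X \<in> A ` I" using \<open>i \<in> I\<close> by blast
  qed (use comp in blast)
qed

context qpf
begin

text \<open>\<open>torus_map\<close> evaluates at an arbitrarily chosen lift; by
  \<open>L_translate\<close> the choice does not affect the projected value.\<close>

lemma torus_map_tor: "torus_map \<omega> F (tor z) = tor (L z)"
proof -
  have "tor (SOME w. tor w = tor z) = tor z" by (rule someI[of "\<lambda>w. tor w = tor z"]) simp
  then obtain m k where "(SOME w. tor w = tor z) = z + (of_int m, of_int k)" using tor_eq_iff by blast
  then show ?thesis unfolding torus_map_def by (simp only: L_translate tor_translate)
qed

lemma torus_map_pow_tor: "(torus_map \<omega> F ^^ n) (tor z) = tor (iter (int n) z)"
  unfolding zpow_of_nat by (induction n) (simp_all add: torus_map_tor)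

lemma tor_act: "tor (act n m k z) = tor (iter n z)"
  unfolding act_def by (rule tor_translate)

lemma not_transitive_squares:
  assumes "\<not> top_transitive (torus_map \<omega> F)"
  obtains u v r where "0 < r" "\<And>n m k z. 1 \<le> n \<Longrightarrow> z \<in> square v r \<Longrightarrow> act n m k z \<notin> square u r"
proof -
  obtain U V where UV: "openin (top_of_set Torus) U" "openin (top_of_set Torus) V" "U \<noteq> {}" "V \<noteq> {}"
    and disj: "\<And>n. n \<ge> 1 \<Longrightarrow> (torus_map \<omega> F ^^ n) -` U \<inter> V = {}"
    using assms unfolding top_transitive_def by blast
  have square: "\<exists>u r. 0 < r \<and> tor ` square u r \<subseteq> U" if U: "openin (top_of_set Torus) U" "U \<noteq> {}" for U
  proof -
    obtain P where P: "open P" "U = Torus \<inter> P" using U(1) unfolding openin_open by blast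
    obtain u where "tor u \<in> P" using U(2) P(2) unfolding Torus_def by blast
    moreover have "open (tor -` P)" using continuous_on_open_vimage[of UNIV tor] continuous_on_tor P(1) by simp
    ultimately obtain r where "0 < r" "square u r \<subseteq> tor -` P"
      using square_subset_open[of "tor -` P" u] by auto
    then show ?thesis using P(2) unfolding Torus_def by blast
  qed
  obtain u r where u: "0 < r" "tor ` square u r \<subseteq> U" using square[OF UV(1,3)] by blast
  obtain v s where v: "0 < s" "tor ` square v s \<subseteq> V" using square[OF UV(2,4)] by blast
  show ?thesis
  proof
    show "0 < min r s" using u v by simp
    fix n m k z assume n: "(1::int) \<le> n" and z: "z \<in> square v (min r s)"
    show "act n m k z \<notin> square u (min r s)"
    proof
      assume "act n m k z \<in> square u (min r s)"
      then have "tor (act n m k z) \<in> U" using u by (auto simp: square_def)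
      then have "(torus_map \<omega> F ^^ nat n) (tor z) \<in> U" using n by (simp add: torus_map_pow_tor tor_act)
      moreover have "tor z \<in> V" using z v by (auto simp: square_def)
      ultimately show False using disj[of "nat n"] n by force
    qed
  qed
qed

end

section \<open>The tube covered by the resonant strip\<close>

context resonant_qpf
begin

lemma level_0_dvd:
  assumes "level n m j = 0"
  shows "int p dvd n"
proof -
  have "n * w = int p * (k * m - j * int q)" using assms by (simp add: level_def algebra_simps)
  then have "int p dvd n * w" by simp
  then show ?thesis using coprime_pw coprime_dvd_mult_left_iff by blast
qed

lemma level_0_dvd_q:
  assumes "level 0 m j = 0"
  shows "int q dvd m"
proof -
  have "level 0 m j = int p * (j * int q - k * m)" by (simp add: level_def algebra_simps)
  then have "j * int q - k * m = 0" using assms p_pos by simp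
  then have "k * m = int q * j" by (simp add: mult.commute)
  then have "int q dvd k * m" by simp
  then show ?thesis using coprime_kq by (metis coprime_commute coprime_dvd_mult_right_iff)
qed

text \<open>Some lift of the \<open>p\<close>-th iterate preserves the strip. Together with
  \<open>level_0_dvd\<close> this makes \<open>p\<close> the exact period of the projected
  strip.\<close>

lemma period_level:
  obtains m j where "level (int p) m j = 0"
proof -
  obtain c d where cd: "c * k + d * int q = 1"
    using coprime_kq by (metis bezout_int coprime_iff_gcd_eq_1)
  have "level (int p) (w * c) (- (w * d)) = int p * w * (1 - (c * k + d * int q))"
    unfolding level_def by (simp add: algebra_simps)
  then show ?thesis using cd that by simp
qed

definition section_at :: "real \<Rightarrow> real set" where
  "section_at \<theta> = {x. (\<theta>, x) \<in> strip}"

abbreviation arc :: "real \<Rightarrow> complex set" where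
  "arc \<theta> \<equiv> (\<lambda>x. cis (2 * pi * x)) ` section_at \<theta>"

text \<open>The translation (q*i, k*i) has level 0: the strip closes up after \<open>q\<close> turns
  in the base, having wound \<open>k\<close> times in the fibre. This is why \<open>q\<close> arcs
  exhaust a fibre of the projection.\<close>

lemma section_translate: "section_at (\<theta> + of_int (int q * i)) = (\<lambda>x. x + of_int (k * i)) ` section_at \<theta>"
proof -
  have sub: "x + of_int (k * i) \<in> section_at (\<theta> + of_int (int q * i))" if "x \<in> section_at \<theta>" for x \<theta> i
  proof -
    have "level 0 (int q * i) (k * i) = 0" unfolding level_def by simp
    then have "act 0 (int q * i) (k * i) (\<theta>, x) \<in> strip" using act_strip that unfolding section_at_def by blast
    then show ?thesis unfolding section_at_def act_def by simp
  qed
  show ?thesis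
  proof (intro equalityI subsetI)
    fix x assume "x \<in> section_at (\<theta> + of_int (int q * i))"
    from sub[OF this, of "- i"] have "x - of_int (k * i) \<in> section_at \<theta>" by simp
    then show "x \<in> (\<lambda>x. x + of_int (k * i)) ` section_at \<theta>" by (intro image_eqI[of _ _ "x - of_int (k * i)"]) simp_all
  qed (use sub in blast)
qed

lemma arc_translate: "arc (\<theta> + of_int (int q * i)) = arc \<theta>"
proof -
  have "cis (2 * pi * (x + of_int (k * i))) = cis (2 * pi * x)" for x
    using cis_2pi_eq_iff by blast
  then show ?thesis unfolding section_translate image_image by simp
qed

text \<open>Two points of the strip with the same projection differ by an element of time 0, which
  must have level 0. Consequently arcs for different residues modulo \<open>q\<close> are disjoint,
  and the projection is injective on each section.\<close>

lemma section_points_congruent: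
  assumes "x \<in> section_at (\<theta> + of_int m)" "y \<in> section_at (\<theta> + of_int m')" "cis (2 * pi * x) = cis (2 * pi * y)"
  shows "int q dvd m - m'" "m = m' \<Longrightarrow> x = y"
proof -
  obtain j :: int where j: "x = y + of_int j" using assms(3) cis_2pi_eq_iff by blast
  have "act 0 (m - m') j (\<theta> + of_int m', y) = (\<theta> + of_int m, x)" using j by (simp add: act_def)
  then have level: "level 0 (m - m') j = 0"
    using level_eq_0_if_return[of "(\<theta> + of_int m', y)" 0 "m - m'" j] assms(1,2) unfolding section_at_def by simp
  then show "int q dvd m - m'" by (rule level_0_dvd_q)
  assume "m = m'"
  then have "j = 0" using level p_pos q_pos by (simp add: level_def)
  then show "x = y" using j by simp
qed

lemma fibre_strip: "fibre (tor ` strip) \<theta> = (\<Union>m\<in>{0..<int q}. arc (\<theta> + of_int m))"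
proof (intro equalityI subsetI)
  fix y assume "y \<in> fibre (tor ` strip) \<theta>"
  then obtain z where z: "z \<in> strip" "cis (2 * pi * \<theta>) = cis (2 * pi * fst z)" "y = cis (2 * pi * snd z)"
    unfolding fibre_def tor_def by auto
  obtain m :: int where m: "fst z = \<theta> + of_int m" using cis_2pi_eq_iff z(2) by metis
  have "snd z \<in> section_at (\<theta> + of_int m)" using z(1) m[symmetric] unfolding section_at_def by simp
  then have "y \<in> arc (\<theta> + of_int m)" using z(3) by blast
  moreover have "\<theta> + of_int m = \<theta> + of_int (m mod int q) + of_int (int q * (m div int q))"
  proof -
    have "m = m mod int q + int q * (m div int q)" by simp
    then have "real_of_int m = of_int (m mod int q) + of_int (int q * (m div int q))" by (metis of_int_add)
    then show ?thesis by simp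
  qed
  ultimately have "y \<in> arc (\<theta> + of_int (m mod int q))" by (simp only: arc_translate)
  then show "y \<in> (\<Union>m\<in>{0..<int q}. arc (\<theta> + of_int m))" using q_pos by (intro UN_I[of "m mod int q"]) auto
next
  fix y assume "y \<in> (\<Union>m\<in>{0..<int q}. arc (\<theta> + of_int m))"
  then obtain m x where "(\<theta> + of_int m, x) \<in> strip" "y = cis (2 * pi * x)" unfolding section_at_def by blast
  moreover have "cis (2 * pi * (\<theta> + of_int m)) = cis (2 * pi * \<theta>)" using cis_2pi_eq_iff by blast
  ultimately show "y \<in> fibre (tor ` strip) \<theta>"
    unfolding fibre_def by (auto simp: tor_def intro!: image_eqI[of _ _ "(\<theta> + of_int m, x)"])
qed

lemma openin_arc:
  "openin (top_of_set (fibre (tor ` strip) \<theta>)) (arc (\<theta> + of_int m))"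
proof -
  \<comment> \<open>A window of width 1 around \<theta> + m contains no other lift \<theta> + i of
    the same base point.\<close>
  define W where "W = strip \<inter> {z. \<bar>fst z - (\<theta> + of_int m)\<bar> < 1 / 2}"
  have "open W" unfolding W_def
    by (intro open_Int open_strip open_Collect_less continuous_intros)
  then obtain P where P: "open P" "tor ` W = Torus \<inter> P"
    using openin_tor_image unfolding openin_open by metis
  let ?Q = "(\<lambda>y. (cis (2 * pi * \<theta>), y)) -` P"
  have "open ?Q"
    using continuous_on_open_vimage[of UNIV "\<lambda>y. (cis (2 * pi * \<theta>), y)"] P(1) by (simp add: continuous_intros)
  moreover have "arc (\<theta> + of_int m) = fibre (tor ` strip) \<theta> \<inter> ?Q"
  proof (intro equalityI subsetI)
    fix y assume "y \<in> arc (\<theta> + of_int m)"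
    then obtain x where x: "(\<theta> + of_int m, x) \<in> strip" "y = cis (2 * pi * x)" unfolding section_at_def by blast
    have "cis (2 * pi * (\<theta> + of_int m)) = cis (2 * pi * \<theta>)" using cis_2pi_eq_iff by blast
    then have y: "(cis (2 * pi * \<theta>), y) = tor (\<theta> + of_int m, x)" using x(2) by (simp add: tor_def)
    have "(\<theta> + of_int m, x) \<in> W" using x(1) unfolding W_def by simp
    then have "(cis (2 * pi * \<theta>), y) \<in> tor ` W" using y by blast
    then show "y \<in> fibre (tor ` strip) \<theta> \<inter> ?Q" using P(2) unfolding fibre_def W_def by auto
  next
    fix y assume y: "y \<in> fibre (tor ` strip) \<theta> \<inter> ?Q"
    then have "(cis (2 * pi * \<theta>), y) \<in> Torus \<inter> P" unfolding fibre_def Torus_def by auto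
    then obtain z where z: "z \<in> W" "cis (2 * pi * \<theta>) = cis (2 * pi * fst z)" "y = cis (2 * pi * snd z)"
      unfolding P(2)[symmetric] tor_def by auto
    obtain i :: int where i: "fst z = \<theta> + of_int i" using cis_2pi_eq_iff z(2) by metis
    have "\<bar>real_of_int (i - m)\<bar> < 1" using z(1) i unfolding W_def by simp
    then have "i = m" by linarith
    then show "y \<in> arc (\<theta> + of_int m)" using z i unfolding W_def section_at_def by (metis IntD1 imageI mem_Collect_eq prod.collapse)
  qed
  ultimately show ?thesis unfolding openin_open by blast
qed

lemma connected_arc: "connected (arc \<theta>)"
proof (rule connected_continuous_image)
  show "continuous_on (section_at \<theta>) (\<lambda>x. cis (2 * pi * x))" by (intro continuous_intros)
  have "is_interval (section_at \<theta>)"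
    unfolding is_interval_1 section_at_def using strip_convex by blast
  then show "connected (section_at \<theta>)" by (simp add: is_interval_connected_1)
qed

lemma arc_nonempty: "arc \<theta> \<noteq> {}"
  using strip_fibre_nonempty[of \<theta>] unfolding section_at_def by blast

text \<open>A section is a bounded open interval on which the projection is injective. If the arc
  were the whole circle, the supremum \<open>b\<close> would be congruent to some \<open>y\<close>
  in the section. Points slightly below \<open>b\<close> and \<open>y\<close> would then be
  congruent points of the section, so b = y, and openness would give points above the
  supremum.\<close>

lemma arc_proper: "arc \<theta> \<noteq> sphere 0 1"
proof
  assume eq: "arc \<theta> = sphere 0 1"
  have "open (section_at \<theta>)"
    using open_vimage[OF open_strip, of "\<lambda>x. (\<theta>, x)"]
    unfolding section_at_def vimage_def by (simp add: continuous_intros)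
  moreover obtain x where x: "x \<in> section_at \<theta>" using strip_fibre_nonempty unfolding section_at_def by blast
  ultimately obtain e where e: "0 < e" "ball x e \<subseteq> section_at \<theta>" using open_contains_ball by blast
  have bound: "\<bar>y - x\<bar> \<le> 1" if y: "y \<in> section_at \<theta>" for y
  proof (rule ccontr)
    assume "\<not> ?thesis"
    then consider "x + 1 \<le> y" | "y \<le> x - 1" by linarith
    then have "x + 1 \<in> section_at \<theta> \<or> x - 1 \<in> section_at \<theta>"
      using strip_convex[of \<theta> x y "x + 1"] strip_convex[of \<theta> y x "x - 1"] x y unfolding section_at_def by auto
    moreover have "cis (2 * pi * (x + 1)) = cis (2 * pi * x)" "cis (2 * pi * (x - 1)) = cis (2 * pi * x)"
      unfolding cis_2pi_eq_iff by (auto intro: exI[of _ "1"] exI[of _ "-1"])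
    ultimately show False
      using section_points_congruent(2)[of "x + 1" \<theta> 0 x 0] section_points_congruent(2)[of "x - 1" \<theta> 0 x 0] x by auto
  qed
  have bdd: "bdd_above (section_at \<theta>)" using bound by (intro bdd_aboveI[of _ "x + 1"]) (smt (verit))
  define b where "b = Sup (section_at \<theta>)"
  have below: "t \<in> section_at \<theta>" if t: "x \<le> t" "t < b" for t
  proof -
    obtain y where "y \<in> section_at \<theta>" "t < y" using t(2) x bdd less_cSup_iff unfolding b_def by blast
    then show ?thesis using strip_convex[of \<theta> x y t] x t unfolding section_at_def by auto
  qed
  have upper: "t \<le> b" if "t \<in> section_at \<theta>" for t using that bdd cSup_upper unfolding b_def by blast
  have "x < b" using upper[of "x + e / 2"] e by (force simp: dist_real_def subset_iff)
  have "cis (2 * pi * b) \<in> arc \<theta>" unfolding eq by simp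
  then obtain y where y: "y \<in> section_at \<theta>" "cis (2 * pi * b) = cis (2 * pi * y)" by blast
  obtain j :: int where j: "b = y + of_int j" using y(2) cis_2pi_eq_iff by blast
  obtain d where d: "0 < d" "ball y d \<subseteq> section_at \<theta>"
    using \<open>open (section_at \<theta>)\<close> y(1) open_contains_ball by blast
  define h where "h = min (d / 2) (b - x)"
  have h: "0 < h" "h < d" "h \<le> b - x" using d \<open>x < b\<close> unfolding h_def by auto
  have "y - h \<in> section_at \<theta>" using d h by (force simp: dist_real_def subset_iff)
  moreover have "b - h \<in> section_at \<theta>" using below[of "b - h"] h by simp
  moreover have "cis (2 * pi * (b - h)) = cis (2 * pi * (y - h))"
    unfolding cis_2pi_eq_iff using j by auto
  ultimately have "b = y" using section_points_congruent(2)[of "b - h" \<theta> 0 "y - h" 0] by simp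
  moreover have "y + d / 2 \<in> section_at \<theta>" using d by (force simp: dist_real_def subset_iff)
  ultimately show False using upper[of "y + d / 2"] d by simp
qed

lemma components_fibre_strip:
  "components (fibre (tor ` strip) \<theta>) = (\<lambda>m. arc (\<theta> + of_int m)) ` {0..<int q}"
proof (rule components_disjoint_openin[OF fibre_strip openin_arc connected_arc arc_nonempty])
  fix i j assume ij: "i \<in> {0..<int q}" "j \<in> {0..<int q}" "i \<noteq> j"
  show "arc (\<theta> + of_int i) \<inter> arc (\<theta> + of_int j) = {}"
  proof (rule ccontr)
    assume "\<not> ?thesis"
    then have "int q dvd i - j" using section_points_congruent(1) by blast
    then have "i mod int q = j mod int q" by (simp add: mod_eq_dvd_iff)
    then show False using ij by simp
  qed
qed

lemma card_components_fibre_strip: "card (components (fibre (tor ` strip) \<theta>)) = q"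
proof -
  have "inj_on (\<lambda>m. arc (\<theta> + of_int m)) {0..<int q}"
  proof (rule inj_onI)
    fix i j assume ij: "i \<in> {0..<int q}" "j \<in> {0..<int q}" "arc (\<theta> + of_int i) = arc (\<theta> + of_int j)"
    obtain x where x: "x \<in> section_at (\<theta> + of_int i)" using strip_fibre_nonempty unfolding section_at_def by blast
    then have "cis (2 * pi * x) \<in> arc (\<theta> + of_int j)" using ij(3) by blast
    then have "int q dvd i - j" using section_points_congruent(1)[OF x] by blast
    then have "i mod int q = j mod int q" by (simp add: mod_eq_dvd_iff)
    then show "i = j" using ij by simp
  qed
  then show ?thesis unfolding components_fibre_strip by (simp add: card_image)
qed

lemma period_image_strip: "(torus_map \<omega> F ^^ p) ` (tor ` strip) = tor ` strip"
proof -
  obtain m j where level: "level (int p) m j = 0" using period_level .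
  have step: "(torus_map \<omega> F ^^ p) (tor z) = tor (act (int p) m j z)" for z
    by (simp add: torus_map_pow_tor tor_act)
  have "act (int p) m j ` strip = strip"
  proof (intro equalityI subsetI)
    fix z assume "z \<in> strip"
    moreover have "level (- int p) (- m) (- j) = 0" using level by (simp add: level_def)
    ultimately have "act (- int p) (- m) (- j) z \<in> strip" by (rule act_strip)
    then show "z \<in> act (int p) m j ` strip" by (intro image_eqI[of _ _ "act (- int p) (- m) (- j) z"]) simp_all
  qed (use act_strip[OF _ level] in blast)
  then show ?thesis using step by (simp add: image_image) (metis image_image)
qed

lemma open_tube_strip:
  "open_tube (torus_map \<omega> F) p q (\<Union>i\<in>{1..p}. (torus_map \<omega> F ^^ (i - 1)) ` (tor ` strip))"
  unfolding open_tube_def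
proof (intro exI conjI ballI impI)
  show "open_tube1 (torus_map \<omega> F ^^ p) q (tor ` strip)"
    unfolding open_tube1_def
  proof (intro conjI allI ballI)
    show "openin (top_of_set Torus) (tor ` strip)" by (rule openin_tor_image[OF open_strip])
    show "connected (tor ` strip)" by (rule connected_continuous_image[OF continuous_on_tor connected_strip])
    show "C \<noteq> sphere 0 1" if "C \<in> components (fibre (tor ` strip) \<theta>)" for C \<theta>
      using that arc_proper unfolding components_fibre_strip by blast
  qed (rule period_image_strip card_components_fibre_strip)+
  fix a b assume ab: "a \<in> {1..p}" "b \<in> {1..p}" "a \<noteq> b"
  show "(torus_map \<omega> F ^^ (a - 1)) ` tor ` strip \<inter> (torus_map \<omega> F ^^ (b - 1)) ` tor ` strip = {}"
  proof (rule ccontr)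
    assume "\<not> ?thesis"
    then obtain y where y: "y \<in> (torus_map \<omega> F ^^ (a - 1)) ` tor ` strip" "y \<in> (torus_map \<omega> F ^^ (b - 1)) ` tor ` strip"
      by blast
    obtain z where z1: "z \<in> strip" "y = tor (iter (int (a - 1)) z)" using y(1) torus_map_pow_tor by auto
    obtain z' where z2: "z' \<in> strip" "y = tor (iter (int (b - 1)) z')" using y(2) torus_map_pow_tor by auto
    note z = z1(1) z2(1) z1(2)[unfolded z2(2), symmetric]
    obtain m j where "iter (int (a - 1)) z = iter (int (b - 1)) z' + (of_int m, of_int j)"
      using z(3) tor_eq_iff by blast
    then have "act (int (a - 1)) 0 0 z = act (int (b - 1)) m j z'" by (simp add: act_def zero_prod_def[symmetric])
    then have "act (- int (a - 1)) 0 0 (act (int (a - 1)) 0 0 z) = act (- int (a - 1)) 0 0 (act (int (b - 1)) m j z')" by simp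
    then have "z = act (- int (a - 1) + int (b - 1)) m j z'" by (simp add: act_act)
    then have "level (- int (a - 1) + int (b - 1)) m j = 0" using level_eq_0_if_return z(1,2) by metis
    \<comment> \<open>Both exponents are below \<open>p\<close>, so divisibility of their difference
      by \<open>p\<close> makes them equal.\<close>
    then have "int p dvd int (b - 1) - int (a - 1)" using level_0_dvd by fastforce
    then have "int (b - 1) mod int p = int (a - 1) mod int p" by (simp add: mod_eq_dvd_iff)
    then show False using ab by auto
  qed
qed simp

end

section \<open>Recurrence and independent rotation numbers\<close>

text \<open>The map \<open>f\<close> subtracts from (s, t) the solution of the linearised equation,
  whose matrix has columns (a1, b1) and (-a2, -b2). The linear parts cancel, so \<open>f\<close> is
  bounded and maps a large square into itself; its fixed points are the parameters at which the
  curves meet.\<close>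

lemma linear_curves_intersect:
  fixes \<gamma>1 \<gamma>2 :: "real \<Rightarrow> real \<times> real"
  assumes cont: "continuous_on UNIV \<gamma>1" "continuous_on UNIV \<gamma>2"
    and close1: "\<And>t. \<bar>fst (\<gamma>1 t) - t * a1\<bar> \<le> B" "\<And>t. \<bar>snd (\<gamma>1 t) - t * b1\<bar> \<le> B"
    and close2: "\<And>t. \<bar>fst (\<gamma>2 t) - t * a2\<bar> \<le> B" "\<And>t. \<bar>snd (\<gamma>2 t) - t * b2\<bar> \<le> B"
    and det: "a1 * b2 - a2 * b1 \<noteq> 0"
  obtains s t where "\<gamma>1 s = \<gamma>2 t"
proof -
  define D where "D = a1 * b2 - a2 * b1"
  define X where "X z = fst (\<gamma>1 (fst z)) - fst (\<gamma>2 (snd z))" for z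
  define Y where "Y z = snd (\<gamma>1 (fst z)) - snd (\<gamma>2 (snd z))" for z
  define f where "f z = (fst z - (X z * b2 - a2 * Y z) / D, snd z - (b1 * X z - a1 * Y z) / D)" for z
  \<comment> \<open>Each component of \<open>X\<close> and \<open>Y\<close> deviates from its linear
    part by at most 2 * B, one \<open>B\<close> per curve; the remaining factor bounds the entries
    of the inverse matrix.\<close>
  define M where "M = 2 * B * (\<bar>a1\<bar> + \<bar>a2\<bar> + \<bar>b1\<bar> + \<bar>b2\<bar>) / \<bar>D\<bar>"
  have D: "D \<noteq> 0" using det by (simp add: D_def)
  have B: "0 \<le> B" using close1(1)[of 0] by linarith
  have M: "0 \<le> M" unfolding M_def using B by simp
  have est: "\<bar>x * b - a * y\<bar> / \<bar>D\<bar> \<le> M"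
    if "\<bar>x\<bar> \<le> 2 * B" "\<bar>y\<bar> \<le> 2 * B" "\<bar>a\<bar> + \<bar>b\<bar> \<le> \<bar>a1\<bar> + \<bar>a2\<bar> + \<bar>b1\<bar> + \<bar>b2\<bar>" for x y a b
  proof -
    have "\<bar>x * b - a * y\<bar> \<le> \<bar>x\<bar> * \<bar>b\<bar> + \<bar>y\<bar> * \<bar>a\<bar>"
      using abs_triangle_ineq4[of "x * b" "a * y"] by (simp add: abs_mult mult.commute)
    also have "\<dots> \<le> 2 * B * \<bar>b\<bar> + 2 * B * \<bar>a\<bar>"
      using that by (intro add_mono mult_right_mono) auto
    also have "\<dots> = 2 * B * (\<bar>a\<bar> + \<bar>b\<bar>)" by (simp add: algebra_simps)
    also have "\<dots> \<le> 2 * B * (\<bar>a1\<bar> + \<bar>a2\<bar> + \<bar>b1\<bar> + \<bar>b2\<bar>)" using that B by (intro mult_left_mono) auto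
    finally show ?thesis unfolding M_def by (intro divide_right_mono) auto
  qed
  have f_bound: "\<bar>fst (f z)\<bar> \<le> M" "\<bar>snd (f z)\<bar> \<le> M" for z
  proof -
    define x where "x = X z - (fst z * a1 - snd z * a2)"
    define y where "y = Y z - (fst z * b1 - snd z * b2)"
    have xy: "\<bar>x\<bar> \<le> 2 * B" "\<bar>y\<bar> \<le> 2 * B"
      using close1[of "fst z"] close2[of "snd z"] unfolding x_def y_def X_def Y_def by linarith+
    have "X z * b2 - a2 * Y z = fst z * D + (x * b2 - a2 * y)"
      unfolding x_def y_def D_def by (simp add: algebra_simps)
    then have "fst (f z) = - ((x * b2 - a2 * y) / D)"
      unfolding f_def using D by (simp add: add_divide_distrib)
    then show "\<bar>fst (f z)\<bar> \<le> M" using est[OF xy, of a2 b2] by (simp add: abs_divide)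
    have "b1 * X z - a1 * Y z = snd z * D + (x * b1 - a1 * y)"
      unfolding x_def y_def D_def by (simp add: algebra_simps)
    then have "snd (f z) = - ((x * b1 - a1 * y) / D)"
      unfolding f_def using D by (simp add: add_divide_distrib)
    then show "\<bar>snd (f z)\<bar> \<le> M" using est[OF xy, of a1 b1] by (simp add: abs_divide)
  qed
  have c1: "continuous_on S (\<lambda>z. \<gamma>1 (fst z))" for S :: "(real \<times> real) set"
    by (rule continuous_on_compose2[OF cont(1)]) (auto intro: continuous_intros)
  have c2: "continuous_on S (\<lambda>z. \<gamma>2 (snd z))" for S :: "(real \<times> real) set"
    by (rule continuous_on_compose2[OF cont(2)]) (auto intro: continuous_intros)
  have cont_f: "continuous_on (cbox (- M, - M) (M, M)) f"
    unfolding f_def X_def Y_def using D by (intro continuous_intros c1 c2) auto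
  have maps: "f \<in> cbox (- M, - M) (M, M) \<rightarrow> cbox (- M, - M) (M, M)"
  proof
    fix z
    have "(fst (f z), snd (f z)) \<in> cbox (- M, - M) (M, M)"
      using f_bound[of z] unfolding cbox_Pair_iff by (simp add: abs_le_iff)
    then show "f z \<in> cbox (- M, - M) (M, M)" by simp
  qed
  have "(0, 0) \<in> cbox (- M, - M) (M, M)" using M by (simp add: cbox_Pair_iff)
  then have "cbox (- M, - M) (M, M) \<noteq> {}" by blast
  then obtain z where z: "f z = z"
    by (rule brouwer[OF compact_cbox convex_box(1) _ cont_f maps])
  then have "X z * b2 - a2 * Y z = 0" "b1 * X z - a1 * Y z = 0"
    using D unfolding f_def prod_eq_iff by auto
  then have eq: "X z * b2 = a2 * Y z" "b1 * X z = a1 * Y z" by simp_all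
  have "D * X z = a1 * (X z * b2) - a2 * (b1 * X z)"
    unfolding D_def by (simp add: algebra_simps)
  also have "\<dots> = 0" unfolding eq by simp
  finally have X: "D * X z = 0" .
  have "D * Y z = b2 * (a1 * Y z) - b1 * (a2 * Y z)"
    unfolding D_def by (simp add: algebra_simps)
  also have "\<dots> = 0" unfolding eq[symmetric] by simp
  finally have "D * Y z = 0" .
  with X have "\<gamma>1 (fst z) = \<gamma>2 (snd z)" using D unfolding X_def Y_def by (simp add: prod_eq_iff)
  then show ?thesis using that by blast
qed

lemma continuous_on_glue_integers:
  fixes f :: "real \<Rightarrow> 'a::topological_space"
  assumes pieces: "\<And>j::int. continuous_on {of_int j..of_int j + 1} f"
  shows "continuous_on UNIV f"
proof -
  have int: "continuous_on {- real N..real N} f" for N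
  proof (induction N)
    case (Suc N)
    have "{- real (Suc N)..real (Suc N)} = {- real (Suc N)..- real N} \<union> ({- real N..real N} \<union> {real N..real (Suc N)})"
      by auto
    moreover have "continuous_on {- real (Suc N)..- real N} f"
      using pieces[of "- int (Suc N)"] by simp
    moreover have "continuous_on {real N..real (Suc N)} f"
      using pieces[of "int N"] by (simp add: add.commute)
    ultimately show ?case
      using Suc by (simp add: continuous_on_closed_Un closed_Un)
  qed simp
  show ?thesis
  proof (rule continuous_at_imp_continuous_on, rule ballI)
    fix t :: real
    obtain N :: nat where N: "\<bar>t\<bar> < real N" using reals_Archimedean2 by blast
    have "continuous_on {- real N<..<real N} f" 
      by (rule continuous_on_subset[OF int[of N]]) auto
    moreover have "t \<in> {- real N<..<real N}" using N unfolding abs_less_iff by simp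
    ultimately show "isCont f t" using continuous_on_eq_continuous_at open_greaterThanLessThan by blast
  qed
qed

lemma irrational_separation:
  fixes \<omega> :: real
  assumes "\<omega> \<notin> \<rat>"
  obtains \<delta> where "0 < \<delta>" "\<And>i m :: int. 1 \<le> i \<Longrightarrow> i \<le> int N \<Longrightarrow> \<delta> \<le> \<bar>of_int i * \<omega> + of_int m\<bar>"
proof -
  have "\<exists>\<delta>>0. \<forall>i m :: int. 1 \<le> i \<longrightarrow> i \<le> int N \<longrightarrow> \<delta> \<le> \<bar>of_int i * \<omega> + of_int m\<bar>"
  proof (induction N)
    case 0
    show ?case by (intro exI[of _ 1]) simp
  next
    case (Suc N)
    then obtain \<delta> where \<delta>: "0 < \<delta>" "\<And>i m :: int. 1 \<le> i \<Longrightarrow> i \<le> int N \<Longrightarrow> \<delta> \<le> \<bar>of_int i * \<omega> + of_int m\<bar>"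
      by blast
    define x where "x = of_int (int (Suc N)) * \<omega>"
    have "frac x \<noteq> 0"
    proof
      assume "frac x = 0"
      then have "of_int (int (Suc N)) * \<omega> + of_int (- \<lfloor>x\<rfloor>) = 0" by (simp add: frac_def x_def)
      then show False using irrational_int_eq_zero[OF assms] by (metis of_nat_eq_0_iff nat.distinct(1))
    qed
    then have x: "0 < frac x" "frac x < 1" using frac_ge_0[of x] frac_lt_1[of x] by linarith+
    define \<epsilon> where "\<epsilon> = min \<delta> (min (frac x) (1 - frac x))"
    have "\<epsilon> \<le> \<bar>of_int i * \<omega> + of_int m\<bar>" if i: "1 \<le> i" "i \<le> int (Suc N)" for i m
    proof (cases "i = int (Suc N)")
      case True
      have "of_int i * \<omega> + of_int m = frac x + of_int (\<lfloor>x\<rfloor> + m)"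
        unfolding True x_def[symmetric] frac_def by simp
      moreover have "\<epsilon> \<le> \<bar>frac x + of_int l\<bar>" for l :: int
      proof (cases "0 \<le> l")
        case True
        then have "(0::real) \<le> of_int l" by simp
        then show ?thesis unfolding \<epsilon>_def using x by linarith
      next
        case False
        then have "of_int l \<le> (-1::real)" by linarith
        then show ?thesis unfolding \<epsilon>_def using x by linarith
      qed
      ultimately show ?thesis by metis
    next
      case False
      then show ?thesis using \<delta>(2)[of i m] i unfolding \<epsilon>_def by linarith
    qed
    moreover have "0 < \<epsilon>" unfolding \<epsilon>_def using \<delta>(1) x by simp
    ultimately show ?case by blast
  qed
  then show ?thesis using that by blast
qed

section \<open>Rational independence and recurrent boxes\<close>

locale independent_qpf = bounded_qpf +
  assumes independent: "\<And>a b c :: int. of_int a * \<rho> + of_int b * \<omega> + of_int c = 0 \<Longrightarrow> a = 0 \<and> b = 0 \<and> c = 0"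
begin

text \<open>The terms in \<omega> * \<rho> cancel in the determinant, and what is left is an integer
  relation between \<rho>, \<omega> and 1, all of whose coefficients vanish.\<close>

lemma parallel_translations:
  assumes "(hshift n m) * (vshift n' k') = (hshift n' m') * (vshift n k)"
  shows "n * m' = n' * m"
proof -
  have "of_int (m * n' - m' * n) * \<rho> + of_int (n * k' - n' * k) * \<omega> + of_int (m * k' - m' * k) = 0"
    using assms by (simp add: algebra_simps)
  from independent[OF this] show ?thesis
    by (simp add: mult.commute)
qed

lemma return_displacement:
  assumes "z \<in> square c s" "act n m k z \<in> square c s"
  shows "\<bar>hshift n m\<bar> < 2 * s"
proof -
  have "\<bar>fst z - fst c\<bar> < s" "\<bar>fst z + (hshift n m) - fst c\<bar> < s"
    using assms fst_act by (simp_all add: square_def)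
  then show ?thesis by linarith
qed

text \<open>The segment from \<open>z\<close> to its return stays in the convex box. Its translates
  under the powers of the returning element fit together to a curve which, by the bounded deviation,
  follows a straight line.\<close>

lemma axis_curve:
  assumes z: "z \<in> square c r" "act n m k z \<in> square c r"
  obtains \<gamma> B where "continuous_on UNIV \<gamma>"
    "\<And>t. \<bar>fst (\<gamma> t) - t * (hshift n m)\<bar> \<le> B" "\<And>t. \<bar>snd (\<gamma> t) - t * (vshift n k)\<bar> \<le> B"
    "\<And>t. \<exists>j w. w \<in> square c r \<and> \<gamma> t = act (j * n) (j * m) (j * k) w"
proof -
  define P where "P s = (1 - s) *\<^sub>R z + s *\<^sub>R act n m k z" for s :: real
  define g where "g j = act (j * n) (j * m) (j * k)" for j
  define \<gamma> where "\<gamma> t = g \<lfloor>t\<rfloor> (P (t - of_int \<lfloor>t\<rfloor>))" for t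
  have "convex (square c r)"
  proof -
    have "square c r = {fst c - r<..<fst c + r} \<times> {snd c - r<..<snd c + r}"
      unfolding square_def by (auto simp: abs_less_iff)
    then show ?thesis by (simp add: convex_Times)
  qed
  then have P_in: "P s \<in> square c r" if "0 \<le> s" "s \<le> 1" for s
    unfolding P_def using convexD[of "square c r" z "act n m k z" "1 - s" s] z that by simp
  have cont: "continuous_on UNIV \<gamma>"
  proof (rule continuous_on_glue_integers)
    fix j :: int
    have "continuous_on {of_int j..of_int j + 1} (\<lambda>t. g j (P (t - of_int j)))"
      unfolding g_def
      by (rule continuous_on_compose2[OF continuous_on_act[of UNIV]]) (auto simp: P_def intro!: continuous_intros)
    moreover have "\<gamma> t = g j (P (t - of_int j))" if "t \<in> {of_int j..of_int j + 1}" for t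
    proof (cases "t = of_int j + 1")
      case True
      \<comment> \<open>At the right end the floor already selects the next piece; the two agree
        because the segment ends at \<open>act n m k z\<close>.\<close>
      have "\<gamma> t = g (j + 1) z" unfolding \<gamma>_def True P_def by simp
      also have "\<dots> = g j (act n m k z)" unfolding g_def act_act by (simp add: algebra_simps)
      finally show ?thesis unfolding True P_def by simp
    next
      case False
      then have "\<lfloor>t\<rfloor> = j" using that by (simp add: floor_eq_iff)
      then show ?thesis unfolding \<gamma>_def by simp
    qed
    ultimately show "continuous_on {of_int j..of_int j + 1} \<gamma>" 
      by (metis (mono_tags, lifting) continuous_on_eq)
  qed
  define B where "B = \<bar>fst c\<bar> + \<bar>snd c\<bar> + r + C + \<bar>hshift n m\<bar> + \<bar>vshift n k\<bar>"
  have C: "0 \<le> C" using deviation[of 0 z] by simp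
  have r: "0 < r" using z(1) by (auto simp: square_def)
  have ex: "\<exists>j w. w \<in> square c r \<and> \<gamma> t = act (j * n) (j * m) (j * k) w" for t
  proof -
    have "P (t - of_int \<lfloor>t\<rfloor>) \<in> square c r" by (rule P_in) linarith+
    then show ?thesis unfolding \<gamma>_def g_def by blast
  qed
  have close: "\<bar>fst (\<gamma> t) - t * (hshift n m)\<bar> \<le> B \<and> \<bar>snd (\<gamma> t) - t * (vshift n k)\<bar> \<le> B" for t
  proof -
    define j where "j = \<lfloor>t\<rfloor>"
    define s where "s = t - of_int j"
    have s: "0 \<le> s" "s \<le> 1" unfolding s_def j_def by linarith+
    have small: "\<bar>s * x\<bar> \<le> \<bar>x\<bar>" for x :: real using s mult_left_le_one_le[of "\<bar>x\<bar>" s] by (simp add: abs_mult)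
    have P: "\<bar>fst (P s)\<bar> \<le> \<bar>fst c\<bar> + r" "\<bar>snd (P s)\<bar> \<le> \<bar>snd c\<bar> + r"
      using P_in[OF s] unfolding square_def by auto
    have \<gamma>: "\<gamma> t = g j (P s)" unfolding \<gamma>_def s_def j_def ..
    have t: "t = of_int j + s" unfolding s_def by simp
    have "fst (\<gamma> t) - t * (hshift n m) = fst (P s) - s * (hshift n m)"
      unfolding \<gamma> g_def fst_act unfolding t by (simp add: algebra_simps)
    moreover have "snd (\<gamma> t) - t * (vshift n k)
        = (snd (iter (j * n) (P s)) - snd (P s) - of_int (j * n) * \<rho>) + snd (P s) - s * (vshift n k)"
      unfolding \<gamma> g_def act_def unfolding t by (simp add: algebra_simps)
    moreover have "\<bar>x - y\<bar> \<le> a + b" if "\<bar>x\<bar> \<le> a" "\<bar>y\<bar> \<le> b" for x y a b :: real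
      using that by linarith
    moreover have "\<bar>x + y - z\<bar> \<le> a + b + c" if "\<bar>x\<bar> \<le> a" "\<bar>y\<bar> \<le> b" "\<bar>z\<bar> \<le> c" for x y z a b c :: real
      using that by linarith
    ultimately have "\<bar>fst (\<gamma> t) - t * (hshift n m)\<bar> \<le> (\<bar>fst c\<bar> + r) + \<bar>hshift n m\<bar>"
      "\<bar>snd (\<gamma> t) - t * (vshift n k)\<bar> \<le> C + (\<bar>snd c\<bar> + r) + \<bar>vshift n k\<bar>"
      using P small deviation[of "j * n" "P s"] by presburger+
    moreover have "(\<bar>fst c\<bar> + r) + \<bar>hshift n m\<bar> \<le> B" "C + (\<bar>snd c\<bar> + r) + \<bar>vshift n k\<bar> \<le> B"
      unfolding B_def using C r by simp_all
    ultimately show ?thesis by (blast intro: order_trans)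
  qed
  show ?thesis using that[OF cont] close ex by blast
qed

lemma recurrent_imp_transitive:
  assumes r: "0 < r"
    and recurrent: "\<And>c s. 0 < s \<Longrightarrow> \<exists>n m k z. 1 \<le> n \<and> z \<in> square c s \<and> act n m k z \<in> square c s"
  shows "\<exists>n m k z. 1 \<le> n \<and> z \<in> square v r \<and> act n m k z \<in> square u r"
proof (rule ccontr)
  assume "\<not> ?thesis"
  then have NT: "act n m k z \<notin> square u r" if "1 \<le> n" "z \<in> square v r" for n m k z
    using that by blast
  \<comment> \<open>Removes the restriction to positive times. A small square around a meeting point
    returns to itself, and by \<open>irrational_separation\<close> a sufficiently small return takes
    longer than \<open>-n\<close> steps, so appending it makes the total time positive.\<close>
  have disjoint: "act n m k z \<notin> square u r" if z: "z \<in> square v r" for n m k z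
  proof
    assume meet: "act n m k z \<in> square u r"
    let ?O = "square v r \<inter> act n m k -` square u r"
    have "open ?O" using open_square open_vimage[OF open_square continuous_on_act] by blast
    then obtain s where s: "0 < s" "square z s \<subseteq> ?O" using square_subset_open[of ?O z] z meet by blast
    obtain \<delta> where \<delta>: "0 < \<delta>" "\<And>i m :: int. 1 \<le> i \<Longrightarrow> i \<le> int (nat (- n)) \<Longrightarrow> \<delta> \<le> \<bar>hshift i m\<bar>"
      using irrational_separation[OF irrational, of "nat (- n)"] by blast
    have "0 < min s (\<delta> / 2)" using s \<delta> by simp
    then obtain n' m' k' z' where z': "1 \<le> n'" "z' \<in> square z (min s (\<delta> / 2))" "act n' m' k' z' \<in> square z (min s (\<delta> / 2))"
      using recurrent by blast
    have "\<bar>hshift n' m'\<bar> < \<delta>"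
      using return_displacement[OF z'(2,3)] by simp
    then have "\<not> n' \<le> int (nat (- n))" using \<delta>(2)[of n' m'] z'(1) by linarith
    then have "1 \<le> n + n'" by linarith
    moreover have "z' \<in> square v r" "act n' m' k' z' \<in> ?O" using z'(2,3) s(2) by (auto simp: square_def)
    moreover have "act (n + n') (m + m') (k + k') z' = act n m k (act n' m' k' z')" by (simp add: act_act)
    ultimately show False using NT[of "n + n'" z' "m + m'" "k + k'"] by auto
  qed
  obtain n1 m1 k1 z1 where z1: "1 \<le> n1" "z1 \<in> square v r" "act n1 m1 k1 z1 \<in> square v r"
    using recurrent[OF r] by blast
  define \<alpha>1 where "\<alpha>1 = hshift n1 m1"
  have "\<alpha>1 \<noteq> 0" using irrational_int_eq_zero(1)[OF irrational, of n1 m1] z1(1) unfolding \<alpha>1_def by auto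
  \<comment> \<open>The second box is shrunk so that n1 * \<bar>\<alpha>2\<bar> <
    \<bar>\<alpha>1\<bar>. Parallel directions would give n1 * \<alpha>2 = n2 * \<alpha>1 with n2
    \<ge> 1, which is then impossible.\<close>
  define s where "s = min r (\<bar>\<alpha>1\<bar> / (2 * of_int n1))"
  have s: "0 < s" unfolding s_def using r z1(1) \<open>\<alpha>1 \<noteq> 0\<close> by simp
  obtain n2 m2 k2 z2 where z2: "1 \<le> n2" "z2 \<in> square u s" "act n2 m2 k2 z2 \<in> square u s"
    using recurrent[OF s] by blast
  define \<alpha>2 where "\<alpha>2 = hshift n2 m2"
  have "\<bar>\<alpha>2\<bar> < 2 * s" using return_displacement[OF z2(2,3)] unfolding \<alpha>2_def by simp
  also have "2 * s \<le> \<bar>\<alpha>1\<bar> / of_int n1" unfolding s_def by simp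
  finally have small: "of_int n1 * \<bar>\<alpha>2\<bar> < \<bar>\<alpha>1\<bar>" using z1(1) by (simp add: field_simps)
  have det: "\<alpha>1 * (vshift n2 k2) - \<alpha>2 * (vshift n1 k1) \<noteq> 0"
  proof
    assume "\<alpha>1 * (vshift n2 k2) - \<alpha>2 * (vshift n1 k1) = 0"
    then have "\<alpha>1 * (vshift n2 k2) = \<alpha>2 * (vshift n1 k1)" by linarith
    then have "n1 * m2 = n2 * m1" unfolding \<alpha>1_def \<alpha>2_def by (rule parallel_translations)
    then have "of_int n1 * of_int m2 = of_int n2 * (of_int m1 :: real)" by (metis of_int_mult)
    moreover have "of_int n1 * \<alpha>2 - of_int n2 * \<alpha>1 = of_int n1 * of_int m2 - of_int n2 * of_int m1"
      unfolding \<alpha>1_def \<alpha>2_def by (simp add: algebra_simps)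
    ultimately have "of_int n1 * \<alpha>2 = of_int n2 * \<alpha>1" by linarith
    then have "\<bar>of_int n1 * \<alpha>2\<bar> = \<bar>of_int n2 * \<alpha>1\<bar>" by (rule arg_cong)
    then have "of_int n1 * \<bar>\<alpha>2\<bar> = of_int n2 * \<bar>\<alpha>1\<bar>" using z1(1) z2(1) by (simp add: abs_mult)
    moreover have "\<bar>\<alpha>1\<bar> \<le> of_int n2 * \<bar>\<alpha>1\<bar>" using z2(1) by (intro mult_le_cancel_right1[THEN iffD2]) auto
    ultimately show False using small by simp
  qed
  obtain \<gamma>1 B1 where \<gamma>1: "continuous_on UNIV \<gamma>1"
    "\<And>t. \<bar>fst (\<gamma>1 t) - t * (hshift n1 m1)\<bar> \<le> B1" "\<And>t. \<bar>snd (\<gamma>1 t) - t * (vshift n1 k1)\<bar> \<le> B1"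
    "\<And>t. \<exists>j w. w \<in> square v r \<and> \<gamma>1 t = act (j * n1) (j * m1) (j * k1) w"
    using axis_curve[OF z1(2,3)] by metis
  obtain \<gamma>2 B2 where \<gamma>2: "continuous_on UNIV \<gamma>2"
    "\<And>t. \<bar>fst (\<gamma>2 t) - t * (hshift n2 m2)\<bar> \<le> B2" "\<And>t. \<bar>snd (\<gamma>2 t) - t * (vshift n2 k2)\<bar> \<le> B2"
    "\<And>t. \<exists>j w. w \<in> square u s \<and> \<gamma>2 t = act (j * n2) (j * m2) (j * k2) w"
    using axis_curve[OF z2(2,3)] by metis
  obtain a b where "\<gamma>1 a = \<gamma>2 b"
  proof (rule linear_curves_intersect[OF \<gamma>1(1) \<gamma>2(1), of \<alpha>1 "max B1 B2" _ \<alpha>2])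
    show "\<bar>fst (\<gamma>1 t) - t * \<alpha>1\<bar> \<le> max B1 B2" "\<bar>snd (\<gamma>1 t) - t * (vshift n1 k1)\<bar> \<le> max B1 B2"
      "\<bar>fst (\<gamma>2 t) - t * \<alpha>2\<bar> \<le> max B1 B2" "\<bar>snd (\<gamma>2 t) - t * (vshift n2 k2)\<bar> \<le> max B1 B2" for t
      using \<gamma>1(2,3)[of t] \<gamma>2(2,3)[of t] unfolding \<alpha>1_def \<alpha>2_def by linarith+
    show "\<alpha>1 * (vshift n2 k2) - \<alpha>2 * (vshift n1 k1) \<noteq> 0" by (rule det)
  qed
  moreover obtain i z where z: "z \<in> square v r" "\<gamma>1 a = act (i * n1) (i * m1) (i * k1) z" using \<gamma>1(4) by blast
  moreover obtain j w where w: "w \<in> square u s" "\<gamma>2 b = act (j * n2) (j * m2) (j * k2) w" using \<gamma>2(4) by blast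
  ultimately have "act (- (j * n2)) (- (j * m2)) (- (j * k2)) (act (i * n1) (i * m1) (i * k1) z) = w" by simp
  then have "act (- (j * n2) + i * n1) (- (j * m2) + i * m1) (- (j * k2) + i * k1) z = w" by (simp only: act_act)
  moreover have "w \<in> square u r" using w(1) unfolding s_def square_def by auto
  ultimately show False using disjoint[OF z(1)] by metis
qed

end

section \<open>Variation over intervals that are disjoint modulo 1\<close>

text \<open>The interval with the largest left end point is removed first; all others lie to its
  left, which is why \<open>r\<close> is generalised in the induction.\<close>

lemma sum_increments_le:
  fixes g :: "real \<Rightarrow> real"
  assumes g: "mono g" and A: "finite A"
    and ab: "\<And>i. i \<in> A \<Longrightarrow> a i \<le> b i"
    and disjoint: "\<And>i j. i \<in> A \<Longrightarrow> j \<in> A \<Longrightarrow> i \<noteq> j \<Longrightarrow> {a i..b i} \<inter> {a j..b j} = {}"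
    and inside: "\<And>i. i \<in> A \<Longrightarrow> p \<le> a i \<and> b i \<le> r" and "p \<le> r"
  shows "(\<Sum>i\<in>A. g (b i) - g (a i)) \<le> g r - g p"
  using A ab disjoint inside \<open>p \<le> r\<close>
proof (induction A arbitrary: r rule: finite_ranking_induct[where f = a])
  case empty
  then show ?case using g by (simp add: monoD)
next
  case (insert i S)
  show ?case
  proof (cases "i \<in> S")
    case True
    then show ?thesis using insert.IH[of r] insert.prems by (simp add: insert_absorb)
  next
    case False
    have before: "b j \<le> a i" if "j \<in> S" for j
    proof (rule ccontr)
      assume "\<not> ?thesis"
      then have "a i \<in> {a j..b j} \<inter> {a i..b i}" using insert.hyps(2)[OF that] insert.prems(1)[of i] by simp
      moreover have "i \<noteq> j" using False that by blast
      ultimately show False using insert.prems(2)[of j i] that by blast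
    qed
    have "(\<Sum>j\<in>S. g (b j) - g (a j)) \<le> g (a i) - g p"
    proof (rule insert.IH)
      show "p \<le> a j \<and> b j \<le> a i" if "j \<in> S" for j using before[OF that] insert.prems(3)[of j] that by simp
    qed (use insert.prems in auto)
    moreover have "g (b i) \<le> g r" using insert.prems(3)[of i] by (intro monoD[OF g]) simp
    ultimately show ?thesis using False insert.hyps(1) by simp
  qed
qed

text \<open>Every interval is translated so that it begins within the period starting at the left
  end of a fixed interval \<open>i0\<close>, which reduces the claim to intervals on the
  line.\<close>

lemma sum_increments_mod_1_le:
  fixes g :: "real \<Rightarrow> real"
  assumes g: "mono g" and g_shift: "\<And>t. g (t + 1) = g t + V" and A: "finite A"
    and ab: "\<And>i. i \<in> A \<Longrightarrow> a i \<le> b i"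
    and disjoint: "\<And>i j k. i \<in> A \<Longrightarrow> j \<in> A \<Longrightarrow> i \<noteq> j \<or> k \<noteq> 0 \<Longrightarrow> {a i..b i} \<inter> {a j + of_int k..b j + of_int k} = {}"
  shows "(\<Sum>i\<in>A. g (b i) - g (a i)) \<le> V"
proof (cases "A = {}")
  case True
  have "g 0 \<le> g (0 + 1)" by (intro monoD[OF g]) simp
  then show ?thesis using True g_shift[of 0] by simp
next
  case False
  then obtain i0 where i0: "i0 \<in> A" by blast
  note g_int = shift_of_int[of g, OF g_shift]
  define s where "s i = - \<lfloor>a i - a i0\<rfloor>" for i
  define a' where "a' i = a i + of_int (s i)" for i
  define b' where "b' i = b i + of_int (s i)" for i
  have a': "a i0 \<le> a' i" "a' i < a i0 + 1" for i unfolding a'_def s_def by (simp; linarith)+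
  have shift: "{a' i..b' i} \<inter> {a j + of_int k..b j + of_int k} = {}"
    if "i \<in> A" "j \<in> A" "i \<noteq> j \<or> k \<noteq> s i" for i j k
  proof (rule ccontr)
    assume "\<not> ?thesis"
    then obtain x where "x \<in> {a' i..b' i}" "x \<in> {a j + of_int k..b j + of_int k}" by blast
    then have "x - of_int (s i) \<in> {a i..b i}" "x - of_int (s i) \<in> {a j + of_int (k - s i)..b j + of_int (k - s i)}"
      unfolding a'_def b'_def by auto
    then show False using disjoint[of i j "k - s i"] that by auto
  qed
  have s0: "s i0 = 0" unfolding s_def by simp
  \<comment> \<open>An interval leaving the period would contain a i0 + 1, the left end of the next
    translate of interval \<open>i0\<close>.\<close>
  have b': "b' i \<le> a i0 + 1" if i: "i \<in> A" for i
  proof (rule ccontr)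
    assume "\<not> ?thesis"
    then have "a i0 + 1 \<in> {a' i..b' i}" using a'[of i] by simp
    moreover have "a i0 + 1 \<in> {a i0 + of_int 1..b i0 + of_int 1}" using ab[OF i0] by simp
    moreover have "i \<noteq> i0 \<or> 1 \<noteq> s i" using s0 by auto
    ultimately show False using shift[OF i i0, of 1] by blast
  qed
  have "(\<Sum>i\<in>A. g (b' i) - g (a' i)) \<le> g (a i0 + 1) - g (a i0)"
  proof (rule sum_increments_le[OF g A])
    show "a' i \<le> b' i" if "i \<in> A" for i using ab[OF that] unfolding a'_def b'_def by simp
    show "{a' i..b' i} \<inter> {a' j..b' j} = {}" if "i \<in> A" "j \<in> A" "i \<noteq> j" for i j
      using shift[of i j "s j"] that unfolding a'_def b'_def by blast
    show "a i0 \<le> a' i \<and> b' i \<le> a i0 + 1" if "i \<in> A" for i using a' b'[OF that] by blast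
  qed simp
  then show ?thesis unfolding a'_def b'_def g_int g_shift by simp
qed

lemma total_variation_extend:
  assumes "a \<le> x" "x \<le> y"
  shows "total_variation f a x + ennreal \<bar>f y - f x\<bar> \<le> total_variation f a y"
proof -
  let ?P = "\<lambda>x. {(n::nat, t::nat \<Rightarrow> real). t 0 = a \<and> t n = x \<and> (\<forall>i<n. t i \<le> t (Suc i))}"
  let ?S = "\<lambda>nt::nat \<times> (nat \<Rightarrow> real). ennreal (\<Sum>i<fst nt. \<bar>f (snd nt (Suc i)) - f (snd nt i)\<bar>)"
  have "(1, \<lambda>i. if i = 0 then a else x) \<in> ?P x" using assms(1) by simp
  then have ne: "?P x \<noteq> {}" by blast
  have "total_variation f a x + ennreal \<bar>f y - f x\<bar> = (SUP nt\<in>?P x. ?S nt + ennreal \<bar>f y - f x\<bar>)"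
    unfolding total_variation_def by (rule ennreal_SUP_add_left[symmetric, OF ne])
  also have "\<dots> \<le> total_variation f a y"
  proof (rule SUP_least)
    fix nt assume "nt \<in> ?P x"
    then obtain n t where nt: "nt = (n, t)" "t 0 = a" "t n = x" "\<And>i. i < n \<Longrightarrow> t i \<le> t (Suc i)" by blast
    define t' where "t' = t(Suc n := y)"
    have t': "t' i = t i" if "i \<le> n" for i using that unfolding t'_def by simp
    have mem: "(Suc n, t') \<in> ?P y"
      using nt assms(2) by (auto simp: t'_def less_Suc_eq)
    have "?S (Suc n, t') = ?S nt + ennreal \<bar>f y - f x\<bar>"
    proof -
      have "(\<Sum>i<n. \<bar>f (t' (Suc i)) - f (t' i)\<bar>) = (\<Sum>i<n. \<bar>f (t (Suc i)) - f (t i)\<bar>)"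
        by (intro sum.cong) (auto simp: t')
      then show ?thesis using nt by (simp add: t' t'_def ennreal_plus[symmetric] sum_nonneg del: ennreal_plus)
    qed
    then show "?S nt + ennreal \<bar>f y - f x\<bar> \<le> total_variation f a y"
      unfolding total_variation_def using SUP_upper[OF mem, of ?S] by (simp only:)
  qed
  finally show ?thesis .
qed

text \<open>The variation function \<open>G\<close> of one period extends to a monotone
  \<open>g\<close> that gains \<open>V\<close> over each period and whose increments dominate the
  oscillations of \<phi>.\<close>

lemma sum_oscillations_le_total_variation:
  fixes \<phi> :: "real \<Rightarrow> real"
  assumes periodic: "\<And>x. \<phi> (x + 1) = \<phi> x" and A: "finite A"
    and ab: "\<And>i. i \<in> A \<Longrightarrow> a i \<le> b i"
    and disjoint: "\<And>i j k. i \<in> A \<Longrightarrow> j \<in> A \<Longrightarrow> i \<noteq> j \<or> k \<noteq> 0 \<Longrightarrow> {a i..b i} \<inter> {a j + of_int k..b j + of_int k} = {}"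
  shows "ennreal (\<Sum>i\<in>A. \<bar>\<phi> (b i) - \<phi> (a i)\<bar>) \<le> total_variation \<phi> 0 1"
proof (cases "total_variation \<phi> 0 1 = \<infinity>")
  case True
  then show ?thesis by simp
next
  case False
  define G where "G t = enn2real (total_variation \<phi> 0 t)" for t
  define V where "V = G 1"
  have le1: "total_variation \<phi> 0 x \<le> total_variation \<phi> 0 1" if "0 \<le> x" "x \<le> 1" for x
    using total_variation_extend[of 0 x 1 \<phi>] that by (meson le_add_same_cancel1 order_trans zero_le add_increasing2 order_refl)
  have fin: "total_variation \<phi> 0 x = ennreal (G x)" if "0 \<le> x" "x \<le> 1" for x
    unfolding G_def using le1[OF that] False by (metis ennreal_enn2real infinity_ennreal_def le_less_trans less_top top.not_eq_extremum)
  have G0: "0 \<le> G x" for x unfolding G_def by simp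
  have step: "\<bar>\<phi> y - \<phi> x\<bar> \<le> G y - G x" if "0 \<le> x" "x \<le> y" "y \<le> 1" for x y
  proof -
    have "ennreal (G x) + ennreal \<bar>\<phi> y - \<phi> x\<bar> \<le> ennreal (G y)"
      using total_variation_extend[of 0 x y \<phi>] fin[of x] fin[of y] that by simp
    then have "ennreal (G x + \<bar>\<phi> y - \<phi> x\<bar>) \<le> ennreal (G y)" using G0 by (simp add: ennreal_plus)
    then show ?thesis using G0[of y] by (simp add: ennreal_le_iff)
  qed
  have V: "0 \<le> V" unfolding V_def by (rule G0)
  note periodic_int = periodic_of_int[of \<phi>, OF periodic]
  have \<phi>_frac: "\<phi> x = \<phi> (frac x)" for x
    using periodic_int[of "frac x" "\<lfloor>x\<rfloor>"] by (simp add: frac_def)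
  define g where "g t = of_int \<lfloor>t\<rfloor> * V + G (frac t)" for t
  have frac01: "0 \<le> frac x" "frac x \<le> 1" for x :: real using frac_lt_1[of x] by (simp_all add: less_imp_le)
  have osc: "\<bar>\<phi> y - \<phi> x\<bar> \<le> g y - g x" if "x \<le> y" for x y
  proof (cases "\<lfloor>x\<rfloor> = \<lfloor>y\<rfloor>")
    case True
    then have "frac x \<le> frac y" using that unfolding frac_def by simp
    then have "\<bar>\<phi> y - \<phi> x\<bar> \<le> G (frac y) - G (frac x)"
      unfolding \<phi>_frac[of x] \<phi>_frac[of y] using step frac01 by blast
    then show ?thesis unfolding g_def True by simp
  next
    \<comment> \<open>An integer lies between \<open>x\<close> and \<open>y\<close>: go up to the
      end of the period of \<open>x\<close>, use \<phi> 1 = \<phi> 0, and go on from the start of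
      the period of \<open>y\<close>.\<close>
    case False
    then have "\<lfloor>x\<rfloor> + 1 \<le> \<lfloor>y\<rfloor>" using floor_mono[OF that] by linarith
    then have "of_int (\<lfloor>x\<rfloor> + 1) * V \<le> of_int \<lfloor>y\<rfloor> * V" using V by (intro mult_right_mono) simp_all
    moreover have "\<bar>\<phi> (frac y) - \<phi> 0\<bar> \<le> G (frac y) - G 0" using step frac01 by blast
    moreover have "\<bar>\<phi> 1 - \<phi> (frac x)\<bar> \<le> V - G (frac x)" unfolding V_def using step frac01 by blast
    moreover have "\<phi> 1 = \<phi> 0" using periodic[of 0] by simp
    ultimately show ?thesis
      unfolding \<phi>_frac[of x] \<phi>_frac[of y] g_def using G0[of 0] by (simp add: algebra_simps)
  qed
  have mono: "mono g"
  proof (rule monoI)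
    fix x y :: real assume "x \<le> y"
    then show "g x \<le> g y" using osc[of x y] by linarith
  qed
  have "g (t + 1) = g t + V" for t
    unfolding g_def frac_1_eq by (simp add: algebra_simps)
  then have "(\<Sum>i\<in>A. g (b i) - g (a i)) \<le> V"
    by (rule sum_increments_mod_1_le[OF mono _ A ab disjoint])
  moreover have "(\<Sum>i\<in>A. \<bar>\<phi> (b i) - \<phi> (a i)\<bar>) \<le> (\<Sum>i\<in>A. g (b i) - g (a i))"
    by (intro sum_mono osc ab)
  ultimately have "ennreal (\<Sum>i\<in>A. \<bar>\<phi> (b i) - \<phi> (a i)\<bar>) \<le> ennreal V" by (intro ennreal_leI) linarith
  then show ?thesis using fin[of 1] unfolding V_def by simp
qed

lemma nn_integral_shift:
  fixes P :: "real \<Rightarrow> ennreal"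
  assumes [measurable]: "P \<in> borel_measurable borel"
  shows "(\<integral>\<^sup>+x\<in>{a..<b}. P (x + c) \<partial>lborel) = (\<integral>\<^sup>+x\<in>{a + c..<b + c}. P x \<partial>lborel)"
proof -
  have "(\<integral>\<^sup>+x. P x * indicator {a + c..<b + c} x \<partial>lborel)
      = (\<integral>\<^sup>+x. P (c + 1 * x) * indicator {a + c..<b + c} (c + 1 * x) \<partial>lborel)"
    using nn_integral_real_affine[of "\<lambda>x. P x * indicator {a + c..<b + c} x" 1 c] by simp
  also have "\<dots> = (\<integral>\<^sup>+x. P (x + c) * indicator {a..<b} x \<partial>lborel)"
    by (intro nn_integral_cong) (auto simp: indicator_def add.commute)
  finally show ?thesis by simp
qed

lemma nn_integral_periodic:
  fixes P :: "real \<Rightarrow> ennreal"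
  assumes meas [measurable]: "P \<in> borel_measurable borel" and periodic: "\<And>x. P (x + 1) = P x"
  shows "(\<integral>\<^sup>+x\<in>{a..<a + 1}. P x \<partial>lborel) = (\<integral>\<^sup>+x\<in>{0..<1}. P x \<partial>lborel)"
proof -
  note periodic_int = periodic_of_int[of P, OF periodic]
  define j :: real where "j = of_int (\<lfloor>a\<rfloor> + 1)"
  have j: "a \<le> j" "j \<le> a + 1" unfolding j_def by linarith+
  have split: "(\<integral>\<^sup>+x\<in>{u..<w}. P x \<partial>lborel) = (\<integral>\<^sup>+x\<in>{u..<v}. P x \<partial>lborel) + (\<integral>\<^sup>+x\<in>{v..<w}. P x \<partial>lborel)"
    if "u \<le> v" "v \<le> w" for u v w
  proof -
    have "P x * indicator {u..<w} x = P x * indicator {u..<v} x + P x * indicator {v..<w} x" for x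
      using that by (auto simp: indicator_def)
    then show ?thesis by (simp add: nn_integral_add)
  qed
  have "(\<integral>\<^sup>+x\<in>{a..<j}. P x \<partial>lborel) = (\<integral>\<^sup>+x\<in>{a + 1..<j + 1}. P x \<partial>lborel)"
    using nn_integral_shift[OF meas, of 1 a j] by (simp add: periodic)
  then have "(\<integral>\<^sup>+x\<in>{a..<a + 1}. P x \<partial>lborel) = (\<integral>\<^sup>+x\<in>{j..<j + 1}. P x \<partial>lborel)"
    using split[of a j "a + 1"] split[of j "a + 1" "j + 1"] j by (simp add: add.commute)
  also have "\<dots> = (\<integral>\<^sup>+x\<in>{0..<1}. P x \<partial>lborel)"
    using nn_integral_shift[OF meas, of j 0 1] unfolding j_def periodic_int by (simp add: add.commute)
  finally show ?thesis .
qed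

text \<open>Every integral is rewritten over a common parameter \<tau>, so that the sum can be
  estimated for each \<tau> separately. With c i = i * \<omega>, \<tau> is the fibre reached at time
  \<open>i\<close>, and \<open>bound\<close> becomes a statement about intervals on that one fibre.
  A window no longer than 1 contains at most one base point for each \<tau>.\<close>

lemma sum_nn_integral_fold_le:
  fixes w :: "'i \<Rightarrow> real \<Rightarrow> ennreal"
  assumes A: "finite A" and p: "p' \<le> p + 1" and meas: "\<And>i. i \<in> A \<Longrightarrow> w i \<in> borel_measurable borel"
    and bound: "\<And>\<theta> \<tau>. (\<And>i. i \<in> A \<Longrightarrow> \<exists>m::int. \<theta> i = \<tau> + of_int m - c i)
      \<Longrightarrow> (\<Sum>i\<in>{i \<in> A. p < \<theta> i \<and> \<theta> i < p'}. w i (\<theta> i)) \<le> W \<tau>"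
  shows "(\<Sum>i\<in>A. \<integral>\<^sup>+\<theta>\<in>{p<..<p'}. w i \<theta> \<partial>lborel) \<le> (\<integral>\<^sup>+\<theta>\<in>{0..1}. W \<theta> \<partial>lborel)"
proof -
  define v where "v i \<theta> = w i \<theta> * indicator {p<..<p'} \<theta>" for i \<theta>
  \<comment> \<open>The representative of \<tau> - c i modulo 1 in the period that starts at
    \<open>p\<close>.\<close>
  define \<theta> where "\<theta> \<tau> i = p + frac (\<tau> - c i - p)" for \<tau> i
  have v_meas [measurable]: "v i \<in> borel_measurable borel" if "i \<in> A" for i
    unfolding v_def using meas[OF that] by measurable
  have eq: "(\<integral>\<^sup>+\<theta>\<in>{p<..<p'}. w i \<theta> \<partial>lborel) = (\<integral>\<^sup>+\<tau>\<in>{0..<1}. v i (\<theta> \<tau> i) \<partial>lborel)" if i: "i \<in> A" for i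
  proof -
    define P where "P t = v i (p + frac (t - p))" for t
    have P_meas: "P \<in> borel_measurable borel"
      unfolding P_def frac_def using v_meas[OF i] by measurable
    have "frac (t + 1 - p) = frac (t - p)" for t
      using frac_1_eq[of "t - p"] by (simp add: algebra_simps)
    then have P_periodic: "P (t + 1) = P t" for t unfolding P_def by simp
    have "(\<integral>\<^sup>+\<theta>\<in>{p<..<p'}. w i \<theta> \<partial>lborel) = (\<integral>\<^sup>+t\<in>{p..<p + 1}. P t \<partial>lborel)"
    proof (intro nn_integral_cong)
      fix t :: real
      show "w i t * indicator {p<..<p'} t = P t * indicator {p..<p + 1} t"
      proof (cases "p \<le> t \<and> t < p + 1")
        case True
        then have "frac (t - p) = t - p" by (simp add: frac_eq)
        then have "P t = v i t" unfolding P_def by simp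
        then show ?thesis using True by (simp add: v_def)
      next
        case False
        then show ?thesis using p by (auto simp: indicator_def)
      qed
    qed
    also have "\<dots> = (\<integral>\<^sup>+t\<in>{0..<1}. P t \<partial>lborel)" by (rule nn_integral_periodic[OF P_meas P_periodic])
    also have "\<dots> = (\<integral>\<^sup>+t\<in>{- c i..<- c i + 1}. P t \<partial>lborel)" by (rule nn_integral_periodic[OF P_meas P_periodic, symmetric])
    also have "\<dots> = (\<integral>\<^sup>+t\<in>{0..<1}. P (t + - c i) \<partial>lborel)"
      using nn_integral_shift[OF P_meas, of "- c i" 0 1] by (simp add: algebra_simps)
    also have "\<dots> = (\<integral>\<^sup>+\<tau>\<in>{0..<1}. v i (\<theta> \<tau> i) \<partial>lborel)"
      unfolding P_def \<theta>_def by (simp add: algebra_simps)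
    finally show ?thesis .
  qed
  have "(\<Sum>i\<in>A. \<integral>\<^sup>+\<theta>\<in>{p<..<p'}. w i \<theta> \<partial>lborel) = (\<Sum>i\<in>A. \<integral>\<^sup>+\<tau>\<in>{0..<1}. v i (\<theta> \<tau> i) \<partial>lborel)"
    using eq by simp
  also have "\<dots> = (\<integral>\<^sup>+\<tau>. (\<Sum>i\<in>A. v i (\<theta> \<tau> i) * indicator {0..<1} \<tau>) \<partial>lborel)"
  proof (rule nn_integral_sum[symmetric])
    fix i assume "i \<in> A"
    from v_meas[OF this] show "(\<lambda>\<tau>. v i (\<theta> \<tau> i) * indicator {0..<1} \<tau>) \<in> borel_measurable lborel"
      unfolding \<theta>_def frac_def by measurable
  qed
  also have "\<dots> \<le> (\<integral>\<^sup>+\<theta>\<in>{0..1}. W \<theta> \<partial>lborel)"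
  proof (intro nn_integral_mono)
    fix \<tau> :: real
    have "(\<Sum>i\<in>A. v i (\<theta> \<tau> i)) = (\<Sum>i\<in>{i \<in> A. p < \<theta> \<tau> i \<and> \<theta> \<tau> i < p'}. w i (\<theta> \<tau> i))"
      unfolding v_def using A by (auto simp: sum.If_cases indicator_def Int_def if_distrib cong: if_cong intro!: sum.cong)
    also have "\<dots> \<le> W \<tau>"
    proof (rule bound)
      fix i
      have "\<theta> \<tau> i = \<tau> + of_int (- \<lfloor>\<tau> - c i - p\<rfloor>) - c i" unfolding \<theta>_def frac_def by simp
      then show "\<exists>m::int. \<theta> \<tau> i = \<tau> + of_int m - c i" by blast
    qed
    finally show "(\<Sum>i\<in>A. v i (\<theta> \<tau> i) * indicator {0..<1} \<tau>) \<le> W \<tau> * indicator {0..1} \<tau>"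
      by (auto simp: indicator_def)
  qed
  finally show ?thesis .
qed

section \<open>Wandering boxes\<close>

text \<open>Cauchy's functional equation on an interval. Subtracting the linear function through (b,
  A b) leaves an additive \<open>k\<close> that vanishes at the multiples of b / N. The remainder
  \<open>z\<close> is at most b / N, so N * z is still in range and A z is of order 1 / N.\<close>

lemma additive_bounded_linear:
  fixes A :: "real \<Rightarrow> real"
  assumes "0 < b" and additive: "\<And>x y. \<bar>x\<bar> \<le> b \<Longrightarrow> \<bar>y\<bar> \<le> b \<Longrightarrow> \<bar>x + y\<bar> \<le> b \<Longrightarrow> A (x + y) = A x + A y"
    and bounded: "\<And>x. \<bar>x\<bar> \<le> b \<Longrightarrow> \<bar>A x\<bar> \<le> M"
  shows "\<bar>x\<bar> \<le> b \<Longrightarrow> A x = A b / b * x"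
proof -
  define k where "k x = A x - A b / b * x" for x
  have k_add: "k (x + y) = k x + k y" if "\<bar>x\<bar> \<le> b" "\<bar>y\<bar> \<le> b" "\<bar>x + y\<bar> \<le> b" for x y
    unfolding k_def additive[OF that] distrib_left by simp
  have k_b: "k b = 0" unfolding k_def using \<open>0 < b\<close> by simp
  have k_mult: "k (real i * x) = real i * k x" if "0 \<le> x" "real i * x \<le> b" for i x
    using that(2)
  proof (induction i)
    case 0
    show ?case using k_add[of 0 0] \<open>0 < b\<close> by simp
  next
    case (Suc i)
    have pos: "0 \<le> real i * x" using that(1) by simp
    have le: "real i * x + x \<le> b" using Suc.prems by (simp add: algebra_simps)
    have "k (real i * x + x) = k (real i * x) + k x"
    proof (rule k_add)
      show "\<bar>real i * x\<bar> \<le> b" "\<bar>x\<bar> \<le> b" "\<bar>real i * x + x\<bar> \<le> b" using pos le that(1) by linarith+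
    qed
    moreover have "k (real i * x) = real i * k x" using le that(1) by (intro Suc.IH) linarith
    ultimately show ?case by (simp add: algebra_simps)
  qed
  have A_small: "\<bar>A x\<bar> \<le> M / real N" if "0 \<le> x" "real N * x \<le> b" "0 < N" for x N
  proof -
    have "real N * A x - A (real N * x) = real N * k x - k (real N * x)"
      unfolding k_def by (simp add: algebra_simps)
    then have "\<bar>real N * A x\<bar> \<le> M" using k_mult[of x N] bounded[of "real N * x"] that by simp
    then show ?thesis using that(3) by (simp add: abs_mult field_simps)
  qed
  have k0: "k x = 0" if x: "0 \<le> x" "x \<le> b" for x
  proof (rule ccontr)
    assume "k x \<noteq> 0"
    then obtain N :: nat where N: "M + \<bar>A b\<bar> < real N * \<bar>k x\<bar>" 
      using reals_Archimedean3[of "\<bar>k x\<bar>"] by auto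
    have "0 \<le> M" using bounded[of 0] \<open>0 < b\<close> by simp
    have "N > 0" using N \<open>0 \<le> M\<close> by (cases N) auto
    define y where "y = b / real N"
    have y: "0 < y" "real N * y = b" unfolding y_def using \<open>0 < b\<close> \<open>N > 0\<close> by simp_all
    define j where "j = nat \<lfloor>x / y\<rfloor>"
    have "real j = of_int \<lfloor>x / y\<rfloor>" unfolding j_def using x(1) y(1) by simp
    then have "real j \<le> x / y" "x / y < real j + 1" by linarith+
    then have j: "real j * y \<le> x" "x < real j * y + y" using y(1) by (simp_all add: field_simps)
    define z where "z = x - real j * y"
    have z: "0 \<le> z" "z \<le> y" "z \<le> b" unfolding z_def using j x y(1) by (auto intro: order_trans[OF _ x(2)])
    have "real N * k y = 0" using k_mult[of y N] y k_b by simp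
    then have "k y = 0" using \<open>N > 0\<close> by simp
    then have "k (real j * y) = 0" using k_mult[of y j] y j x by simp
    moreover have "k (real j * y + z) = k (real j * y) + k z"
      using j x z y(1) unfolding z_def by (intro k_add) auto
    ultimately have kz: "k x = k z" unfolding z_def by simp
    have Nz: "real N * z \<le> b" using z(2) y(2) \<open>N > 0\<close> mult_left_mono[of z y "real N"] by simp
    have "\<bar>A z\<bar> \<le> M / real N" using A_small[OF z(1) Nz \<open>N > 0\<close>] .
    moreover have "\<bar>A b / b * z\<bar> \<le> \<bar>A b\<bar> / real N"
    proof -
      have "\<bar>A b / b * z\<bar> = \<bar>A b\<bar> / b * z" using \<open>0 < b\<close> z(1) by (simp add: abs_mult abs_divide)
      also have "\<dots> \<le> \<bar>A b\<bar> / b * y" using z(2) \<open>0 < b\<close> by (intro mult_left_mono) auto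
      finally show ?thesis unfolding y_def using \<open>0 < b\<close> by simp
    qed
    ultimately have "\<bar>k z\<bar> \<le> M / real N + \<bar>A b\<bar> / real N" unfolding k_def by linarith
    then have "real N * \<bar>k x\<bar> \<le> M + \<bar>A b\<bar>" unfolding kz using \<open>N > 0\<close> by (simp add: field_simps)
    then show False using N by linarith
  qed
  show "A x = A b / b * x" if "\<bar>x\<bar> \<le> b"
  proof (cases "0 \<le> x")
    case True
    then show ?thesis using k0[of x] that unfolding k_def by simp
  next
    case False
    then have "k (- x) = 0" using k0[of "- x"] that by simp
    moreover have "k (x + - x) = k x + k (- x)" using that \<open>0 < b\<close> by (intro k_add) auto
    moreover have "k 0 = 0" using k_add[of 0 0] \<open>0 < b\<close> by simp
    ultimately show ?thesis unfolding k_def by simp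
  qed
qed

text \<open>If no small translate of the graph of \<open>h\<close> crosses the graph, then the increments of \<open>h\<close>
  do not depend on the base point.  Comparing with a point where \<open>h\<close> is almost maximal makes
  semicontinuity sufficient for this.\<close>

lemma rigid_function_affine:
  fixes h :: "real \<Rightarrow> real"
  assumes r: "0 < r"
    and lsc: "\<And>t a. a < h t \<Longrightarrow> \<exists>d>0. \<forall>s. \<bar>s - t\<bar> < d \<longrightarrow> a < h s"
    and bounded: "\<And>t. \<bar>h t\<bar> \<le> B"
    and rigid: "\<And>a b \<epsilon>. 0 < \<epsilon> \<Longrightarrow> \<exists>\<alpha> \<beta>. \<bar>\<alpha> - a\<bar> < \<epsilon> \<and> \<bar>\<beta> - b\<bar> < \<epsilon> \<and>
      (\<forall>t s. \<bar>t\<bar> < r \<and> \<bar>t - \<alpha>\<bar> < r \<and> \<bar>s\<bar> < r \<and> \<bar>s - \<alpha>\<bar> < r \<and> h (t - \<alpha>) + \<beta> < h t \<longrightarrow> h (s - \<alpha>) + \<beta> \<le> h s)"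
  obtains l where "\<And>t. \<bar>t\<bar> \<le> r / 2 \<Longrightarrow> h t = h 0 + l * t"
proof -
  have key: "h (s + \<delta>) - h s \<le> M - h t"
    if t: "\<bar>t\<bar> < r" "\<bar>t + \<delta>\<bar> < r" and s: "\<bar>s\<bar> < r" "\<bar>s + \<delta>\<bar> < r"
      and d: "0 < d" "\<And>u. \<bar>u - (t + \<delta>)\<bar> < d \<Longrightarrow> h u \<le> M" for t s \<delta> M d
  proof (rule ccontr)
    assume contra: "\<not> ?thesis"
    \<comment> \<open>A quarter of the assumed excess: two quarters go into the offset of \<beta>,
      one into the error in approximating it, and one into semicontinuity at s + \<delta>.\<close>
    define \<eta> where "\<eta> = (h (s + \<delta>) - h s - (M - h t)) / 4"
    have "4 * \<eta> = h (s + \<delta>) - h s - (M - h t)" unfolding \<eta>_def by simp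
    then have \<eta>: "0 < \<eta>" "h (s + \<delta>) - h s = M - h t + 4 * \<eta>" using contra by linarith+
    obtain d2 where d2: "0 < d2" "\<And>u. \<bar>u - (s + \<delta>)\<bar> < d2 \<Longrightarrow> h (s + \<delta>) - \<eta> < h u"
      using lsc[of "h (s + \<delta>) - \<eta>" "s + \<delta>"] \<eta>(1) by auto
    define \<epsilon> where "\<epsilon> = min (min d d2) (min \<eta> (min (r - \<bar>t + \<delta>\<bar>) (r - \<bar>s + \<delta>\<bar>)))"
    have "\<epsilon> \<le> min (min d d2) (min \<eta> (min (r - \<bar>t + \<delta>\<bar>) (r - \<bar>s + \<delta>\<bar>)))"
      unfolding \<epsilon>_def by (rule order_refl)
    moreover have "0 < \<epsilon>"
      unfolding \<epsilon>_def min_less_iff_conj using d(1) d2(1) \<eta>(1) t(2) s(2) by linarith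
    ultimately have \<epsilon>: "0 < \<epsilon>" "\<epsilon> \<le> d" "\<epsilon> \<le> d2" "\<epsilon> \<le> \<eta>" "\<epsilon> \<le> r - \<bar>t + \<delta>\<bar>" "\<epsilon> \<le> r - \<bar>s + \<delta>\<bar>"
      by (simp_all only: min.bounded_iff)
    obtain \<alpha> \<beta> where \<alpha>\<beta>: "\<bar>\<alpha> - (- \<delta>)\<bar> < \<epsilon>" "\<bar>\<beta> - (- (M - h t + 2 * \<eta>))\<bar> < \<epsilon>"
      and cross: "\<And>t s. \<bar>t\<bar> < r \<Longrightarrow> \<bar>t - \<alpha>\<bar> < r \<Longrightarrow> \<bar>s\<bar> < r \<Longrightarrow> \<bar>s - \<alpha>\<bar> < r \<Longrightarrow> h (t - \<alpha>) + \<beta> < h t \<Longrightarrow> h (s - \<alpha>) + \<beta> \<le> h s"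
      using rigid[OF \<epsilon>(1), of "- \<delta>" "- (M - h t + 2 * \<eta>)"] by blast
    have "h (t - \<alpha>) \<le> M" using d(2)[of "t - \<alpha>"] \<alpha>\<beta>(1) \<epsilon>(2) by linarith
    then have "h (t - \<alpha>) + \<beta> < h t" using \<alpha>\<beta>(2) \<epsilon>(4) \<eta>(1) by linarith
    then have "h (s - \<alpha>) + \<beta> \<le> h s"
    proof (rule cross[rotated 4])
      show "\<bar>t - \<alpha>\<bar> < r" using \<alpha>\<beta>(1) \<epsilon>(5) by linarith
      show "\<bar>s - \<alpha>\<bar> < r" using \<alpha>\<beta>(1) \<epsilon>(6) by linarith
    qed (rule t(1) s(1))+
    moreover have "h (s + \<delta>) - \<eta> < h (s - \<alpha>)" using d2(2)[of "s - \<alpha>"] \<alpha>\<beta>(1) \<epsilon>(3) by linarith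
    ultimately show False using \<alpha>\<beta>(2) \<epsilon>(4) \<eta> by linarith
  qed
  have upper: "\<exists>d>0. \<forall>s \<delta>. \<bar>s\<bar> < r \<longrightarrow> \<bar>s + \<delta>\<bar> < r \<longrightarrow> \<bar>\<delta>\<bar> < d \<longrightarrow> h (s + \<delta>) - h s \<le> \<epsilon>" if \<epsilon>: "0 < \<epsilon>" for \<epsilon>
  proof -
    let ?I = "{t. \<bar>t\<bar> < r / 2}"
    define S where "S = Sup (h ` ?I)"
    have bdd: "bdd_above (h ` ?I)" using bounded by (intro bdd_aboveI2[of _ _ B]) (auto simp: abs_le_iff)
    have "0 \<in> ?I" using r by simp
    then have "h ` ?I \<noteq> {}" by blast
    then obtain c where c: "\<bar>c\<bar> < r / 2" "S - \<epsilon> < h c"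
      using less_cSup_iff[of "h ` ?I" "S - \<epsilon>"] bdd \<epsilon> unfolding S_def by auto
    have S: "h u \<le> S" if "\<bar>u\<bar> < r / 2" for u
      unfolding S_def using bdd that by (intro cSup_upper) auto
    obtain d where d: "0 < d" "\<And>u. \<bar>u - c\<bar> < d \<Longrightarrow> S - \<epsilon> < h u" using lsc[OF c(2)] by blast
    have "h (s + \<delta>) - h s \<le> \<epsilon>" if s: "\<bar>s\<bar> < r" "\<bar>s + \<delta>\<bar> < r" "\<bar>\<delta>\<bar> < min d (r / 2)" for s \<delta>
    proof -
      have "h (s + \<delta>) - h s \<le> S - h (c - \<delta>)"
      proof (rule key)
        show "\<bar>c - \<delta>\<bar> < r" "\<bar>c - \<delta> + \<delta>\<bar> < r" using c s by auto
        show "0 < r / 2 - \<bar>c\<bar>" using c by simp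
        show "h u \<le> S" if "\<bar>u - (c - \<delta> + \<delta>)\<bar> < r / 2 - \<bar>c\<bar>" for u using that by (intro S) auto
      qed (use s in auto)
      moreover have "S - \<epsilon> < h (c - \<delta>)" using d(2)[of "c - \<delta>"] s by simp
      ultimately show ?thesis by linarith
    qed
    then show ?thesis using d(1) r by (intro exI[of _ "min d (r / 2)"]) auto
  qed
  \<comment> \<open>By \<open>upper\<close>, \<open>h\<close> is nearly bounded by h (t + \<delta>)
    close to t + \<delta>, so \<open>M\<close> in \<open>key\<close> can be taken arbitrarily close
    to this value. Exchanging \<open>s\<close> and \<open>t\<close> later gives equality of
    increments.\<close>
  have incr: "h (s + \<delta>) - h s \<le> h (t + \<delta>) - h t"
    if t: "\<bar>t\<bar> < r" "\<bar>t + \<delta>\<bar> < r" and s: "\<bar>s\<bar> < r" "\<bar>s + \<delta>\<bar> < r" for t s \<delta>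
  proof (rule field_le_epsilon)
    fix \<epsilon> :: real assume "0 < \<epsilon>"
    then obtain d where d: "0 < d" "\<And>s \<delta>. \<bar>s\<bar> < r \<Longrightarrow> \<bar>s + \<delta>\<bar> < r \<Longrightarrow> \<bar>\<delta>\<bar> < d \<Longrightarrow> h (s + \<delta>) - h s \<le> \<epsilon>"
      using upper by meson
    have "h (s + \<delta>) - h s \<le> (h (t + \<delta>) + \<epsilon>) - h t"
    proof (rule key[OF t s])
      show "0 < min d (r - \<bar>t + \<delta>\<bar>)" using d(1) t by simp
      fix u assume u: "\<bar>u - (t + \<delta>)\<bar> < min d (r - \<bar>t + \<delta>\<bar>)"
      then have "\<bar>t + \<delta> + (u - (t + \<delta>))\<bar> < r" by auto
      then show "h u \<le> h (t + \<delta>) + \<epsilon>" using d(2)[of "t + \<delta>" "u - (t + \<delta>)"] t u by simp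
    qed
    then show "h (s + \<delta>) - h s \<le> h (t + \<delta>) - h t + \<epsilon>" by simp
  qed
  define A where "A x = h x - h 0" for x
  have "A x = A (r / 2) / (r / 2) * x" if "\<bar>x\<bar> \<le> r / 2" for x
  proof (rule additive_bounded_linear[OF _ _ _ that])
    show "0 < r / 2" using r by simp
    show "A (x + y) = A x + A y" if "\<bar>x\<bar> \<le> r / 2" "\<bar>y\<bar> \<le> r / 2" "\<bar>x + y\<bar> \<le> r / 2" for x y
      using incr[of x y 0] incr[of 0 y x] that r unfolding A_def by auto
    show "\<bar>A x\<bar> \<le> 2 * B" for x using bounded[of x] bounded[of 0] unfolding A_def by linarith
  qed
  then show ?thesis using that[of "A (r / 2) / (r / 2)"] unfolding A_def by (metis add.commute diff_eq_eq)
qed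

section \<open>Rigidity of the conjugation on a wandering box\<close>

context independent_qpf
begin

lemma translations_dense:
  assumes "0 < \<epsilon>"
  obtains n m k :: int where "\<bar>hshift n m - a\<bar> < \<epsilon>" "\<bar>vshift n k - b\<bar> < \<epsilon>"
proof -
  \<comment> \<open>The independence in Kronecker's theorem is that of the reals as a module over
    the integers.\<close>
  interpret Modules.module "(\<lambda>r. (*) (real_of_int r))"
    by (simp add: Modules.module.intro distrib_left mult.commute)
  define \<theta> :: "nat \<Rightarrow> real" where "\<theta> i = (if i = 0 then \<omega> else if i = 1 then \<rho> else 1)" for i
  have ne: "\<omega> \<noteq> \<rho>" "\<omega> \<noteq> 1" "\<rho> \<noteq> 1"
    using independent[of 1 "-1" 0] independent[of 0 1 "-1"] independent[of 1 0 "-1"] by auto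
  have atMost2: "{..2::nat} = {0, 1, 2}" by auto
  have image: "\<theta> ` {..2} = {\<omega>, \<rho>, 1}" unfolding atMost2 \<theta>_def by auto
  have "independent {\<omega>, \<rho>, 1}"
  proof
    assume "dependent {\<omega>, \<rho>, 1}"
    then obtain u :: "real \<Rightarrow> int" where u: "\<exists>v\<in>{\<omega>, \<rho>, 1}. u v \<noteq> 0" "(\<Sum>v\<in>{\<omega>, \<rho>, 1}. of_int (u v) * v) = 0"
      using dependent_finite[of "{\<omega>, \<rho>, 1}"] by auto
    have "of_int (u \<rho>) * \<rho> + of_int (u \<omega>) * \<omega> + of_int (u 1) = 0"
      using u(2) ne by (simp add: algebra_simps)
    then show False using independent u(1) by blast
  qed
  then have indep: "independent (\<theta> ` {..2})" unfolding image .
  have inj: "inj_on \<theta> {..2}" unfolding atMost2 \<theta>_def using ne by (auto simp: inj_on_def)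
  have \<theta>2: "\<theta> 2 = 1" unfolding \<theta>_def by simp
  show ?thesis
  proof (rule Kronecker_thm_2[OF indep inj \<theta>2 assms, where \<alpha> = "\<lambda>i. if i = 0 then a else b"])
    fix n m assume nm: "\<And>i. i < 2 \<Longrightarrow> \<bar>of_int n * \<theta> i - of_int (m i) - (if i = 0 then a else b)\<bar> < \<epsilon>"
    show ?thesis using that[of n "- m 0" "- m 1"] nm[of 0] nm[of 1] unfolding \<theta>_def by simp
  qed
qed

end

text \<open>A half-side of at most 1 / 2 keeps the box disjoint from its integer translates, so that
  it is disjoint from its image under every nontrivial group element.\<close>

locale wandering_qpf = independent_qpf +
  fixes c :: "real \<times> real" and r :: real
  assumes r: "0 < r" "r \<le> 1 / 2"
    and wandering: "1 \<le> n \<Longrightarrow> z \<in> square c r \<Longrightarrow> act n m k z \<notin> square c r"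
begin

lemma no_return:
  assumes z: "z \<in> square c r" "act n m k z \<in> square c r"
  shows "n = 0" "m = 0" "k = 0"
proof -
  have "\<not> 1 \<le> n" using wandering z by blast
  moreover have "\<not> 1 \<le> - n" using wandering[of "- n" "act n m k z" "- m" "- k"] z by auto
  ultimately show n: "n = 0" by simp
  have "\<bar>real_of_int m\<bar> < 1" using return_displacement[OF z] r n by simp
  then show "m = 0" by linarith
  have "snd (act n m k z) = snd z + of_int k" using n by (simp add: act_def)
  then have "\<bar>real_of_int k\<bar> < 1" using z r unfolding square_def by auto
  then show "k = 0" by linarith
qed

text \<open>A translate of the horizontal axis of the box starts below the axis at \<open>t\<close>,
  because \<open>H\<close> is monotone on fibres. Were it not below at \<open>s\<close>, it would
  meet the axis in between, and the box would meet its own translate.\<close>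

lemma H_crossing:
  assumes t: "\<bar>t - fst c\<bar> < r" "\<bar>t - \<alpha> - fst c\<bar> < r" and s: "\<bar>s - fst c\<bar> < r" "\<bar>s - \<alpha> - fst c\<bar> < r"
    and \<alpha>: "\<alpha> = hshift n m"
    and below: "H (t - \<alpha>, snd c) + (vshift n k) < H (t, snd c)"
  shows "H (s - \<alpha>, snd c) + (vshift n k) \<le> H (s, snd c)"
proof -
  define Y where "Y u = snd (act n m k (u - \<alpha>, snd c))" for u
  have act_Y: "act n m k (u - \<alpha>, snd c) = (u, Y u)" for u
    unfolding Y_def by (simp add: prod_eq_iff fst_act \<alpha>)
  have H_Y: "H (u, Y u) = H (u - \<alpha>, snd c) + (vshift n k)" for u
    unfolding act_Y[symmetric] H_act ..
  have Yt: "Y t < snd c"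
  proof (rule ccontr)
    assume "\<not> ?thesis"
    then have "H (t, snd c) \<le> H (t, Y t)" by (intro H_mono) auto
    then show False using below H_Y by simp
  qed
  have Ys: "Y s < snd c"
  proof (rule ccontr)
    assume "\<not> ?thesis"
    moreover have "continuous_on (closed_segment t s) Y"
      unfolding Y_def
      by (intro continuous_on_snd continuous_on_compose2[OF continuous_on_act[of UNIV]] continuous_intros) auto
    ultimately obtain u where u: "u \<in> closed_segment t s" "Y u = snd c"
      using IVT_closed_segment[of t s Y "snd c"] Yt by auto
    then have "min t s \<le> u" "u \<le> max t s" by (auto simp: closed_segment_eq_real_ivl split: if_splits)
    then have "\<bar>u - fst c\<bar> < r" "\<bar>u - \<alpha> - fst c\<bar> < r" using t s by (auto simp: min_def max_def split: if_splits)
    then have "(u - \<alpha>, snd c) \<in> square c r" "act n m k (u - \<alpha>, snd c) \<in> square c r"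
      unfolding act_Y using u(2) r by (simp_all add: square_def)
    then have "n = 0" "m = 0" "k = 0" using no_return by blast+
    then show False using below \<alpha> by simp
  qed
  then have "H (s, Y s) \<le> H (s, snd c)" by (intro H_mono) auto
  then show ?thesis using H_Y by simp
qed

lemma H_affine_on_axis:
  obtains l where "\<And>\<theta>. \<bar>\<theta> - fst c\<bar> \<le> r / 2 \<Longrightarrow> H (\<theta>, snd c) = H c + l * (\<theta> - fst c)"
proof -
  define h where "h t = H (fst c + t, snd c)" for t
  have "\<exists>l. \<forall>t. \<bar>t\<bar> \<le> r / 2 \<longrightarrow> h t = h 0 + l * t"
  proof (rule rigid_function_affine[OF r(1), of h "\<bar>snd c\<bar> + C"])
    fix a t assume a: "a < h t"
    have "open {z. a < H z + 0 * fst z}" by (rule open_H_greater)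
    moreover have "(fst c + t, snd c) \<in> {z. a < H z + 0 * fst z}" using a unfolding h_def by simp
    ultimately obtain d where d: "0 < d" "square (fst c + t, snd c) d \<subseteq> {z. a < H z + 0 * fst z}"
      using square_subset_open by blast
    have "a < h s" if "\<bar>s - t\<bar> < d" for s
    proof -
      have "(fst c + s, snd c) \<in> square (fst c + t, snd c) d" using that d(1) by (simp add: square_def)
      then show ?thesis using d(2) unfolding h_def by auto
    qed
    then show "\<exists>d>0. \<forall>s. \<bar>s - t\<bar> < d \<longrightarrow> a < h s" using d(1) by blast
  next
    show "\<bar>h t\<bar> \<le> \<bar>snd c\<bar> + C" for t using H_close[of "(fst c + t, snd c)"] unfolding h_def by simp
  next
    fix a b \<epsilon> :: real assume "0 < \<epsilon>"
    then obtain n m k :: int where nmk: "\<bar>hshift n m - a\<bar> < \<epsilon>" "\<bar>vshift n k - b\<bar> < \<epsilon>"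
      using translations_dense by blast
    define \<alpha> where "\<alpha> = hshift n m"
    define \<beta> where "\<beta> = vshift n k"
    have "h (s - \<alpha>) + \<beta> \<le> h s" if "\<bar>t\<bar> < r" "\<bar>t - \<alpha>\<bar> < r" "\<bar>s\<bar> < r" "\<bar>s - \<alpha>\<bar> < r" "h (t - \<alpha>) + \<beta> < h t" for t s
      using H_crossing[of "fst c + t" \<alpha> "fst c + s" n m k] that unfolding h_def \<beta>_def by (simp add: \<alpha>_def add_diff_eq)
    then show "\<exists>\<alpha> \<beta>. \<bar>\<alpha> - a\<bar> < \<epsilon> \<and> \<bar>\<beta> - b\<bar> < \<epsilon> \<and>
      (\<forall>t s. \<bar>t\<bar> < r \<and> \<bar>t - \<alpha>\<bar> < r \<and> \<bar>s\<bar> < r \<and> \<bar>s - \<alpha>\<bar> < r \<and> h (t - \<alpha>) + \<beta> < h t \<longrightarrow> h (s - \<alpha>) + \<beta> \<le> h s)"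
      using nmk unfolding \<alpha>_def \<beta>_def by blast
  qed (blast)
  then obtain l where l: "\<And>t. \<bar>t\<bar> \<le> r / 2 \<Longrightarrow> h t = h 0 + l * t" by blast
  have "H (\<theta>, snd c) = H c + l * (\<theta> - fst c)" if "\<bar>\<theta> - fst c\<bar> \<le> r / 2" for \<theta>
    using l[OF that] unfolding h_def by simp
  then show ?thesis using that by blast
qed

text \<open>It remains to see that \<open>H\<close> is constant on the vertical segments of the box.
  There are translates of the axis with \<open>H\<close> slightly larger or smaller than on the
  axis; by \<open>no_return\<close> they pass outside the box, so the whole segment lies between
  them and monotonicity squeezes \<open>H\<close>.\<close>

lemma H_affine:
  obtains l where "\<And>z. z \<in> square c (r / 2) \<Longrightarrow> H z = H c + l * (fst z - fst c)"
proof -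
  obtain l where l: "\<And>\<theta>. \<bar>\<theta> - fst c\<bar> \<le> r / 2 \<Longrightarrow> H (\<theta>, snd c) = H c + l * (\<theta> - fst c)"
    using H_affine_on_axis by blast
  have "H z = H (fst z, snd c)" if z: "z \<in> square c (r / 2)" for z
  proof -
    have zc: "\<bar>fst z - fst c\<bar> < r / 2" "\<bar>snd z - snd c\<bar> < r / 2" using z by (auto simp: square_def)
    have far: "\<exists>y. \<bar>H (fst z, y) - (H (fst z, snd c) + b)\<bar> < \<bar>b\<bar> \<and> r \<le> \<bar>y - snd c\<bar>" if b: "b \<noteq> 0" for b
    proof -
      \<comment> \<open>The value of \<open>H\<close> on the translate misses its target by less
        than (1 + \<bar>l\<bar>) * \<epsilon>, which is at most \<bar>b\<bar>; this fixes the sign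
        of the difference to the axis.\<close>
      define \<epsilon> where "\<epsilon> = min (r / 2 - \<bar>fst z - fst c\<bar>) (\<bar>b\<bar> / (1 + \<bar>l\<bar>))"
      have \<epsilon>: "0 < \<epsilon>" "\<epsilon> \<le> r / 2 - \<bar>fst z - fst c\<bar>" "\<epsilon> \<le> \<bar>b\<bar> / (1 + \<bar>l\<bar>)"
        unfolding \<epsilon>_def using zc b by auto
      obtain n m k :: int where nmk: "\<bar>hshift n m - 0\<bar> < \<epsilon>" "\<bar>vshift n k - b\<bar> < \<epsilon>"
        using translations_dense[OF \<epsilon>(1)] by blast
      define \<alpha> where "\<alpha> = hshift n m"
      define \<beta> where "\<beta> = vshift n k"
      define y where "y = snd (act n m k (fst z - \<alpha>, snd c))"
      have act_y: "act n m k (fst z - \<alpha>, snd c) = (fst z, y)"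
        unfolding y_def by (simp add: prod_eq_iff fst_act \<alpha>_def)
      have \<alpha>\<beta>: "\<bar>\<alpha>\<bar> < \<epsilon>" "\<bar>\<beta> - b\<bar> < \<epsilon>" using nmk unfolding \<alpha>_def \<beta>_def by simp_all
      have "H (fst z, y) = H (fst z - \<alpha>, snd c) + \<beta>" unfolding act_y[symmetric] H_act \<beta>_def ..
      also have "H (fst z - \<alpha>, snd c) = H (fst z, snd c) - l * \<alpha>"
      proof -
        have "\<bar>fst z - \<alpha> - fst c\<bar> \<le> r / 2" using \<alpha>\<beta>(1) \<epsilon>(2) by linarith
        then show ?thesis using l[of "fst z - \<alpha>"] l[of "fst z"] zc(1) by (simp add: right_diff_distrib)
      qed
      finally have "\<bar>H (fst z, y) - (H (fst z, snd c) + b)\<bar> \<le> \<bar>\<beta> - b\<bar> + \<bar>l * \<alpha>\<bar>" by linarith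
      also have "\<bar>l * \<alpha>\<bar> \<le> \<bar>l\<bar> * \<epsilon>" using \<alpha>\<beta>(1) by (simp add: abs_mult mult_left_mono)
      also have "\<bar>\<beta> - b\<bar> + \<bar>l\<bar> * \<epsilon> < (1 + \<bar>l\<bar>) * \<epsilon>" using \<alpha>\<beta>(2) by (simp add: distrib_right)
      also have "(1 + \<bar>l\<bar>) * \<epsilon> \<le> (1 + \<bar>l\<bar>) * (\<bar>b\<bar> / (1 + \<bar>l\<bar>))"
        using \<epsilon>(3) by (rule mult_left_mono) simp
      also have "\<dots> = \<bar>b\<bar>"
      proof -
        have "1 + \<bar>l\<bar> \<noteq> 0" by linarith
        then show ?thesis by simp
      qed
      finally have H_y: "\<bar>H (fst z, y) - (H (fst z, snd c) + b)\<bar> < \<bar>b\<bar>" by simp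
      have "r \<le> \<bar>y - snd c\<bar>"
      proof (rule ccontr)
        assume "\<not> ?thesis"
        then have "act n m k (fst z - \<alpha>, snd c) \<in> square c r"
          unfolding act_y using zc(1) r by (simp add: square_def)
        moreover have "(fst z - \<alpha>, snd c) \<in> square c r"
          using \<alpha>\<beta>(1) \<epsilon>(2) r by (simp add: square_def)
        ultimately have nmk0: "n = 0" "m = 0" "k = 0" using no_return by blast+
        then have "y = snd c" "\<alpha> = 0" unfolding y_def \<alpha>_def by simp_all
        then show False using H_y by simp
      qed
      with H_y show ?thesis by blast
    qed
    have "H z \<le> H (fst z, snd c) + b" if b: "0 < b" for b
    proof -
      obtain y where y: "\<bar>H (fst z, y) - (H (fst z, snd c) + b / 2)\<bar> < \<bar>b / 2\<bar>" "r \<le> \<bar>y - snd c\<bar>"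
        using far[of "b / 2"] b by force
      have "snd c < y"
      proof (rule ccontr)
        assume "\<not> ?thesis"
        then have "H (fst z, y) \<le> H (fst z, snd c)" by (intro H_mono) auto
        then show False using y(1) b by linarith
      qed
      then have "snd z \<le> y" using y(2) zc(2) r(1) by linarith
      then have "H z \<le> H (fst z, y)" by (intro H_mono) auto
      then show ?thesis using y(1) b by linarith
    qed
    then have "H z \<le> H (fst z, snd c)" by (rule field_le_epsilon)
    moreover have "H (fst z, snd c) \<le> H z + b" if b: "0 < b" for b
    proof -
      obtain y where y: "\<bar>H (fst z, y) - (H (fst z, snd c) + - (b / 2))\<bar> < \<bar>- (b / 2)\<bar>" "r \<le> \<bar>y - snd c\<bar>"
        using far[of "- (b / 2)"] b by force
      have "y < snd c"
      proof (rule ccontr)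
        assume "\<not> ?thesis"
        then have "H (fst z, snd c) \<le> H (fst z, y)" by (intro H_mono) auto
        then show False using y(1) b by linarith
      qed
      then have "y \<le> snd z" using y(2) zc(2) r(1) by linarith
      then have "H (fst z, y) \<le> H z" by (intro H_mono) auto
      then show ?thesis using y(1) b by linarith
    qed
    then have "H (fst z, snd c) \<le> H z" by (rule field_le_epsilon)
    ultimately show ?thesis by simp
  qed
  moreover have "H (fst z, snd c) = H c + l * (fst z - fst c)" if "z \<in> square c (r / 2)" for z
    using l[of "fst z"] that by (simp add: square_def)
  ultimately show ?thesis using that by metis
qed

section \<open>Heights of translates and closest returns\<close>

definition slope :: real where
  "slope = (SOME l. \<forall>z\<in>square c (r / 2). H z = H c + l * (fst z - fst c))"

lemma H_slope:
  assumes "z \<in> square c (r / 2)"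
  shows "H z = H c + slope * (fst z - fst c)"
proof -
  obtain l where "\<And>z. z \<in> square c (r / 2) \<Longrightarrow> H z = H c + l * (fst z - fst c)"
    using H_affine by blast
  then have "\<exists>l. \<forall>z\<in>square c (r / 2). H z = H c + l * (fst z - fst c)" by blast
  from someI_ex[OF this] show ?thesis
    using assms unfolding slope_def[symmetric] by blast
qed

text \<open>The amount by which \<open>H\<close> on the translate of the box exceeds the affine
  continuation of \<open>H\<close> from the box itself.\<close>

definition height :: "int \<Rightarrow> int \<Rightarrow> int \<Rightarrow> real" where
  "height n m k = of_int n * \<rho> + of_int k - slope * (hshift n m)"

text \<open>Two elements of height 0 are parallel, so if one with shift \<alpha>0 and time n0
  exists, every other one has a shift of at least \<bar>\<alpha>0\<bar> / n0. The bound 8 * e \<le>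
  r leaves room for horizontal displacements up to 3 * e inside the half-size box on which
  \<open>H\<close> is affine.\<close>

lemma height_nonzero:
  obtains e where "0 < e" "8 * e \<le> r"
    "\<And>n m k. 1 \<le> n \<Longrightarrow> \<bar>hshift n m\<bar> < 2 * e \<Longrightarrow> height n m k \<noteq> 0"
proof (cases "\<exists>n m k. 1 \<le> n \<and> height n m k = 0")
  case False
  then show ?thesis using that[of "r / 8"] r by auto
next
  case True
  then obtain n0 m0 k0 where 0: "1 \<le> n0" "height n0 m0 k0 = 0" by blast
  define \<alpha>0 where "\<alpha>0 = hshift n0 m0"
  have \<alpha>0: "\<alpha>0 \<noteq> 0" using irrational_int_eq_zero(1)[OF irrational, of n0 m0] 0(1) unfolding \<alpha>0_def by auto
  define e where "e = min (r / 8) (\<bar>\<alpha>0\<bar> / (2 * of_int n0))"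
  have "height n m k \<noteq> 0" if n: "1 \<le> n" and small: "\<bar>hshift n m\<bar> < 2 * e" for n m k
  proof
    assume zero: "height n m k = 0"
    define \<alpha> where "\<alpha> = hshift n m"
    have \<beta>: "of_int n * \<rho> + of_int k = slope * \<alpha>" "of_int n0 * \<rho> + of_int k0 = slope * \<alpha>0"
      using zero 0(2) unfolding height_def \<alpha>_def \<alpha>0_def by simp_all
    have "\<alpha> * (vshift n0 k0) = \<alpha>0 * (vshift n k)" unfolding \<beta> by simp
    then have "n * m0 = n0 * m" unfolding \<alpha>_def \<alpha>0_def by (rule parallel_translations)
    then have "of_int n * of_int m0 = of_int n0 * (of_int m :: real)" by (metis of_int_mult)
    moreover have "of_int n * \<alpha>0 - of_int n0 * \<alpha> = of_int n * of_int m0 - of_int n0 * of_int m"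
      unfolding \<alpha>_def \<alpha>0_def by (simp add: algebra_simps)
    ultimately have "of_int n * \<alpha>0 = of_int n0 * \<alpha>" by linarith
    then have "\<bar>of_int n * \<alpha>0\<bar> = \<bar>of_int n0 * \<alpha>\<bar>" by (rule arg_cong)
    then have "of_int n * \<bar>\<alpha>0\<bar> = of_int n0 * \<bar>\<alpha>\<bar>" using n 0(1) by (simp add: abs_mult)
    moreover have "\<bar>\<alpha>0\<bar> \<le> of_int n * \<bar>\<alpha>0\<bar>" using n by (intro mult_le_cancel_right1[THEN iffD2]) auto
    ultimately have "\<bar>\<alpha>0\<bar> \<le> of_int n0 * \<bar>\<alpha>\<bar>" by simp
    moreover have "\<bar>\<alpha>\<bar> < \<bar>\<alpha>0\<bar> / of_int n0" using small unfolding e_def \<alpha>_def by simp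
    then have "of_int n0 * \<bar>\<alpha>\<bar> < \<bar>\<alpha>0\<bar>" using 0(1) by (simp add: field_simps)
    ultimately show False by linarith
  qed
  moreover have "0 < e" "8 * e \<le> r" unfolding e_def using r \<alpha>0 0(1) by auto
  ultimately show ?thesis using that by blast
qed

lemma height_separation:
  assumes nz: "\<And>n m k. 1 \<le> n \<Longrightarrow> \<bar>hshift n m\<bar> < a \<Longrightarrow> height n m k \<noteq> 0"
  obtains \<tau> where "0 < \<tau>" "\<tau> \<le> 1"
    "\<And>n m k. 1 \<le> n \<Longrightarrow> n \<le> N \<Longrightarrow> \<bar>hshift n m\<bar> < a \<Longrightarrow> \<tau> \<le> \<bar>height n m k\<bar>"
proof -
  define S where "S = {(n, m, k). 1 \<le> n \<and> n \<le> N \<and> \<bar>hshift n m\<bar> < a \<and> \<bar>height n m k\<bar> < 1}"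
  define M1 where "M1 = \<lceil>of_int N * \<bar>\<omega>\<bar> + a\<rceil>"
  define M2 where "M2 = \<lceil>1 + of_int N * \<bar>\<rho>\<bar> + \<bar>slope\<bar> * a\<rceil>"
  have "S \<subseteq> {1..N} \<times> {-M1..M1} \<times> {-M2..M2}"
  proof
    fix x assume "x \<in> S"
    then obtain n m k where x: "x = (n, m, k)" "1 \<le> n" "n \<le> N" "\<bar>hshift n m\<bar> < a" "\<bar>height n m k\<bar> < 1"
      unfolding S_def by blast
    have mul: "\<bar>of_int n * y\<bar> \<le> of_int N * \<bar>y\<bar>" for y :: real
      using x(2,3) by (simp add: abs_mult mult_right_mono)
    have "\<bar>real_of_int m\<bar> \<le> of_int N * \<bar>\<omega>\<bar> + a" using x(4) mul[of \<omega>] by linarith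
    then have m: "\<bar>m\<bar> \<le> M1" unfolding M1_def by linarith
    have "\<bar>slope * (hshift n m)\<bar> \<le> \<bar>slope\<bar> * a"
      unfolding abs_mult using x(4) by (intro mult_left_mono) auto
    then have "\<bar>real_of_int k\<bar> \<le> 1 + of_int N * \<bar>\<rho>\<bar> + \<bar>slope\<bar> * a"
      using x(5) mul[of \<rho>] unfolding height_def by linarith
    then have "\<bar>k\<bar> \<le> M2" unfolding M2_def by linarith
    with m show "x \<in> {1..N} \<times> {-M1..M1} \<times> {-M2..M2}" using x by auto
  qed
  then have fin: "finite S" by (rule finite_subset) auto
  \<comment> \<open>The 1 handles triples outside \<open>S\<close>, whose height is at least 1, and
    keeps the minimum meaningful when \<open>S\<close> is empty.\<close>
  define T where "T = insert 1 ((\<lambda>(n, m, k). \<bar>height n m k\<bar>) ` S)"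
  have T: "finite T" "T \<noteq> {}" unfolding T_def using fin by auto
  have pos: "0 < t" if "t \<in> T" for t using that nz unfolding T_def S_def by auto
  have "Min T \<le> \<bar>height n m k\<bar>" if "1 \<le> n" "n \<le> N" "\<bar>hshift n m\<bar> < a" for n m k
  proof (cases "\<bar>height n m k\<bar> < 1")
    case True
    then have "(n, m, k) \<in> S" unfolding S_def using that by simp
    then have "\<bar>height n m k\<bar> \<in> T" unfolding T_def by force
    then show ?thesis using T(1) by simp
  next
    case False
    have "Min T \<le> 1" using T(1) unfolding T_def by simp
    then show ?thesis using False by linarith
  qed
  moreover have "0 < Min T" using T pos Min_in by blast
  moreover have "Min T \<le> 1" using T(1) unfolding T_def by simp
  ultimately show ?thesis using that by blast
qed

text \<open>The competitors are all earlier positive times with a small horizontal shift. Height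
  below 1 prevents the region between the box and its preimage from meeting its own vertical
  translates.\<close>

definition closest :: "real \<Rightarrow> int \<Rightarrow> int \<Rightarrow> int \<Rightarrow> bool" where
  "closest a n m k \<longleftrightarrow> 1 \<le> n \<and> \<bar>hshift n m\<bar> < a \<and> \<bar>height n m k\<bar> < 1 \<and>
    (\<forall>n' m' k'. 1 \<le> n' \<longrightarrow> n' < n \<longrightarrow> \<bar>hshift n' m'\<bar> < a \<longrightarrow> \<bar>height n m k\<bar> < \<bar>height n' m' k'\<bar>)"

text \<open>With \<tau> below all heights up to time \<open>N\<close>, the first time at which a
  height smaller than \<tau> occurs is later than \<open>N\<close>, and all earlier heights are at
  least \<tau>.\<close>

lemma closest_return:
  assumes a: "0 < a" "a \<le> 1"
    and nz: "\<And>n m k. 1 \<le> n \<Longrightarrow> \<bar>hshift n m\<bar> < a \<Longrightarrow> height n m k \<noteq> 0"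
  obtains n m k where "N < n" "closest a n m k"
proof -
  obtain \<tau> where \<tau>: "0 < \<tau>" "\<tau> \<le> 1"
    "\<And>n m k. 1 \<le> n \<Longrightarrow> n \<le> N \<Longrightarrow> \<bar>hshift n m\<bar> < a \<Longrightarrow> \<tau> \<le> \<bar>height n m k\<bar>"
    using height_separation[OF nz] by blast
  define P where "P i \<longleftrightarrow> 1 \<le> i \<and> (\<exists>m k. \<bar>hshift (int i) m\<bar> < a \<and> \<bar>height (int i) m k\<bar> < \<tau>)" for i
  have "\<exists>i. P i"
  proof -
    \<comment> \<open>Aiming at horizontal shift 0 and vertical shift \<tau> / 2 with this precision
      gives a height strictly between 0 and \<tau>. A negative time is then replaced by the inverse
      element.\<close>
    define \<epsilon> where "\<epsilon> = min a (\<tau> / 2 / (1 + \<bar>slope\<bar>))"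
    have pos: "0 < 1 + \<bar>slope\<bar>" by linarith
    have \<epsilon>: "0 < \<epsilon>" "\<epsilon> \<le> a" "\<epsilon> \<le> \<tau> / 2 / (1 + \<bar>slope\<bar>)" unfolding \<epsilon>_def using a(1) \<tau>(1) pos by auto
    have \<epsilon>3: "(1 + \<bar>slope\<bar>) * \<epsilon> \<le> \<tau> / 2" 
      using \<epsilon>(3) pos_le_divide_eq[OF pos, of \<epsilon> "\<tau> / 2"] mult.commute[of \<epsilon>] by metis
    obtain n m k :: int where nmk: "\<bar>hshift n m - 0\<bar> < \<epsilon>" "\<bar>vshift n k - \<tau> / 2\<bar> < \<epsilon>"
      using translations_dense[OF \<epsilon>(1)] by blast
    have small: "\<bar>hshift n m\<bar> < a" using nmk(1) \<epsilon>(2) by simp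
    have "\<bar>slope * (hshift n m)\<bar> \<le> \<bar>slope\<bar> * \<epsilon>"
      unfolding abs_mult using nmk(1) by (intro mult_left_mono) auto
    then have "\<bar>height n m k - \<tau> / 2\<bar> < \<tau> / 2"
      using nmk(2) \<epsilon>3 unfolding height_def distrib_right by linarith
    then have height: "0 < height n m k" "height n m k < \<tau>" by (auto simp: abs_if split: if_splits)
    consider "1 \<le> n" | "1 \<le> - n" | "n = 0" by linarith
    then show ?thesis
    proof cases
      case 1
      then have "P (nat n)" 
        unfolding P_def using small height by (intro conjI exI[of _ m] exI[of _ k]) auto
      then show ?thesis by blast
    next
      case 2
      have neg: "height (- n) (- m) (- k) = - height n m k" unfolding height_def by (simp add: algebra_simps)
      have "\<bar>hshift (- n) (- m)\<bar> < a" using small by (simp add: abs_if split: if_splits)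
      then have "P (nat (- n))"
        unfolding P_def using 2 height neg by (intro conjI exI[of _ "- m"] exI[of _ "- k"]) auto
      then show ?thesis by blast
    next
      \<comment> \<open>At time 0 the horizontal shift is an integer below 1, so it is 0, and the
        height would be an integer strictly between 0 and 1.\<close>
      case 3
      then have "\<bar>real_of_int m\<bar> < 1" using small a(2) by simp
      then have "m = 0" by linarith
      then have "0 < real_of_int k" "real_of_int k < 1" using 3 height \<tau>(2) unfolding height_def by simp_all
      then have "0 < k" "k < 1" by simp_all
      then show ?thesis by simp
    qed
  qed
  then have P: "P (LEAST i. P i)" by (rule LeastI_ex)
  define i where "i = (LEAST i. P i)"
  obtain m k where mk: "1 \<le> i" "\<bar>hshift (int i) m\<bar> < a" "\<bar>height (int i) m k\<bar> < \<tau>"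
    using P unfolding P_def i_def by blast
  have "N < int i"
  proof (rule ccontr)
    assume "\<not> ?thesis"
    then show False using \<tau>(3)[of "int i" m k] mk by simp
  qed
  moreover have "\<bar>height (int i) m k\<bar> < \<bar>height n' m' k'\<bar>" if n': "1 \<le> n'" "n' < int i" "\<bar>hshift n' m'\<bar> < a" for n' m' k'
  proof -
    have "\<not> P (nat n')" using n'(1,2) not_less_Least[of "nat n'" P] unfolding i_def by simp
    then have "\<not> \<bar>height n' m' k'\<bar> < \<tau>" using n' unfolding P_def by auto
    then show ?thesis using mk(3) by linarith
  qed
  ultimately show ?thesis using that[of "int i" m k] mk \<tau>(2) unfolding closest_def by simp
qed

end

section \<open>Distortion\<close>

context qpf
begin

lemma iter_between:
  assumes "snd (iter n (\<theta>, a)) \<le> y" "y \<le> snd (iter n (\<theta>, b))"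
  obtains x where "a \<le> x" "x \<le> b" "iter n (\<theta>, x) = (\<theta> + of_int n * \<omega>, y)"
proof -
  define z where "z = iter (- n) (\<theta> + of_int n * \<omega>, y)"
  have z: "iter n z = (\<theta> + of_int n * \<omega>, y)" unfolding z_def by simp
  have fst_z: "fst z = \<theta>" unfolding z_def fst_iter by simp
  have "\<not> snd z < a" using iter_strict_mono[of z "(\<theta>, a)" n] assms(1) fst_z z by auto
  then have "a \<le> snd z" by simp
  moreover have "\<not> b < snd z" using iter_strict_mono[of "(\<theta>, b)" z n] assms(2) fst_z z by auto
  then have "snd z \<le> b" by simp
  moreover have "z = (\<theta>, snd z)" using fst_z by (metis prod.collapse)
  ultimately show ?thesis using that[of "snd z"] z by simp
qed

end

locale smooth_wandering_qpf = wandering_qpf +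
  fixes DF :: "real \<Rightarrow> real \<Rightarrow> real"
  assumes DF_continuous: "continuous_on UNIV (\<lambda>z. DF (fst z) (snd z))"
    and DF_deriv: "(F \<theta> has_real_derivative DF \<theta> x) (at x)"
    and DF_pos: "0 < DF \<theta> x"
begin

definition \<phi> :: "real \<times> real \<Rightarrow> real" where
  "\<phi> z = ln (DF (fst z) (snd z))"

lemma continuous_on_phi: "continuous_on S \<phi>"
proof -
  have "continuous_on UNIV \<phi>"
    unfolding \<phi>_def using DF_pos by (intro continuous_on_ln DF_continuous) (metis less_irrefl)
  then show ?thesis using continuous_on_subset by blast
qed

lemma DF_periodic: "DF (\<theta> + of_int m) x = DF \<theta> x"
proof -
  have "F (\<theta> + of_int m) = F \<theta>" using F_periodic_int by blast
  then show ?thesis using DF_deriv DERIV_unique by metis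
qed

lemma DF_periodic_snd: "DF \<theta> (x + 1) = DF \<theta> x"
proof -
  have "((\<lambda>x. F \<theta> (x + 1)) has_real_derivative DF \<theta> (x + 1)) (at x)"
    using DF_deriv[of \<theta> "x + 1"] by (simp add: DERIV_shift)
  moreover have "((\<lambda>x. F \<theta> x + 1) has_real_derivative DF \<theta> x) (at x)"
    using DERIV_add[OF DF_deriv[of \<theta> x] DERIV_const[of 1]] by simp
  ultimately show ?thesis unfolding F_degree_one using DERIV_unique by blast
qed

definition log_deriv :: "nat \<Rightarrow> real \<times> real \<Rightarrow> real" where
  "log_deriv n z = (\<Sum>i<n. \<phi> (iter (int i) z))"

lemma continuous_on_phi_iter: "continuous_on S (\<lambda>z. \<phi> (iter n z))"
  using continuous_on_compose[OF continuous_on_iter continuous_on_phi] by (simp add: o_def)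

lemma continuous_on_log_deriv: "continuous_on S (log_deriv n)"
  unfolding log_deriv_def by (intro continuous_on_sum continuous_on_phi_iter)

lemma iter_has_derivative:
  "((\<lambda>x. snd (iter (int n) (\<theta>, x))) has_real_derivative exp (log_deriv n (\<theta>, x))) (at x)"
proof (induction n)
  case 0
  show ?case by (simp add: log_deriv_def)
next
  case (Suc n)
  have iter_Suc: "snd (iter (int (Suc n)) (\<theta>, x)) = F (\<theta> + of_int (int n) * \<omega>) (snd (iter (int n) (\<theta>, x)))" for x
    using zpow_add_1[OF bij_L, of "int n" "(\<theta>, x)"] by (simp add: add.commute L_simps fst_iter)
  have "exp (log_deriv (Suc n) (\<theta>, x)) = DF (\<theta> + of_int (int n) * \<omega>) (snd (iter (int n) (\<theta>, x))) * exp (log_deriv n (\<theta>, x))"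
    unfolding log_deriv_def using DF_pos by (simp add: exp_add \<phi>_def fst_iter)
  then show ?case
    unfolding iter_Suc using DERIV_chain2[OF DF_deriv Suc] by simp
qed

text \<open>Distortion compares points on one fibre. The point pulled back is therefore the one at
  height \<open>x\<close> over the shifted base point, so that its preimage lies on the same fibre
  as (\<theta>, x).\<close>

definition preimage :: "int \<Rightarrow> int \<Rightarrow> int \<Rightarrow> real \<Rightarrow> real \<Rightarrow> real \<times> real" where
  "preimage n m k \<theta> x = act (- n) (- m) (- k) (\<theta> + (hshift n m), x)"

lemma fst_preimage [simp]: "fst (preimage n m k \<theta> x) = \<theta>"
  unfolding preimage_def fst_act by simp

lemma snd_preimage: "snd (preimage n m k \<theta> x) = snd (iter (- n) (\<theta> + (hshift n m), x)) - of_int k"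
  unfolding preimage_def act_def by simp

lemma continuous_on_preimage: "continuous_on S (\<lambda>z. preimage n m k (fst z) (snd z))"
  unfolding preimage_def
  by (intro continuous_on_compose2[OF continuous_on_act[of UNIV]] continuous_intros) auto

definition defect :: "nat \<Rightarrow> int \<Rightarrow> int \<Rightarrow> nat \<Rightarrow> real \<Rightarrow> real \<Rightarrow> real" where
  "defect n m k i \<theta> x = \<bar>\<phi> (iter (int i) (\<theta>, x)) - \<phi> (iter (int i) (preimage (int n) m k \<theta> x))\<bar>"

lemma defect_nonneg [simp]: "0 \<le> defect n m k i \<theta> x"
  by (simp add: defect_def)

lemma continuous_on_defect: "continuous_on UNIV (\<lambda>z. defect n m k i (fst z) (snd z))"
proof -
  have "continuous_on UNIV (\<lambda>z. \<phi> (iter (int i) (preimage (int n) m k (fst z) (snd z))))"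
    by (rule continuous_on_compose2[OF continuous_on_phi_iter[of UNIV] continuous_on_preimage]) auto
  then show ?thesis
    unfolding defect_def using continuous_on_phi_iter by (intro continuous_on_rabs continuous_on_diff) simp_all
qed

lemma preimage_has_derivative:
  "((\<lambda>x. snd (preimage (int n) m k \<theta> x)) has_real_derivative exp (- log_deriv n (preimage (int n) m k \<theta> x))) (at x)"
proof -
  define g where "g x = snd (preimage (int n) m k \<theta> x)" for x
  define f where "f y = snd (iter (int n) (\<theta>, y)) + of_int k" for y
  have pre: "preimage (int n) m k \<theta> x = (\<theta>, g x)" for x unfolding g_def by (simp add: prod_eq_iff)
  have "(f has_real_derivative exp (log_deriv n (\<theta>, g x))) (at (g x))"
    unfolding f_def using DERIV_add[OF iter_has_derivative DERIV_const[of "of_int k"]] by simp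
  moreover have "f (g y) = y" for y
  proof -
    have "act (int n) m k (\<theta>, g y) = (\<theta> + (hshift (int n) m), y)"
      unfolding pre[symmetric] preimage_def by simp
    then show ?thesis unfolding f_def act_def by (simp add: prod_eq_iff)
  qed
  moreover have "isCont g x"
  proof -
    have "continuous_on UNIV g"
      unfolding g_def preimage_def
      by (intro continuous_on_snd continuous_on_compose2[OF continuous_on_act[of UNIV]] continuous_intros) auto
    then show ?thesis by (simp add: continuous_on_eq_continuous_at)
  qed
  ultimately have "(g has_real_derivative inverse (exp (log_deriv n (\<theta>, g x)))) (at x)"
    by (intro DERIV_inverse_function[where f = f and a = "x - 1" and b = "x + 1"]) auto
  then show ?thesis unfolding pre g_def[symmetric] by (simp add: exp_minus)
qed

section \<open>Areas of the images of the box\<close>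

definition image_length :: "real \<Rightarrow> int \<Rightarrow> real \<Rightarrow> real" where
  "image_length e n \<theta> = snd (iter n (\<theta>, snd c + e)) - snd (iter n (\<theta>, snd c - e))"

text \<open>Lebesgue measure of the \<open>n\<close>-th image of a box, since the base rotation
  preserves length. The half-width 3 * e is the half-width \<open>e\<close> of the averaging window
  plus the largest horizontal shift 2 * e of a return.\<close>

definition image_area :: "real \<Rightarrow> int \<Rightarrow> ennreal" where
  "image_area e n = (\<integral>\<^sup>+\<theta>\<in>{fst c - 3 * e<..<fst c + 3 * e}. ennreal (image_length e n \<theta>) \<partial>lborel)"

lemma continuous_on_image_length: "continuous_on S (image_length e n)"
  unfolding image_length_def
  by (intro continuous_on_diff continuous_on_snd continuous_on_compose2[OF continuous_on_iter[of UNIV]] continuous_intros) auto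

lemma borel_measurable_image_length [measurable]: "image_length e n \<in> borel_measurable borel"
  by (intro borel_measurable_continuous_onI continuous_on_image_length)

text \<open>Moving the summand at time \<open>n\<close> to the fibre \<theta> + n * \<omega> turns
  the total area into an integral of lengths on a common fibre. By \<open>no_return\<close> these
  intervals are disjoint modulo 1.\<close>

lemma sum_image_area_le_1:
  assumes e: "0 < e" "8 * e \<le> r" and A: "finite A"
  shows "(\<Sum>n\<in>A. image_area e n) \<le> 1"
proof -
  have "(\<Sum>n\<in>A. image_area e n) \<le> (\<integral>\<^sup>+\<theta>\<in>{0..1}. 1 \<partial>(lborel :: real measure))"
    unfolding image_area_def
  proof (rule sum_nn_integral_fold_le[OF A, where c = "\<lambda>n. of_int n * \<omega>"])
    show "fst c + 3 * e \<le> fst c - 3 * e + 1" using e r by simp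
    show "(\<lambda>\<theta>. ennreal (image_length e n \<theta>)) \<in> borel_measurable borel" for n by measurable
    fix \<theta> :: "int \<Rightarrow> real" and \<tau>
    assume "\<And>i. i \<in> A \<Longrightarrow> \<exists>m::int. \<theta> i = \<tau> + of_int m - of_int i * \<omega>"
    then obtain M :: "int \<Rightarrow> int" where M: "\<And>i. i \<in> A \<Longrightarrow> \<theta> i = \<tau> + of_int (M i) - of_int i * \<omega>" by metis
    define A' where "A' = {i \<in> A. fst c - 3 * e < \<theta> i \<and> \<theta> i < fst c + 3 * e}"
    define a where "a i = snd (iter i (\<theta> i, snd c - e))" for i
    define b where "b i = snd (iter i (\<theta> i, snd c + e))" for i
    have ab: "a i \<le> b i" for i unfolding a_def b_def using e by (intro iter_mono) auto
    have "(\<Sum>i\<in>A'. b i - a i) \<le> 1"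
    proof (rule sum_increments_mod_1_le[where g = "\<lambda>t. t" and V = 1])
      show "finite A'" unfolding A'_def using A by simp
      fix i j k :: int assume ij: "i \<in> A'" "j \<in> A'" "i \<noteq> j \<or> k \<noteq> 0"
      have A: "i \<in> A" "j \<in> A" using ij unfolding A'_def by auto
      show "{a i..b i} \<inter> {a j + of_int k..b j + of_int k} = {}"
      proof (rule ccontr)
        assume "\<not> ?thesis"
        then obtain y where "y \<in> {a i..b i}" "y \<in> {a j + of_int k..b j + of_int k}" by blast
        then have y: "a i \<le> y" "y \<le> b i" "a j \<le> y - of_int k" "y - of_int k \<le> b j" by simp_all
        obtain x where x: "snd c - e \<le> x" "x \<le> snd c + e" "iter i (\<theta> i, x) = (\<theta> i + of_int i * \<omega>, y)"
          using iter_between y(1,2) unfolding a_def b_def by blast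
        obtain x' where x': "snd c - e \<le> x'" "x' \<le> snd c + e" "iter j (\<theta> j, x') = (\<theta> j + of_int j * \<omega>, y - of_int k)"
          using iter_between y(3,4) unfolding a_def b_def by blast
        have "act i 0 0 (\<theta> i, x) = act j (M i - M j) k (\<theta> j, x')"
          unfolding act_def x(3) x'(3) by (simp add: M[OF A(1)] M[OF A(2)])
        then have "act (- i) 0 0 (act i 0 0 (\<theta> i, x)) = act (- i) 0 0 (act j (M i - M j) k (\<theta> j, x'))" by simp
        then have eq: "(\<theta> i, x) = act (j - i) (M i - M j) k (\<theta> j, x')" by (simp add: act_act)
        have "(\<theta> j, x') \<in> square c r" "(\<theta> i, x) \<in> square c r"
          using ij x x' e unfolding A'_def square_def by (auto simp: abs_less_iff)
        then have "j - i = 0" "k = 0" using no_return eq by metis+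
        then show False using ij(3) by simp
      qed
    qed (auto simp: mono_def ab)
    then show "(\<Sum>i\<in>A'. ennreal (image_length e i (\<theta> i))) \<le> 1"
      using ab unfolding image_length_def a_def[symmetric] b_def[symmetric]
      by (subst sum_ennreal) (auto simp: ennreal_le_1)
  qed
  then show ?thesis by simp
qed

lemma borel_measurable_defect [measurable]: "(\<lambda>\<theta>. defect n m k i \<theta> x) \<in> borel_measurable borel"
proof -
  have "continuous_on UNIV (\<lambda>\<theta>. defect n m k i (fst (\<theta>, x)) (snd (\<theta>, x)))"
    by (rule continuous_on_compose2[OF continuous_on_defect]) (auto intro!: continuous_intros)
  then show ?thesis by (intro borel_measurable_continuous_onI) simp
qed

text \<open>Denjoy's disjointness argument on one fibre \<tau>. The \<open>i\<close>-th interval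
  joins the images of (\<theta>, x) and of its companion \<open>preimage\<close>; at its ends
  \<open>H\<close> equals \<open>P i\<close> and \<open>P i - T\<close>. An overlap of the intervals
  for \<open>i\<close> and \<open>j\<close>, up to an integer \<open>l\<close>, forces \<bar>P i - P
  j - l\<bar> \<le> \<bar>T\<bar>. For distinct \<open>i\<close> and \<open>j\<close> this number
  is, up to sign, a height at time \<bar>i - j\<bar> < n, contradicting \<open>closest\<close>; for
  i = j it gives l = 0.\<close>

lemma distortion_integral_le:
  assumes e: "0 < e" "8 * e \<le> r" and return: "closest (2 * e) (int n) m k"
    and x: "\<bar>x - snd c\<bar> \<le> e"
  shows "(\<Sum>i<n. \<integral>\<^sup>+\<theta>\<in>{fst c - e<..<fst c + e}. ennreal (defect n m k i \<theta> x) \<partial>lborel)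
    \<le> (\<integral>\<^sup>+\<theta>\<in>{0..1}. total_variation (\<lambda>x. ln (DF \<theta> x)) 0 1 \<partial>lborel)"
proof (rule sum_nn_integral_fold_le[where c = "\<lambda>i. of_int (int i) * \<omega>"])
  have small: "\<bar>hshift (int n) m\<bar> < 2 * e" "\<bar>height (int n) m k\<bar> < 1"
    and closest: "\<And>n' m' k'. 1 \<le> n' \<Longrightarrow> n' < int n \<Longrightarrow> \<bar>hshift n' m'\<bar> < 2 * e \<Longrightarrow> \<bar>height (int n) m k\<bar> < \<bar>height n' m' k'\<bar>"
    using return unfolding closest_def by blast+
  show "fst c + e \<le> fst c - e + 1" using e r by simp
  show "(\<lambda>\<theta>. ennreal (defect n m k i \<theta> x)) \<in> borel_measurable borel" for i
    by (rule measurable_compose[OF borel_measurable_defect measurable_ennreal])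
  fix \<theta> :: "nat \<Rightarrow> real" and \<tau>
  assume "\<And>i. i \<in> {..<n} \<Longrightarrow> \<exists>m::int. \<theta> i = \<tau> + of_int m - of_int (int i) * \<omega>"
  then obtain M :: "nat \<Rightarrow> int" where M: "\<And>i. i < n \<Longrightarrow> \<theta> i = \<tau> + of_int (M i) - of_int (int i) * \<omega>"
    by (metis lessThan_iff)
  define A where "A = {i \<in> {..<n}. fst c - e < \<theta> i \<and> \<theta> i < fst c + e}"
  define \<psi> where "\<psi> y = ln (DF \<tau> y)" for y
  define T where "T = height (int n) m k"
  define X where "X i = snd (iter (int i) (\<theta> i, x))" for i
  define Y where "Y i = snd (iter (int i) (preimage (int n) m k (\<theta> i) x))" for i
  define P where "P i = H c + slope * (\<theta> i - fst c) + of_int (int i) * \<rho>" for i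
  have iter_X: "iter (int i) (\<theta> i, x) = (\<tau> + of_int (M i), X i)" if "i < n" for i
    unfolding X_def by (simp add: prod_eq_iff fst_iter M[OF that])
  have iter_Y: "iter (int i) (preimage (int n) m k (\<theta> i) x) = (\<tau> + of_int (M i), Y i)" if "i < n" for i
    unfolding Y_def by (simp add: prod_eq_iff fst_iter M[OF that])
  have \<phi>_eq: "\<phi> (\<tau> + of_int (M i), y) = \<psi> y" for i y
    unfolding \<phi>_def \<psi>_def by (simp add: DF_periodic)
  have H_iter: "H (iter j z) = H z + of_int j * \<rho>" for j z
    using H_act[of j 0 0 z] by (simp add: act_def zero_prod_def[symmetric])
  have H_X: "H (\<tau> + of_int (M i), X i) = P i" if i: "i \<in> A" for i
  proof -
    have "\<bar>\<theta> i - fst c\<bar> < e" using i unfolding A_def abs_less_iff by simp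
    then have "(\<theta> i, x) \<in> square c (r / 2)" using x e by (simp add: square_def)
    then have "H (\<theta> i, x) = H c + slope * (\<theta> i - fst c)" using H_slope by fastforce
    then show ?thesis using iter_X[of i] H_iter[of "int i" "(\<theta> i, x)"] i unfolding A_def P_def by simp
  qed
  have H_Y: "H (\<tau> + of_int (M i), Y i) = P i - T" if i: "i \<in> A" for i
  proof -
    let ?\<alpha> = "of_int (int n) * \<omega> + of_int m"
    have "\<bar>\<theta> i - fst c\<bar> < e" using i unfolding A_def abs_less_iff by simp
    then have "\<bar>\<theta> i + ?\<alpha> - fst c\<bar> < r / 2" using small(1) e by linarith
    then have "(\<theta> i + ?\<alpha>, x) \<in> square c (r / 2)" using x e by (simp add: square_def)
    then have "H (\<theta> i + ?\<alpha>, x) = H c + slope * (\<theta> i + ?\<alpha> - fst c)" using H_slope by fastforce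
    then have "H (preimage (int n) m k (\<theta> i) x) = H c + slope * (\<theta> i - fst c) - T"
      unfolding preimage_def H_act T_def height_def by (simp add: algebra_simps)
    then show ?thesis
      using iter_Y[of i] H_iter[of "int i" "preimage (int n) m k (\<theta> i) x"] i unfolding A_def P_def by simp
  qed
  have "ennreal (\<Sum>i\<in>A. \<bar>\<psi> (max (X i) (Y i)) - \<psi> (min (X i) (Y i))\<bar>) \<le> total_variation \<psi> 0 1"
  proof (rule sum_oscillations_le_total_variation)
    show "\<psi> (x + 1) = \<psi> x" for x unfolding \<psi>_def DF_periodic_snd ..
    show "finite A" unfolding A_def by simp
    fix i j :: nat and l :: int assume ij: "i \<in> A" "j \<in> A" "i \<noteq> j \<or> l \<noteq> 0"
    have n: "i < n" "j < n" using ij unfolding A_def by auto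
    show "{min (X i) (Y i)..max (X i) (Y i)} \<inter> {min (X j) (Y j) + of_int l..max (X j) (Y j) + of_int l} = {}"
    proof (rule ccontr)
      assume "\<not> ?thesis"
      then obtain y where "y \<in> {min (X i) (Y i)..max (X i) (Y i)}"
        "y \<in> {min (X j) (Y j) + of_int l..max (X j) (Y j) + of_int l}" by blast
      then have y: "min (X i) (Y i) \<le> y" "y \<le> max (X i) (Y i)"
        "min (X j) (Y j) \<le> y - of_int l" "y - of_int l \<le> max (X j) (Y j)"
        unfolding atLeastAtMost_iff by linarith+
      have between: "min (P i) (P i - T) \<le> H (\<tau> + of_int (M i), y) \<and> H (\<tau> + of_int (M i), y) \<le> max (P i) (P i - T)"
        if i: "i \<in> A" and y: "min (X i) (Y i) \<le> y" "y \<le> max (X i) (Y i)" for i y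
      proof -
        have H_le: "H (\<tau> + of_int (M i), a) \<le> H (\<tau> + of_int (M i), b)" if "a \<le> b" for a b
          using that by (intro H_mono) auto
        have "X i \<le> y \<or> Y i \<le> y" "y \<le> X i \<or> y \<le> Y i" using y by linarith+
        then show ?thesis using H_le[of "X i" y] H_le[of "Y i" y] H_le[of y "X i"] H_le[of y "Y i"] H_X[OF i] H_Y[OF i]
          by (auto simp: min_le_iff_disj le_max_iff_disj)
      qed
      have "H (\<tau> + of_int (M i), y) = H (\<tau> + of_int (M j), y - of_int l) + of_int l"
      proof -
        have "act 0 (M i - M j) l (\<tau> + of_int (M j), y - of_int l) = (\<tau> + of_int (M i), y)"
          by (simp add: act_def)
        then show ?thesis using H_act[of 0 "M i - M j" l "(\<tau> + of_int (M j), y - of_int l)"] by simp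
      qed
      then have near: "\<bar>P i - P j - of_int l\<bar> \<le> \<bar>T\<bar>"
        using between[OF ij(1) y(1,2)] between[OF ij(2) y(3,4)] by linarith
      have diff: "\<theta> i - \<theta> j = of_int (M i - M j) - of_int (int i - int j) * \<omega>"
        unfolding M[OF n(1)] M[OF n(2)] by (simp add: algebra_simps)
      have "P i - P j = slope * (\<theta> i - \<theta> j) + of_int (int i - int j) * \<rho>"
        unfolding P_def by (simp add: algebra_simps)
      \<comment> \<open>Both signs are recorded because \<open>closest\<close> speaks about positive
        times. The base points differ by less than 2 * e, which is the bound on the horizontal shift
        there.\<close>
      then have P: "P i - P j - of_int l = height (int i - int j) (M j - M i) (- l)"
        "P i - P j - of_int l = - height (int j - int i) (M i - M j) l"
        unfolding diff height_def by (simp_all add: algebra_simps)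
      have "\<bar>\<theta> i - \<theta> j\<bar> < 2 * e" using ij unfolding A_def by auto
      then have close: "\<bar>hshift (int i - int j) (M j - M i)\<bar> < 2 * e"
        "\<bar>hshift (int j - int i) (M i - M j)\<bar> < 2 * e"
        unfolding diff by (simp_all add: abs_if algebra_simps split: if_splits)
      consider "j < i" | "i < j" | "i = j" by linarith
      then show False
      proof cases
        case 1
        then have "\<bar>T\<bar> < \<bar>height (int i - int j) (M j - M i) (- l)\<bar>"
          unfolding T_def using n by (intro closest close) auto
        then show False using near P(1) by simp
      next
        case 2
        then have "\<bar>T\<bar> < \<bar>height (int j - int i) (M i - M j) l\<bar>"
          unfolding T_def using n by (intro closest close) auto
        then show False using near P(2) by simp
      next
        case 3
        then have "\<bar>real_of_int l\<bar> < 1" using near small(2) unfolding T_def by simp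
        then show False using ij(3) 3 by simp
      qed
    qed
  qed auto
  moreover have "(\<Sum>i\<in>A. ennreal (defect n m k i (\<theta> i) x))
    = ennreal (\<Sum>i\<in>A. \<bar>\<psi> (max (X i) (Y i)) - \<psi> (min (X i) (Y i))\<bar>)"
  proof (subst sum_ennreal[symmetric])
    have "defect n m k i (\<theta> i) x = \<bar>\<psi> (max (X i) (Y i)) - \<psi> (min (X i) (Y i))\<bar>"
      if "i \<in> A" for i
    proof -
      have "i < n" using that unfolding A_def by simp
      then show ?thesis unfolding defect_def iter_X[OF \<open>i < n\<close>] iter_Y[OF \<open>i < n\<close>] \<phi>_eq by (simp add: max_def min_def abs_minus_commute)
    qed
    then show "(\<Sum>i\<in>A. ennreal (defect n m k i (\<theta> i) x))
      = (\<Sum>i\<in>A. ennreal \<bar>\<psi> (max (X i) (Y i)) - \<psi> (min (X i) (Y i))\<bar>)" by (intro sum.cong) auto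
  qed simp
  ultimately show "(\<Sum>i\<in>{i \<in> {..<n}. fst c - e < \<theta> i \<and> \<theta> i < fst c + e}.
      ennreal (defect n m k i (\<theta> i) x))
    \<le> total_variation (\<lambda>x. ln (DF \<tau> x)) 0 1"
    unfolding A_def[symmetric] \<psi>_def[abs_def] by simp
qed simp

end

context smooth_wandering_qpf
begin

text \<open>The vertical derivatives of the \<open>n\<close>-th iterate at (\<theta>, x) and of the
  \<open>-n\<close>-th iterate at (\<theta> + \<alpha>, x) have product exp (u - v), with u and v
  the log derivatives at (\<theta>, x) and at its companion. The inequality of arithmetic and
  geometric means bounds their sum below by 2 * exp ((u - v) / 2), and \<bar>u - v\<bar> is at most
  the sum of the defects.\<close>

lemma return_area_bound:
  assumes e: "0 < e" "8 * e \<le> r" and return: "closest (2 * e) (int n) m k"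
    and V: "0 \<le> V" "(\<integral>\<^sup>+\<theta>\<in>{0..1}. total_variation (\<lambda>x. ln (DF \<theta> x)) 0 1 \<partial>lborel) = ennreal V"
  shows "ennreal (8 * e * e * exp (- (V / (4 * e)))) \<le> image_area e (int n) + image_area e (- int n)"
proof -
  \<comment> \<open>The sum of defects has integral at most V * 2 * e over a box of area 4 * e * e,
    so its mean is at most V / (2 * e); \<open>M\<close> is half of this.\<close>
  define M where "M = V / (4 * e)"
  have M: "0 \<le> M" "V = 4 * e * M" unfolding M_def using V e by simp_all
  define K where "K = 2 * exp (- M) * (1 + M)"
  have K: "0 \<le> K" unfolding K_def using M by simp
  define I where "I = {fst c - e<..<fst c + e}"
  define J where "J = {snd c - e..snd c + e}"
  have [measurable]: "I \<in> sets borel" "J \<in> sets borel" unfolding I_def J_def by simp_all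
  have emeasure_I: "emeasure lborel I = ennreal (2 * e)" unfolding I_def using e by simp
  have emeasure_J: "emeasure lborel J = ennreal (2 * e)" unfolding J_def using e by simp
  define \<alpha> where "\<alpha> = hshift (int n) m"
  define E where "E \<theta> x = (\<Sum>i<n. defect n m k i \<theta> x)" for \<theta> x
  have E0: "0 \<le> E \<theta> x" for \<theta> x unfolding E_def by (intro sum_nonneg) simp
  have E_cont: "continuous_on UNIV (\<lambda>z. E (fst z) (snd z))"
    unfolding E_def by (intro continuous_on_sum) (rule continuous_on_defect)
  have E_snd: "continuous_on UNIV (E \<theta>)" for \<theta>
    using continuous_on_compose2[OF E_cont, of UNIV "\<lambda>x. (\<theta>, x)"] by (simp add: continuous_intros)
  have E_meas1 [measurable]: "E \<theta> \<in> borel_measurable borel" for \<theta>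
    by (rule borel_measurable_continuous_onI[OF E_snd])
  have E_meas: "(\<lambda>z. E (fst z) (snd z)) \<in> borel_measurable (lborel \<Otimes>\<^sub>M lborel)"
  proof -
    have "(\<lambda>z. E (fst z) (snd z)) \<in> borel_measurable (borel :: (real \<times> real) measure)"
      by (rule borel_measurable_continuous_onI[OF E_cont])
    then show ?thesis by (simp add: lborel_prod)
  qed
  define a where "a \<theta> x = exp (log_deriv n (\<theta>, x))" for \<theta> x
  define b where "b \<theta> x = exp (- log_deriv n (preimage (int n) m k \<theta> x))" for \<theta> x
  \<comment> \<open>Expanding exp (- E / 2) by the tangent line at E = 2 * M makes the bound affine
    in \<open>E\<close>, so that the integral of \<open>E\<close> is all that is needed. It replaces
    Jensen's inequality.\<close>
  have pointwise: "K \<le> a \<theta> x + b \<theta> x + exp (- M) * E \<theta> x" for \<theta> x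
  proof -
    let ?u = "log_deriv n (\<theta>, x)" and ?v = "log_deriv n (preimage (int n) m k \<theta> x)"
    have "\<bar>?u - ?v\<bar> \<le> E \<theta> x"
      unfolding log_deriv_def E_def defect_def sum_subtractf[symmetric] by (rule sum_abs)
    then have "exp (- M) * (1 + (M - E \<theta> x / 2)) \<le> exp (- M) * exp (M - E \<theta> x / 2)"
      by (intro mult_left_mono exp_ge_add_one_self) simp
    also have "\<dots> = exp (- E \<theta> x / 2)" by (simp add: exp_add[symmetric])
    also have "\<dots> \<le> exp ((?u - ?v) / 2)" using \<open>\<bar>?u - ?v\<bar> \<le> E \<theta> x\<close> by (simp add: abs_le_iff)
    finally have "2 * (exp (- M) * (1 + (M - E \<theta> x / 2))) \<le> 2 * exp ((?u - ?v) / 2)" by simp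
    also have "\<dots> \<le> exp ?u + exp (- ?v)"
    proof -
      have "0 \<le> (exp (?u / 2) - exp (- ?v / 2))\<^sup>2" by simp
      also have "\<dots> = exp ?u + exp (- ?v) - 2 * exp ((?u - ?v) / 2)"
        by (simp add: power2_diff exp_double[symmetric] mult.assoc exp_add[symmetric] diff_divide_distrib)
      finally show ?thesis by simp
    qed
    finally show ?thesis unfolding K_def a_def b_def by (simp add: algebra_simps)
  qed
  have a_int: "(\<integral>\<^sup>+x\<in>J. ennreal (a \<theta> x) \<partial>lborel) = ennreal (image_length e (int n) \<theta>)" for \<theta>
    unfolding J_def image_length_def a_def
  proof (rule nn_integral_FTC_Icc)
    show "(\<lambda>x. exp (log_deriv n (\<theta>, x))) \<in> borel_measurable borel"
      by (intro borel_measurable_continuous_onI continuous_on_exp continuous_on_compose2[OF continuous_on_log_deriv[of UNIV]] continuous_intros) auto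
  qed (use e iter_has_derivative in auto)
  have b_meas [measurable]: "b \<theta> \<in> borel_measurable borel" for \<theta>
  proof -
    have "continuous_on UNIV (\<lambda>x. preimage (int n) m k \<theta> x)"
      using continuous_on_compose2[OF continuous_on_preimage[of UNIV "int n" m k], of UNIV "\<lambda>x. (\<theta>, x)"] by (simp add: continuous_intros)
    then show ?thesis unfolding b_def
      by (intro borel_measurable_continuous_onI continuous_on_exp continuous_on_minus continuous_on_compose2[OF continuous_on_log_deriv[of UNIV]]) auto
  qed
  have a_meas [measurable]: "a \<theta> \<in> borel_measurable borel" for \<theta>
    unfolding a_def
    by (intro borel_measurable_continuous_onI continuous_on_exp continuous_on_compose2[OF continuous_on_log_deriv[of UNIV]] continuous_intros) auto
  have b_int: "(\<integral>\<^sup>+x\<in>J. ennreal (b \<theta> x) \<partial>lborel) = ennreal (image_length e (- int n) (\<theta> + \<alpha>))" for \<theta>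
  proof -
    have "(\<integral>\<^sup>+x\<in>J. ennreal (b \<theta> x) \<partial>lborel)
      = ennreal (snd (preimage (int n) m k \<theta> (snd c + e)) - snd (preimage (int n) m k \<theta> (snd c - e)))"
      unfolding J_def b_def
    proof (rule nn_integral_FTC_Icc)
      show "(\<lambda>x. exp (- log_deriv n (preimage (int n) m k \<theta> x))) \<in> borel_measurable borel"
        using b_meas unfolding b_def .
    qed (use e preimage_has_derivative in auto)
    then show ?thesis unfolding snd_preimage image_length_def \<alpha>_def by simp
  qed
  have inner: "ennreal (K * (2 * e)) \<le> ennreal (image_length e (int n) \<theta>) + ennreal (image_length e (- int n) (\<theta> + \<alpha>))
      + ennreal (exp (- M)) * (\<integral>\<^sup>+x\<in>J. ennreal (E \<theta> x) \<partial>lborel)" for \<theta>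
  proof -
    have "ennreal (K * (2 * e)) = (\<integral>\<^sup>+x\<in>J. ennreal K \<partial>lborel)"
      using K e by (simp add: nn_integral_cmult_indicator emeasure_J ennreal_mult)
    also have "\<dots> \<le> (\<integral>\<^sup>+x. ennreal (a \<theta> x) * indicator J x + ennreal (b \<theta> x) * indicator J x + ennreal (exp (- M)) * (ennreal (E \<theta> x) * indicator J x) \<partial>lborel)"
    proof (rule nn_integral_mono)
      fix x
      have "ennreal K \<le> ennreal (a \<theta> x) + ennreal (b \<theta> x) + ennreal (exp (- M)) * ennreal (E \<theta> x)"
        using ennreal_leI[OF pointwise[of \<theta> x]] E0[of \<theta> x] unfolding a_def b_def
        by (simp add: ennreal_plus ennreal_mult)
      then show "ennreal K * indicator J x \<le> ennreal (a \<theta> x) * indicator J x + ennreal (b \<theta> x) * indicator J x + ennreal (exp (- M)) * (ennreal (E \<theta> x) * indicator J x)"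
        by (simp add: indicator_def)
    qed
    also have "\<dots> = (\<integral>\<^sup>+x\<in>J. ennreal (a \<theta> x) \<partial>lborel) + (\<integral>\<^sup>+x\<in>J. ennreal (b \<theta> x) \<partial>lborel)
      + ennreal (exp (- M)) * (\<integral>\<^sup>+x\<in>J. ennreal (E \<theta> x) \<partial>lborel)"
      by (simp add: nn_integral_add nn_integral_cmult)
    finally show ?thesis unfolding a_int b_int .
  qed
  have E_int: "(\<integral>\<^sup>+\<theta>\<in>I. (\<integral>\<^sup>+x\<in>J. ennreal (E \<theta> x) \<partial>lborel) \<partial>lborel) \<le> ennreal (V * (2 * e))"
  proof -
    \<comment> \<open>The bound on the defects integrates over \<theta> at fixed \<open>x\<close>,
      whereas lengths arise from integrating over \<open>x\<close> at fixed \<theta>; Fubini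
      connects the two.\<close>
    define f where "f \<theta> x = ennreal (E \<theta> x) * indicator I \<theta> * indicator J x" for \<theta> x
    have "case_prod f \<in> borel_measurable (lborel \<Otimes>\<^sub>M lborel)"
      unfolding f_def case_prod_beta using E_meas by measurable
    then have swap: "(\<integral>\<^sup>+x. (\<integral>\<^sup>+\<theta>. f \<theta> x \<partial>lborel) \<partial>lborel) = (\<integral>\<^sup>+\<theta>. (\<integral>\<^sup>+x. f \<theta> x \<partial>lborel) \<partial>lborel)"
      by (rule lborel_pair.Fubini')
    have "(\<integral>\<^sup>+\<theta>\<in>I. (\<integral>\<^sup>+x\<in>J. ennreal (E \<theta> x) \<partial>lborel) \<partial>lborel) = (\<integral>\<^sup>+\<theta>. (\<integral>\<^sup>+x. f \<theta> x \<partial>lborel) \<partial>lborel)"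
    proof (rule nn_integral_cong)
      fix \<theta>
      show "(\<integral>\<^sup>+x\<in>J. ennreal (E \<theta> x) \<partial>lborel) * indicator I \<theta> = (\<integral>\<^sup>+x. f \<theta> x \<partial>lborel)"
        by (cases "\<theta> \<in> I") (simp_all add: f_def)
    qed
    also have "\<dots> = (\<integral>\<^sup>+x. (\<integral>\<^sup>+\<theta>. f \<theta> x \<partial>lborel) \<partial>lborel)" by (rule swap[symmetric])
    also have "\<dots> \<le> (\<integral>\<^sup>+x\<in>J. ennreal V \<partial>lborel)"
    proof (rule nn_integral_mono)
      fix x
      show "(\<integral>\<^sup>+\<theta>. f \<theta> x \<partial>lborel) \<le> ennreal V * indicator J x"
      proof (cases "x \<in> J")
        case True
        then have x: "\<bar>x - snd c\<bar> \<le> e" unfolding J_def by auto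
        have "(\<integral>\<^sup>+\<theta>. f \<theta> x \<partial>lborel) = (\<integral>\<^sup>+\<theta>. (\<Sum>i<n. ennreal (defect n m k i \<theta> x) * indicator I \<theta>) \<partial>lborel)"
          using True unfolding f_def E_def by (simp add: sum_distrib_right[symmetric])
        also have "\<dots> = (\<Sum>i<n. \<integral>\<^sup>+\<theta>\<in>I. ennreal (defect n m k i \<theta> x) \<partial>lborel)"
          by (rule nn_integral_sum) measurable
        also have "\<dots> \<le> ennreal V"
          unfolding I_def V(2)[symmetric] by (rule distortion_integral_le[OF e return x])
        finally show ?thesis using True by simp
      next
        case False
        then show ?thesis unfolding f_def by simp
      qed
    qed
    also have "\<dots> = ennreal (V * (2 * e))"
      using V e by (simp add: nn_integral_cmult_indicator emeasure_J ennreal_mult)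
    finally show ?thesis .
  qed
  have I_wide: "indicator I \<theta> \<le> (indicator {fst c - 3 * e<..<fst c + 3 * e} \<theta> :: ennreal)" for \<theta>
    unfolding I_def using e by (auto simp: indicator_def)
  have area1: "(\<integral>\<^sup>+\<theta>\<in>I. ennreal (image_length e (int n) \<theta>) \<partial>lborel) \<le> image_area e (int n)"
    unfolding image_area_def by (intro nn_integral_mono mult_left_mono I_wide) simp
  have area2: "(\<integral>\<^sup>+\<theta>\<in>I. ennreal (image_length e (- int n) (\<theta> + \<alpha>)) \<partial>lborel) \<le> image_area e (- int n)"
  proof -
    have "image_area e (- int n) = (\<integral>\<^sup>+\<theta>. ennreal (image_length e (- int n) (\<alpha> + 1 * \<theta>)) * indicator {fst c - 3 * e<..<fst c + 3 * e} (\<alpha> + 1 * \<theta>) \<partial>lborel)"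
      unfolding image_area_def
      using nn_integral_real_affine[of "\<lambda>\<theta>. ennreal (image_length e (- int n) \<theta>) * indicator {fst c - 3 * e<..<fst c + 3 * e} \<theta>" 1 \<alpha>] by simp
    \<comment> \<open>A window of half-width \<open>e\<close> shifted by \<alpha>, with
      \<bar>\<alpha>\<bar> < 2 * e, stays within half-width 3 * e.\<close>
    moreover have "indicator I \<theta> \<le> (indicator {fst c - 3 * e<..<fst c + 3 * e} (\<alpha> + 1 * \<theta>) :: ennreal)" for \<theta>
      using return unfolding closest_def I_def \<alpha>_def[symmetric] by (auto simp: indicator_def)
    ultimately show ?thesis
      by (auto simp: add.commute intro!: nn_integral_mono mult_left_mono)
  qed
  have J_meas: "(\<lambda>\<theta>. \<integral>\<^sup>+x\<in>J. ennreal (E \<theta> x) \<partial>lborel) \<in> borel_measurable lborel"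
  proof -
    have "(\<lambda>(\<theta>, x). ennreal (E \<theta> x) * indicator J x) \<in> borel_measurable (lborel \<Otimes>\<^sub>M lborel)"
      unfolding case_prod_beta using E_meas by measurable
    then show ?thesis by (rule lborel.borel_measurable_nn_integral)
  qed
  have "ennreal (K * (2 * e) * (2 * e)) = (\<integral>\<^sup>+\<theta>\<in>I. ennreal (K * (2 * e)) \<partial>lborel)"
    using K e by (simp add: nn_integral_cmult_indicator emeasure_I flip: ennreal_mult)
  also have "\<dots> \<le> (\<integral>\<^sup>+\<theta>. ennreal (image_length e (int n) \<theta>) * indicator I \<theta> + ennreal (image_length e (- int n) (\<theta> + \<alpha>)) * indicator I \<theta>
      + ennreal (exp (- M)) * ((\<integral>\<^sup>+x\<in>J. ennreal (E \<theta> x) \<partial>lborel) * indicator I \<theta>) \<partial>lborel)"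
    using inner by (intro nn_integral_mono) (simp add: indicator_def)
  also have "\<dots> = (\<integral>\<^sup>+\<theta>\<in>I. ennreal (image_length e (int n) \<theta>) \<partial>lborel) + (\<integral>\<^sup>+\<theta>\<in>I. ennreal (image_length e (- int n) (\<theta> + \<alpha>)) \<partial>lborel)
      + ennreal (exp (- M)) * (\<integral>\<^sup>+\<theta>\<in>I. (\<integral>\<^sup>+x\<in>J. ennreal (E \<theta> x) \<partial>lborel) \<partial>lborel)"
    using J_meas by (simp add: nn_integral_add nn_integral_cmult)
  also have "\<dots> \<le> image_area e (int n) + image_area e (- int n) + ennreal (exp (- M)) * ennreal (V * (2 * e))"
    by (intro add_mono area1 area2 mult_left_mono E_int) simp
  finally have "ennreal (K * (2 * e) * (2 * e)) \<le> image_area e (int n) + image_area e (- int n) + ennreal (exp (- M) * (V * (2 * e)))"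
    using V e by (simp add: ennreal_mult)
  moreover have "K * (2 * e) * (2 * e) = 8 * e * e * exp (- M) + exp (- M) * (V * (2 * e))"
    unfolding K_def M(2) by (simp add: algebra_simps)
  ultimately have "ennreal (8 * e * e * exp (- M)) + ennreal (exp (- M) * (V * (2 * e)))
      \<le> image_area e (int n) + image_area e (- int n) + ennreal (exp (- M) * (V * (2 * e)))"
    using V e by (simp add: ennreal_plus)
  then have "ennreal (exp (- M) * (V * (2 * e))) + ennreal (8 * e * e * exp (- M))
      \<le> ennreal (exp (- M) * (V * (2 * e))) + (image_area e (int n) + image_area e (- int n))"
    by (simp only: add.commute)
  then show ?thesis unfolding M_def[symmetric] ennreal_add_left_cancel_le by simp
qed

text \<open>For finite variation every closest return contributes at least \<kappa>, independent of
  \<open>n\<close>, to the areas at times \<open>n\<close> and \<open>-n\<close>. There are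
  infinitely many such returns, but any finite family of distinct images has total area at most
  1.\<close>

lemma infinite_variation:
  "(\<integral>\<^sup>+\<theta>\<in>{0..1}. total_variation (\<lambda>x. ln (DF \<theta> x)) 0 1 \<partial>lborel) = \<infinity>"
proof (rule ccontr)
  assume "\<not> ?thesis"
  then obtain V where V: "0 \<le> V" "(\<integral>\<^sup>+\<theta>\<in>{0..1}. total_variation (\<lambda>x. ln (DF \<theta> x)) 0 1 \<partial>lborel) = ennreal V"
    by (metis ennreal_cases infinity_ennreal_def)
  obtain e where e: "0 < e" "8 * e \<le> r"
    and nz: "\<And>n m k. 1 \<le> n \<Longrightarrow> \<bar>hshift n m\<bar> < 2 * e \<Longrightarrow> height n m k \<noteq> 0"
    using height_nonzero by blast
  define \<kappa> where "\<kappa> = 8 * e * e * exp (- (V / (4 * e)))"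
  have \<kappa>: "0 < \<kappa>" unfolding \<kappa>_def using e by simp
  define R where "R = {n. 1 \<le> n \<and> ennreal \<kappa> \<le> image_area e n + image_area e (- n)}"
  have unbounded: "\<exists>n\<in>R. N < n" for N
  proof -
    have "0 < 2 * e" "2 * e \<le> 1" using e r by simp_all
    then show ?thesis
    proof (rule closest_return[of "2 * e" N])
      show "height n m k \<noteq> 0" if "1 \<le> n" "\<bar>hshift n m\<bar> < 2 * e" for n m k
        using nz that by blast
    next
      fix n m k
      assume n: "N < n" "closest (2 * e) n m k"
      have "1 \<le> n" using n(2) unfolding closest_def by blast
      then have nat_n: "int (nat n) = n" by simp
      have "ennreal \<kappa> \<le> image_area e n + image_area e (- n)"
        unfolding \<kappa>_def using return_area_bound[OF e, of "nat n" m k V, unfolded nat_n, OF n(2) V] .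
      then have "n \<in> R" unfolding R_def using \<open>1 \<le> n\<close> by simp
      then show "\<exists>n\<in>R. N < n" using n(1) by blast
    qed
  qed
  have "infinite R"
  proof
    assume "finite R"
    moreover obtain n where "n \<in> R" "Max R < n" using unbounded by blast
    ultimately show False using Max_ge by fastforce
  qed
  obtain N :: nat where N: "1 < real N * \<kappa>" using reals_Archimedean3[OF \<kappa>] by blast
  obtain S where S: "S \<subseteq> R" "finite S" "card S = N" using infinite_arbitrarily_large[OF \<open>infinite R\<close>] by blast
  have pos: "1 \<le> n" if "n \<in> S" for n using S(1) that unfolding R_def by blast
  have disj: "S \<inter> uminus ` S = {}"
  proof (rule ccontr)
    assume "\<not> ?thesis"
    then obtain n where "n \<in> S" "- n \<in> S" by auto
    then show False using pos[of n] pos[of "- n"] by linarith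
  qed
  have "ennreal (real N * \<kappa>) = (\<Sum>n\<in>S. ennreal \<kappa>)"
    using S(3) \<kappa> by (simp add: ennreal_mult ennreal_of_nat_eq_real_of_nat)
  also have "\<dots> \<le> (\<Sum>n\<in>S. image_area e n + image_area e (- n))"
    using S(1) unfolding R_def by (intro sum_mono) blast
  also have "\<dots> = (\<Sum>n\<in>S. image_area e n) + (\<Sum>n\<in>uminus ` S. image_area e n)"
    by (simp add: sum.distrib sum.reindex)
  also have "\<dots> = (\<Sum>n\<in>S \<union> uminus ` S. image_area e n)"
    using disj S(2) by (simp add: sum.union_disjoint)
  also have "\<dots> \<le> 1" by (rule sum_image_area_le_1[OF e]) (use S(2) in simp)
  finally show False using N \<kappa> by simp
qed

end

text \<open>Dividing by the common divisor, with the sign that makes the coefficient of \<rho>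
  positive, gives v * \<rho> = u * \<omega> + w without common factor. Splitting off p = gcd v u
  leaves \<open>q\<close> and \<open>k\<close> coprime, and \<open>p\<close> is coprime to
  \<open>w\<close> because all three coefficients have no common factor.\<close>

lemma (in bounded_qpf) resonance_reduced:
  fixes a b d :: int
  assumes rel: "of_int a * \<rho> + of_int b * \<omega> + of_int d = 0" and nonzero: "\<not> (a = 0 \<and> b = 0 \<and> d = 0)"
  obtains p q k w where "resonant_qpf \<omega> F \<rho> C p q k w"
proof -
  have "a \<noteq> 0"
  proof
    assume "a = 0"
    then have "of_int b * \<omega> + of_int d = 0" using rel by simp
    then have "b = 0" "d = 0" using irrational_int_eq_zero[OF irrational] by blast+
    then show False using nonzero \<open>a = 0\<close> by simp
  qed
  define g where "g = gcd (gcd a b) d"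
  have g: "g \<noteq> 0" unfolding g_def using \<open>a \<noteq> 0\<close> by simp
  define g' where "g' = (if 0 < a then g else - g)"
  define v where "v = a div g'"
  define u where "u = - (b div g')"
  define w where "w = - (d div g')"
  have "g dvd a" "g dvd b" "g dvd d" unfolding g_def by (meson dvd_trans gcd_dvd1 gcd_dvd2)+
  then have "g' dvd a" "g' dvd b" "g' dvd d" unfolding g'_def by auto
  then have abd: "a = g' * v" "b = - (g' * u)" "d = - (g' * w)" unfolding v_def u_def w_def by auto
  have g_pos: "0 < g" using g unfolding g_def by (simp add: less_le)
  have v: "0 < v"
  proof (cases "0 < a")
    case True
    then have "0 < g * v" using abd(1) unfolding g'_def by simp
    then show ?thesis using g_pos by (simp add: zero_less_mult_iff)
  next
    case False
    then have "g * v = - a" using abd(1) unfolding g'_def by simp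
    then have "0 < g * v" using False \<open>a \<noteq> 0\<close> by linarith
    then show ?thesis using g_pos by (simp add: zero_less_mult_iff)
  qed
  have "g = gcd (gcd (g' * v) (g' * u)) (g' * w)"
    unfolding g_def by (subst abd(1), subst abd(2), subst abd(3)) simp
  also have "gcd (g' * v) (g' * u) = \<bar>g' * gcd v u\<bar>"
    unfolding gcd_mult_distrib_int[symmetric] by (simp add: abs_mult)
  also have "gcd \<bar>g' * gcd v u\<bar> (g' * w) = gcd (g' * gcd v u) (g' * w)" by (rule gcd_abs1_int)
  also have "\<dots> = \<bar>g'\<bar> * gcd (gcd v u) w" by (rule gcd_mult_distrib_int[symmetric])
  also have "\<bar>g'\<bar> = g" unfolding g'_def using g_pos by simp
  finally have gcd1: "gcd (gcd v u) w = 1" using g by simp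
  have "of_int g' * (of_int v * \<rho> - of_int u * \<omega> - of_int w) = 0"
    using rel unfolding abd by (simp add: algebra_simps)
  moreover have "g' \<noteq> 0" unfolding g'_def using g by simp
  ultimately have rel': "of_int v * \<rho> = hshift u w" by simp
  define p where "p = gcd v u"
  have p: "0 < p" unfolding p_def using v by simp
  define q where "q = v div p"
  define k where "k = u div p"
  have vu: "v = p * q" "u = p * k" unfolding q_def k_def p_def by simp_all
  have q: "0 < q" using v p unfolding vu(1) by (simp add: zero_less_mult_iff)
  have "coprime q k" unfolding q_def k_def p_def using v by (intro div_gcd_coprime) simp
  have "resonant_qpf \<omega> F \<rho> C (nat p) (nat q) k w"
  proof unfold_locales
    show "1 \<le> nat p" "1 \<le> nat q" using p q by simp_all
    show "coprime k (int (nat q))" using \<open>coprime q k\<close> q by (simp add: coprime_commute)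
    show "coprime (int (nat p)) w" using gcd1 p unfolding p_def[symmetric] by (simp add: coprime_iff_gcd_eq_1)
    show "real (nat p * nat q) * \<rho> = real (nat p) * of_int k * \<omega> + of_int w"
      using rel' p q unfolding vu by simp
  qed
  then show ?thesis using that by blast
qed

theorem mainTheorem9:
  fixes \<omega> :: real and F :: "real \<Rightarrow> real \<Rightarrow> real"
  assumes "0 \<le> \<omega>" and "\<omega> < 1" and "\<omega> \<notin> \<rat>"
    and "in_TBV F"
    and "\<not> top_transitive (torus_map \<omega> F)"
  shows "\<exists>p q U. p \<ge> 1 \<and> q \<ge> 1 \<and> open_tube (torus_map \<omega> F) p q U \<and>
           (\<exists>k l :: int. rot_number \<omega> F = frac (real_of_int k / real q * \<omega> + real_of_int l / real (p * q)))"
proof -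
  from \<open>in_TBV F\<close> obtain DF where F: "\<And>\<theta> x. F (\<theta> + 1) x = F \<theta> x" "\<And>\<theta> x. F \<theta> (x + 1) = F \<theta> x + 1"
      "continuous_on UNIV (\<lambda>z. F (fst z) (snd z))"
    and DF: "continuous_on UNIV (\<lambda>z. DF (fst z) (snd z))" "\<And>\<theta> x. (F \<theta> has_real_derivative DF \<theta> x) (at x)" "\<And>\<theta> x. 0 < DF \<theta> x"
      "(\<integral>\<^sup>+ \<theta>\<in>{0..1}. total_variation (\<lambda>x. ln (DF \<theta> x)) 0 1 \<partial>lborel) < \<infinity>"
    unfolding in_TBV_def by blast
  interpret qpf \<omega> F
  proof
    show "F \<theta> x < F \<theta> y" if "x < y" for x y \<theta>
      using DERIV_pos_imp_increasing[OF that] DF(2,3) by blast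
  qed (fact assms F)+
  obtain u v s where s: "0 < s" and NT: "\<And>n m k z. 1 \<le> n \<Longrightarrow> z \<in> square v s \<Longrightarrow> act n m k z \<notin> square u s"
    using not_transitive_squares[OF assms(5)] by metis
  have "\<exists>\<rho> C. (\<forall>n z. \<bar>snd (iter n z) - snd z - of_int n * \<rho>\<bar> \<le> C) \<and> (\<lambda>n. snd (iter (int n) (0, 0)) / real n) \<longlonglongrightarrow> \<rho>"
    by (rule bounded_deviation[OF s NT]) blast+
  then obtain \<rho> C where dev: "\<And>n z. \<bar>snd (iter n z) - snd z - of_int n * \<rho>\<bar> \<le> C"
    and lim: "(\<lambda>n. snd (iter (int n) (0, 0)) / real n) \<longlonglongrightarrow> \<rho>"
    by blast
  interpret bounded_qpf \<omega> F \<rho> C by unfold_locales (rule dev)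
  have rot: "rot_number \<omega> F = frac \<rho>"
    unfolding rot_number_def using limI[OF lim] by (simp add: zpow_of_nat)
  have "\<exists>a b d :: int. of_int a * \<rho> + of_int b * \<omega> + of_int d = 0 \<and> \<not> (a = 0 \<and> b = 0 \<and> d = 0)"
  proof (rule ccontr)
    assume indep: "\<not> ?thesis"
    interpret independent_qpf \<omega> F \<rho> C by unfold_locales (use indep in blast)+
    have "\<exists>c t. 0 < t \<and> (\<forall>n m k z. 1 \<le> n \<longrightarrow> z \<in> square c t \<longrightarrow> act n m k z \<notin> square c t)"
    proof (rule ccontr)
      assume "\<not> ?thesis"
      then have "\<exists>n m k z. 1 \<le> n \<and> z \<in> square c t \<and> act n m k z \<in> square c t" if "0 < t" for c t
        using that by blast
      then show False using recurrent_imp_transitive[OF s, of v u] NT by blast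
    qed
    then obtain c t where t: "0 < t" "\<And>n m k z. 1 \<le> n \<Longrightarrow> z \<in> square c t \<Longrightarrow> act n m k z \<notin> square c t" by blast
    \<comment> \<open>A smaller box is still wandering, and half-side 1 / 2 separates it from its
      integer translates.\<close>
    have sub: "square c (min t (1 / 2)) \<subseteq> square c t" unfolding square_def by auto
    interpret smooth_wandering_qpf \<omega> F \<rho> C c "min t (1 / 2)" DF
    proof unfold_locales
      show "act n m k z \<notin> square c (min t (1 / 2))" if "1 \<le> n" "z \<in> square c (min t (1 / 2))" for n m k z
        using t(2)[OF that(1), of z m k] that(2) sub by blast
    qed (use t(1) DF(1-3) in simp_all)
    show False using infinite_variation DF(4) by simp
  qed
  then obtain p q k w where "resonant_qpf \<omega> F \<rho> C p q k w" using resonance_reduced by blast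
  then interpret resonant_qpf \<omega> F \<rho> C p q k w .
  have pq: "real p \<noteq> 0" "real q \<noteq> 0" using p_pos q_pos by simp_all
  have "\<rho> = (real p * of_int k * \<omega> + of_int w) / (real p * real q)" using resonance pq by (simp add: eq_divide_eq mult_ac)
  also have "\<dots> = of_int k / real q * \<omega> + of_int w / real (p * q)"
    using pq by (simp add: add_divide_distrib)
  finally have "rot_number \<omega> F = frac (of_int k / real q * \<omega> + of_int w / real (p * q))" using rot by simp
  then show ?thesis using open_tube_strip p_pos q_pos by blast
qed

end
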